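(* Let $\xi:M^m\to\mathbb{R}^{m+p}$ be a smooth map, let $x:M^m\to\mathbb{R}^{m+p}$ be an immersion, and let $F:M\times(-\varepsilon,\varepsilon)\to\mathbb{R}^{m+p}$ be a compact variation of $x$, with $x_t=F(\cdot,t)$. Write $V_\xi(t)=V_\xi(x_t)$ and $\bar V_\xi(t)=\bar V_\xi(x_t)$. Then $$V_\xi'(t)=-\int_M\Big\langle (H_t+x_t^\perp-\xi)+\nabla^t\big(\langle x_t,\xi\rangle-\tfrac12|\xi|^2\big),\frac{\partial F}{\partial t}\Big\rangle e^{-f_t}\,dV_t,$$ $$\bar V_\xi'(t)=-\int_M\Big\langle (H_t+x_t^\perp-\xi)+\nabla^t\langle x_t,\xi\rangle,\frac{\partial F}{\partial t}\Big\rangle e^{-\bar f_t}\,dV_t.$$ In particular, if $F$ is a normal variation, i.e. $\eta=\frac{\partial F}{\partial t}|_{t=0}$ is a (compactly supported) normal field along $x$, then $$V_\xi'(0)=-\int_M\langle H+x^\perp-\xi,\eta\rangle e^{-f}dV,\qquad \bar V_\xi'(0)=-\int_M\langle H+x^\perp-\xi,\eta\rangle e^{-\bar f}dV.$$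
   Context: For an immersion $y:M^m\to\mathbb{R}^{m+p}$ and a fixed map $\xi:M\to\mathbb{R}^{m+p}$, define $f_y=\tfrac12|y-\xi|^2$, $\bar f_y=f_y-\tfrac12|\xi|^2$, and $$V_\xi(y)=\int_M e^{-f_y}dV_y,\qquad \bar V_\xi(y)=\int_M e^{-\bar f_y}dV_y,$$ where $dV_y$ is the volume element of the metric induced by $y$. A variation of $x$ is a smooth map $F:M\times(-\varepsilon,\varepsilon)\to\mathbb{R}^{m+p}$ with $F(\cdot,0)=x$ and every $x_t=F(\cdot,t)$ an immersion. It is compact if there is a relatively compact open $B\subset M$ containing the support of $\partial F/\partial t(\cdot,t)$ for every $t$. Notation: $f_t=f_{x_t}$, $\bar f_t=\bar f_{x_t}$, $dV_t=dV_{x_t}$; $H_t$ is the (unnormalized, trace of the second fundamental form) mean curvature vector of $x_t$; $x_t^\perp$ is the component of the position vector $x_t$ normal to the immersion $x_t$; $\nabla^t$ is the gradient for the metric induced by $x_t$, regarded as an $\mathbb{R}^{m+p}$-valued field via $(x_t)_*$. At $t=0$ the index is dropped. The map $\xi$ does not depend on $t$. When $V_\xi$ or $\bar V_\xi$ is infinite, the derivative is understood as $\int_M\frac{\partial}{\partial t}(e^{-f_t}dV_t)$ (respectively with $\bar f_t$), which is an integral over a relatively compact set. *)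

theory Defs
  imports "HOL-Analysis.Analysis"
begin

section \<open>Smooth maps and smooth manifolds\<close>

text \<open>Meant for open \<open>S\<close> in a finite-dimensional space, where continuity of all iterated
  directional derivatives is the usual \<open>C\<^sup>k\<close> condition.\<close>

primrec Ck_on :: "nat \<Rightarrow> 'b::real_normed_vector set \<Rightarrow> ('b \<Rightarrow> 'c::real_normed_vector) \<Rightarrow> bool" where
  "Ck_on 0 S f \<longleftrightarrow> continuous_on S f"
| "Ck_on (Suc k) S f \<longleftrightarrow>
     (\<forall>u\<in>S. f differentiable (at u)) \<and> (\<forall>v. Ck_on k S (\<lambda>u. frechet_derivative f (at u) v))"

definition smooth_on :: "'b::real_normed_vector set \<Rightarrow> ('b \<Rightarrow> 'c::real_normed_vector) \<Rightarrow> bool" where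
  "smooth_on S f \<longleftrightarrow> (\<forall>k. Ck_on k S f)"

text \<open>The manifold is the whole type \<open>'a\<close> (used with sort \<open>{t2_space, second_countable_topology}\<close>),
  of dimension \<open>CARD('m)\<close>. A chart is a pair of its domain and its coordinate map; the values of the
  coordinate map outside the domain are irrelevant.\<close>

type_synonym ('a, 'm) chart = "'a set \<times> ('a \<Rightarrow> real^'m)"

definition chart_inv :: "('a, 'm::finite) chart \<Rightarrow> real^'m \<Rightarrow> 'a" where
  "chart_inv c = inv_into (fst c) (snd c)"

definition smooth_atlas :: "('a::topological_space, 'm::finite) chart set \<Rightarrow> bool" where
  "smooth_atlas A \<longleftrightarrow>
     (\<Union>c\<in>A. fst c) = UNIV \<and>
     (\<forall>c\<in>A. open (fst c) \<and> open (snd c ` fst c) \<and>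
        homeomorphism (fst c) (snd c ` fst c) (snd c) (chart_inv c)) \<and>
     (\<forall>c\<in>A. \<forall>d\<in>A. smooth_on (snd c ` (fst c \<inter> fst d)) (snd d \<circ> chart_inv c))"

definition smooth_map ::
  "('a, 'm::finite) chart set \<Rightarrow> ('a \<Rightarrow> 'b::real_normed_vector) \<Rightarrow> bool" where
  "smooth_map A f \<longleftrightarrow> (\<forall>c\<in>A. smooth_on (snd c ` fst c) (f \<circ> chart_inv c))"

definition immersion :: "('a, 'm::finite) chart set \<Rightarrow> ('a \<Rightarrow> real^'n) \<Rightarrow> bool" where
  "immersion A y \<longleftrightarrow> smooth_map A y \<and>
     (\<forall>c\<in>A. \<forall>p\<in>fst c. inj (frechet_derivative (y \<circ> chart_inv c) (at (snd c p))))"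

text \<open>Pointwise geometric quantities are computed in an arbitrarily selected chart around the point;
  the tensorial ones do not depend on the selection.\<close>

definition chart_at :: "('a, 'm::finite) chart set \<Rightarrow> 'a \<Rightarrow> ('a, 'm) chart" where
  "chart_at A p = (SOME c. c \<in> A \<and> p \<in> fst c)"

text \<open>\<open>chart_deriv A f p\<close> is the differential of \<open>f\<close> at \<open>p\<close>, with the tangent space of the manifold
  at \<open>p\<close> identified with \<open>real^'m\<close> through \<open>chart_at A p\<close>.\<close>

definition chart_deriv ::
  "('a, 'm::finite) chart set \<Rightarrow> ('a \<Rightarrow> 'b::real_normed_vector) \<Rightarrow> 'a \<Rightarrow> real^'m \<Rightarrow> 'b" where
  "chart_deriv A f p =
     frechet_derivative (f \<circ> chart_inv (chart_at A p)) (at (snd (chart_at A p) p))"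

section \<open>Extrinsic geometry of an immersion\<close>

definition partial :: "(real^'m \<Rightarrow> 'b::real_normed_vector) \<Rightarrow> 'm::finite \<Rightarrow> real^'m \<Rightarrow> 'b" where
  "partial f i u = frechet_derivative f (at u) (axis i 1)"

text \<open>The matrix \<open>(g\<^sub>i\<^sub>j)\<close> of the induced metric in the chart \<open>c\<close>, at the coordinate point \<open>u\<close>.\<close>

definition metric_matrix ::
  "('a, 'm::finite) chart \<Rightarrow> ('a \<Rightarrow> real^'n) \<Rightarrow> real^'m \<Rightarrow> real^'m^'m" where
  "metric_matrix c y u =
     (\<chi> i j. partial (y \<circ> chart_inv c) i u \<bullet> partial (y \<circ> chart_inv c) j u)"

definition volume_density ::
  "('a, 'm::finite) chart \<Rightarrow> ('a \<Rightarrow> real^'n) \<Rightarrow> real^'m \<Rightarrow> real" where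
  "volume_density c y u = sqrt (det (metric_matrix c y u))"

text \<open>The volume element \<open>dV\<^sub>y\<close>: the unique Borel measure that is \<open>sqrt (det g) du\<close> in every chart.\<close>

definition volume_measure ::
  "('a::topological_space, 'm::finite) chart set \<Rightarrow> ('a \<Rightarrow> real^'n) \<Rightarrow> 'a measure" where
  "volume_measure A y = (THE \<mu>. sets \<mu> = sets borel \<and>
     (\<forall>c\<in>A. \<forall>E\<in>sets borel. E \<subseteq> fst c \<longrightarrow>
        emeasure \<mu> E = (\<integral>\<^sup>+u\<in>snd c ` E. ennreal (volume_density c y u) \<partial>lborel)))"

text \<open>The tangent space of the immersion, as a subspace of the ambient Euclidean space.\<close>

definition tangent_space ::
  "('a, 'm::finite) chart set \<Rightarrow> ('a \<Rightarrow> real^'n) \<Rightarrow> 'a \<Rightarrow> (real^'n) set" where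
  "tangent_space A y p = range (chart_deriv A y p)"

definition normal_part ::
  "('a, 'm::finite) chart set \<Rightarrow> ('a \<Rightarrow> real^'n) \<Rightarrow> 'a \<Rightarrow> real^'n \<Rightarrow> real^'n" where
  "normal_part A y p v =
     v - (THE w. w \<in> tangent_space A y p \<and> (\<forall>s\<in>tangent_space A y p. orthogonal (v - w) s))"

definition normal_field ::
  "('a, 'm::finite) chart set \<Rightarrow> ('a \<Rightarrow> real^'n) \<Rightarrow> ('a \<Rightarrow> real^'n) \<Rightarrow> bool" where
  "normal_field A y \<eta> \<longleftrightarrow> (\<forall>p. \<forall>s\<in>tangent_space A y p. orthogonal (\<eta> p) s)"

text \<open>The second fundamental form evaluated on the coordinate fields \<open>i\<close> and \<open>j\<close> of
  \<open>chart_at A p\<close>: by the Gauss formula, the normal part of the second partial derivative.\<close>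

definition second_fundamental_form ::
  "('a, 'm::finite) chart set \<Rightarrow> ('a \<Rightarrow> real^'n) \<Rightarrow> 'a \<Rightarrow> 'm \<Rightarrow> 'm \<Rightarrow> real^'n" where
  "second_fundamental_form A y p i j = (let c = chart_at A p in
     normal_part A y p (partial (partial (y \<circ> chart_inv c) j) i (snd c p)))"

definition mean_curvature ::
  "('a, 'm::finite) chart set \<Rightarrow> ('a \<Rightarrow> real^'n) \<Rightarrow> 'a \<Rightarrow> real^'n" where
  "mean_curvature A y p = (let c = chart_at A p; ginv = matrix_inv (metric_matrix c y (snd c p)) in
     (\<Sum>i\<in>UNIV. \<Sum>j\<in>UNIV. (ginv $ i $ j) *\<^sub>R second_fundamental_form A y p i j))"

text \<open>The gradient of \<open>h\<close> for the metric induced by \<open>y\<close>, pushed forward by the differential of \<open>y\<close>: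
  the tangent vector \<open>w\<close> whose inner product with each \<open>dy(v)\<close> is \<open>dh(v)\<close>.\<close>

definition induced_gradient ::
  "('a, 'm::finite) chart set \<Rightarrow> ('a \<Rightarrow> real^'n) \<Rightarrow> ('a \<Rightarrow> real) \<Rightarrow> 'a \<Rightarrow> real^'n" where
  "induced_gradient A y h p =
     (THE w. w \<in> tangent_space A y p \<and> (\<forall>v. w \<bullet> chart_deriv A y p v = chart_deriv A h p v))"

section \<open>Weighted volumes and variations\<close>

definition potential :: "('a \<Rightarrow> real^'n) \<Rightarrow> ('a \<Rightarrow> real^'n) \<Rightarrow> 'a \<Rightarrow> real" where
  "potential \<xi> y p = (norm (y p - \<xi> p))\<^sup>2 / 2"

definition potential_bar :: "('a \<Rightarrow> real^'n) \<Rightarrow> ('a \<Rightarrow> real^'n) \<Rightarrow> 'a \<Rightarrow> real" where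
  "potential_bar \<xi> y p = potential \<xi> y p - (norm (\<xi> p))\<^sup>2 / 2"

text \<open>\<open>weighted_volume A (potential \<xi>) y\<close> and \<open>weighted_volume A (potential_bar \<xi>) y\<close> are
  \<open>V\<^sub>\<xi>(y)\<close> and its barred version; both may be infinite.\<close>

definition weighted_volume ::
  "('a::topological_space, 'm::finite) chart set \<Rightarrow> (('a \<Rightarrow> real^'n) \<Rightarrow> 'a \<Rightarrow> real) \<Rightarrow>
     ('a \<Rightarrow> real^'n) \<Rightarrow> ennreal" where
  "weighted_volume A f y = (\<integral>\<^sup>+p. ennreal (exp (- f y p)) \<partial>volume_measure A y)"

definition velocity :: "('a \<Rightarrow> real \<Rightarrow> real^'n) \<Rightarrow> real \<Rightarrow> 'a \<Rightarrow> real^'n" where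
  "velocity F t p = vector_derivative (F p) (at t)"

definition variation ::
  "('a, 'm::finite) chart set \<Rightarrow> ('a \<Rightarrow> real^'n) \<Rightarrow> real \<Rightarrow> ('a \<Rightarrow> real \<Rightarrow> real^'n) \<Rightarrow> bool" where
  "variation A x \<epsilon> F \<longleftrightarrow>
     (\<forall>c\<in>A. smooth_on ((snd c ` fst c) \<times> {-\<epsilon><..<\<epsilon>}) (\<lambda>(u, t). F (chart_inv c u) t)) \<and>
     (\<forall>p. F p 0 = x p) \<and>
     (\<forall>t\<in>{-\<epsilon><..<\<epsilon>}. immersion A (\<lambda>p. F p t))"

definition compact_variation ::
  "('a::topological_space, 'm::finite) chart set \<Rightarrow> ('a \<Rightarrow> real^'n) \<Rightarrow> real \<Rightarrow>
     ('a \<Rightarrow> real \<Rightarrow> real^'n) \<Rightarrow> bool" where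
  "compact_variation A x \<epsilon> F \<longleftrightarrow> variation A x \<epsilon> F \<and>
     (\<exists>B. open B \<and> compact (closure B) \<and>
        (\<forall>t\<in>{-\<epsilon><..<\<epsilon>}. closure {p. velocity F t p \<noteq> 0} \<subseteq> B))"

text \<open>The density, with respect to \<open>dV\<^sub>t\<close>, of the derivative at time \<open>t\<close> of the family of measures
  \<open>exp (-f\<^sub>s) dV\<^sub>s\<close>. The quotient of the two volume densities is \<open>dV\<^sub>s / dV\<^sub>t\<close>, which does not depend
  on the chart.\<close>

definition weighted_volume_element_deriv ::
  "('a, 'm::finite) chart set \<Rightarrow> (('a \<Rightarrow> real^'n) \<Rightarrow> 'a \<Rightarrow> real) \<Rightarrow>
     ('a \<Rightarrow> real \<Rightarrow> real^'n) \<Rightarrow> real \<Rightarrow> 'a \<Rightarrow> real" where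
  "weighted_volume_element_deriv A f F t p = (let c = chart_at A p; u = snd c p in
     deriv (\<lambda>s. exp (- f (\<lambda>q. F q s) p) *
                (volume_density c (\<lambda>q. F q s) u / volume_density c (\<lambda>q. F q t) u)) t)"

text \<open>\<open>D\<close> is the derivative at time \<open>t\<close> of the weighted volume along \<open>F\<close>, where for infinite volume
  this is by convention the integral of the derivative of the weighted volume element.\<close>

definition has_weighted_volume_deriv ::
  "('a::topological_space, 'm::finite) chart set \<Rightarrow> (('a \<Rightarrow> real^'n) \<Rightarrow> 'a \<Rightarrow> real) \<Rightarrow>
     ('a \<Rightarrow> real \<Rightarrow> real^'n) \<Rightarrow> real \<Rightarrow> real \<Rightarrow> bool" where
  "has_weighted_volume_deriv A f F t D \<longleftrightarrow>
     (if weighted_volume A f (\<lambda>p. F p t) < \<infinity>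
      then ((\<lambda>s. enn2real (weighted_volume A f (\<lambda>p. F p s))) has_real_derivative D) (at t)
      else has_bochner_integral (volume_measure A (\<lambda>p. F p t))
             (weighted_volume_element_deriv A f F t) D)"

end

theory Submission
  imports Defs
begin

text \<open>Write \<open>div X = \<Sum>\<^sub>i\<^sub>j g\<^sup>i\<^sup>j \<langle>\<partial>\<^sub>i X, \<partial>\<^sub>j y\<rangle>\<close> for the divergence along \<open>y = x\<^sub>t\<close> of a field \<open>X\<close> in the ambient
  space, tangent or not. By Jacobi's formula the density of the derivative of \<open>exp (-f\<^sub>t) dV\<^sub>t\<close> is
  \<open>exp (-f) (div \<eta> - \<langle>y - \<xi>, \<eta>\<rangle>)\<close>, where \<open>\<eta>\<close> is the velocity. Split \<open>\<eta> = \<tau> + \<nu>\<close> into tangent and normal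
  part. Differentiating \<open>\<langle>\<nu>, \<partial>\<^sub>j y\<rangle> = 0\<close> gives \<open>div \<nu> = - \<langle>H, \<eta>\<rangle>\<close>, and the product rule for
  \<open>exp (-f) \<tau>\<close> turns the density into \<open>div (exp (-f) \<tau>)\<close> minus the integrand of the theorem. The
  integral of the divergence of a compactly supported tangent field vanishes: a partition of unity
  reduces this to a single chart, where it is translation invariance of Lebesgue measure.

  Since \<open>div\<close> is the trace of an endomorphism of the tangent space, it does not depend on the chart;
  the mean curvature, which involves second derivatives, is only ever evaluated in \<open>chart_at A p\<close>.\<close>

section \<open>Gram matrices\<close>

text \<open>The volume may be infinite and the measure itself moves with the variation. Therefore t
  is fixed and every nearby weighted measure is written as a density \<open>weight t s\<close>
  against the single measure dV_t. The s-derivative of this density vanishes off one compact set,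
  the same for all s, and is bounded there by joint continuity in point and time. This dominates the
  difference quotients, carries finiteness of the volume from t to nearby times, and makes the
  integral of the derivative meaningful when the volume is infinite. The position vector and \<xi>
  enter the result differently for the following reason. With f = |y|^2/2 - k, the derivative of f
  along the tangent part tau of the velocity is <y, tau> - <grad k, tau>. The first term cancels the
  tangent part of y and leaves its normal part; derivatives of \<xi> occur only inside grad k, so
  \<xi> itself is never projected. Since \<open>chart_at\<close> jumps from point to point,
  continuity of a quantity defined through it (divergence, ratio of volume elements) is proved only
  after its independence of the chart. A C1 partition of unity suffices, because the divergence
  takes one derivative.\<close>

lemma matrix_inv_works:
  fixes G :: "real^'m^'m"
  assumes "det G \<noteq> 0"
  shows "G ** matrix_inv G = mat 1" "matrix_inv G ** G = mat 1"
proof -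
  have "\<exists>A'. G ** A' = mat 1 \<and> A' ** G = mat 1"
    using assms invertible_det_nz[of G] by (simp add: invertible_def)
  then have "G ** matrix_inv G = mat 1 \<and> matrix_inv G ** G = mat 1"
    unfolding matrix_inv_def by (rule someI_ex)
  then show "G ** matrix_inv G = mat 1" "matrix_inv G ** G = mat 1" by auto
qed

lemma matrix_inv_eqI:
  fixes G :: "real^'m^'m"
  assumes "G ** B = mat 1"
  shows "matrix_inv G = B"
proof -
  have "det G \<noteq> 0"
    using arg_cong[OF assms, of det] by (auto simp: det_mul)
  then show ?thesis
    by (metis assms matrix_inv_works(2) matrix_mul_assoc matrix_mul_lid matrix_mul_rid)
qed

lemma matrix_inv_symmetric:
  fixes G :: "real^'m^'m"
  assumes "det G \<noteq> 0" "transpose G = G"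
  shows "transpose (matrix_inv G) = matrix_inv G"
proof -
  have "transpose (matrix_inv G ** G) = mat 1"
    by (simp add: matrix_inv_works[OF assms(1)] transpose_mat)
  then show ?thesis
    by (metis matrix_inv_eqI assms(2) matrix_transpose_mul)
qed

text \<open>Cramer's rule for the j-th column of the inverse. It exhibits the entries as quotients
  of polynomials in the entries of \<open>G\<close>, from which their continuity and C1 dependence
  follow.\<close>

lemma matrix_inv_component:
  fixes G :: "real^'m^'m"
  assumes "det G \<noteq> 0"
  shows "matrix_inv G $ i $ j = det (\<chi> k l. if l = i then (if k = j then 1 else 0) else G $ k $ l) / det G"
proof -
  have "G *v (matrix_inv G *v axis j 1) = axis j 1"
    by (simp add: matrix_vector_mul_assoc matrix_inv_works[OF assms])
  then have *: "matrix_inv G *v axis j 1 = (\<chi> k. det(\<chi> i l. if l=k then axis j 1 $ i else G$i$l) / det G)"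
    using cramer[OF assms] by blast
  have "matrix_inv G $ i $ j = (matrix_inv G *v axis j 1) $ i"
    by (simp add: matrix_vector_mult_basis column_def)
  also have "\<dots> = det(\<chi> k l. if l=i then axis j 1 $ k else G$k$l) / det G"
    unfolding * by simp
  finally show ?thesis
    by (simp add: axis_def if_distrib cong: if_cong)
qed

text \<open>The segment \<open>P s\<close> from the identity to the Gram matrix consists of positive
  definite matrices, so the determinant starts at 1 and never vanishes along it; by the intermediate
  value theorem it stays positive.\<close>

lemma det_gram_pos:
  fixes Y :: "real^'m^'n"
  assumes "inj ((*v) Y)"
  shows "det (transpose Y ** Y) > 0"
proof -
  define G where "G = transpose Y ** Y"
  define P where "P = (\<lambda>s::real. (1 - s) *\<^sub>R (mat 1 :: real^'m^'m) + s *\<^sub>R G)"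
  have Gv: "v \<bullet> (G *v v) = (norm (Y *v v))\<^sup>2" for v
    unfolding G_def matrix_vector_mul_assoc[symmetric]
    by (metis dot_lmul_matrix power2_norm_eq_inner inner_commute transpose_matrix_vector)
  have nz: "det (P s) \<noteq> 0" if s: "s \<in> {0..1}" for s
  proof
    assume "det (P s) = 0"
    then have "\<not> (\<exists>B. B ** P s = mat 1)"
      using invertible_det_nz[of "P s"] invertible_left_inverse[of "P s"] by simp
    then obtain v where v: "v \<noteq> 0" "P s *v v = 0"
      unfolding matrix_left_invertible_ker by auto
    have "v \<bullet> (P s *v v) = (1 - s) * (norm v)\<^sup>2 + s * (norm (Y *v v))\<^sup>2"
      unfolding P_def
      by (simp add: matrix_vector_mult_add_rdistrib scaleR_matrix_vector_assoc[symmetric]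
          inner_add_right Gv power2_norm_eq_inner)
    moreover have "norm (Y *v v) > 0"
      using assms v(1) by (metis injD matrix_vector_mult_0_right zero_less_norm_iff)
    moreover have "norm v > 0" using v by simp
    ultimately have "v \<bullet> (P s *v v) > 0"
      \<comment> \<open>For \<open>s < 1\<close> the identity part is already positive; at
        \<open>s = 1\<close> it is gone and injectivity of \<open>Y\<close> is what remains.\<close>
      using s by (cases "s = 1") (auto intro!: add_pos_nonneg mult_pos_pos)
    then show False using v by simp
  qed
  have "continuous_on {0..1} (\<lambda>s. det (P s))"
    unfolding P_def det_def by (intro continuous_intros)
  moreover have "det (P 0) = 1" by (simp add: P_def)
  ultimately have "det (P 1) > 0"
  proof (intro ccontr[of "det (P 1) > 0"])
    assume c: "continuous_on {0..1} (\<lambda>s. det (P s))" and d: "det (P 0) = 1" and "\<not> det (P 1) > 0"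
    then have "\<exists>s\<ge>0. s \<le> 1 \<and> det (P s) = 0"
      by (intro IVT2') auto
    then show False using nz by auto
  qed
  then show ?thesis by (simp add: P_def G_def)
qed

text \<open>With G the Gram matrix of \<open>Y\<close>, the matrix
  \<open>Y ** matrix_inv G ** transpose Y\<close> is the orthogonal projection onto the column space
  of \<open>Y\<close>; the residual is therefore orthogonal to all columns.\<close>

lemma transpose_mult_gram_residual:
  fixes Y :: "real^'m^'n"
  assumes "det (transpose Y ** Y) \<noteq> 0"
  shows "transpose Y *v (v - Y *v (matrix_inv (transpose Y ** Y) *v (transpose Y *v v))) = 0"
proof -
  have "transpose Y *v (Y *v (matrix_inv (transpose Y ** Y) *v (transpose Y *v v))) =
      (transpose Y ** Y ** matrix_inv (transpose Y ** Y)) *v (transpose Y *v v)"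
    by (simp only: matrix_vector_mul_assoc matrix_mul_assoc)
  also have "\<dots> = transpose Y *v v"
    by (simp only: matrix_inv_works(1)[OF assms] matrix_vector_mul_lid)
  finally show ?thesis by (simp only: matrix_vector_mult_diff_distrib right_minus_eq)
qed

section \<open>The tangential trace\<close>

text \<open>For injective \<open>Y\<close> the matrix
  \<open>matrix_inv (transpose Y ** Y) ** transpose Y\<close> is the left inverse of
  \<open>Y\<close> that kills the orthogonal complement of its range. The trace is that of the
  endomorphism of the column space sending column i of \<open>Y\<close> to the projection of column
  i of \<open>X\<close>.\<close>

definition tangential_trace :: "real^'m^'n \<Rightarrow> real^'m^'n \<Rightarrow> real" where
  "tangential_trace Y X = trace (matrix_inv (transpose Y ** Y) ** (transpose Y ** X))"

lemma tangential_trace_eq_sum: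
  "tangential_trace Y X =
     (\<Sum>i\<in>UNIV. \<Sum>j\<in>UNIV. matrix_inv (transpose Y ** Y) $ i $ j * (column j Y \<bullet> column i X))"
  unfolding tangential_trace_def trace_def matrix_matrix_mult_def[of "matrix_inv _"]
  by (simp add: matrix_matrix_mult_def transpose_def column_def inner_vec_def)

text \<open>A change of coordinates multiplies both Jacobians on the right by \<open>J\<close>,
  which merely conjugates the matrix under the trace. This is the source of the chart independence
  of the divergence.\<close>

lemma tangential_trace_mult_right:
  fixes Y X :: "real^'m^'n" and J :: "real^'m^'m"
  assumes Y: "det (transpose Y ** Y) \<noteq> 0" and J: "det J \<noteq> 0"
  shows "tangential_trace (Y ** J) (X ** J) = tangential_trace Y X"
proof -
  define G where "G = transpose Y ** Y"
  define J' where "J' = matrix_inv J"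
  define G' where "G' = matrix_inv G"
  have J': "J ** J' = mat 1" "J' ** J = mat 1" and G': "G ** G' = mat 1"
    using matrix_inv_works J Y by (auto simp: J'_def G'_def G_def)
  have tJ: "transpose J ** transpose J' = mat 1"
    by (metis J'(2) matrix_transpose_mul transpose_mat)
  have tJ': "transpose J' ** transpose J = mat 1"
    by (metis J'(1) matrix_transpose_mul transpose_mat)
  have "(transpose (Y ** J) ** (Y ** J)) ** (J' ** G' ** transpose J') =
      transpose J ** (G ** ((J ** J') ** G') ** transpose J')"
    by (simp add: matrix_transpose_mul G_def matrix_mul_assoc)
  also have "\<dots> = mat 1" by (simp add: J' G' tJ)
  finally have "matrix_inv (transpose (Y ** J) ** (Y ** J)) = J' ** G' ** transpose J'"
    by (rule matrix_inv_eqI)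
  then have "tangential_trace (Y ** J) (X ** J) =
      trace (J' ** (G' ** (transpose J' ** transpose J) ** (transpose Y ** X) ** J))"
    by (simp add: tangential_trace_def matrix_transpose_mul matrix_mul_assoc)
  also have "\<dots> = trace ((G' ** (transpose Y ** X) ** J) ** J')"
    by (subst trace_mul_sym) (simp add: tJ')
  also have "\<dots> = trace (G' ** (transpose Y ** X) ** (J ** J'))"
    by (simp add: matrix_mul_assoc)
  finally show ?thesis
    by (simp add: J' tangential_trace_def G'_def G_def)
qed

section \<open>Jacobi's formula\<close>

text \<open>In the Leibniz expansion a permutation other than the identity moves at least two
  indices. After one factor is differentiated, an off-diagonal entry of the identity matrix is still
  left among the others, so only the diagonal product contributes.\<close>

lemma has_real_derivative_det_at_mat_1:
  fixes M :: "real \<Rightarrow> real^'m^'m"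
  assumes M: "\<And>i j. ((\<lambda>s. M s $ i $ j) has_real_derivative M' $ i $ j) (at t)"
    and t: "M t = mat 1"
  shows "((\<lambda>s. det (M s)) has_real_derivative trace M') (at t)"
proof -
  have "((\<lambda>s. det (M s)) has_real_derivative
     (\<Sum>p\<in>{p. p permutes (UNIV::'m set)}. of_int (sign p) *
        (\<Sum>i\<in>UNIV. M' $ i $ p i * (\<Prod>j\<in>UNIV - {i}. M t $ j $ p j)))) (at t)"
    unfolding det_def
    by (intro DERIV_sum DERIV_cmult has_field_derivative_prod M)
  also have "(\<Sum>p\<in>{p. p permutes (UNIV::'m set)}. of_int (sign p) *
        (\<Sum>i\<in>UNIV. M' $ i $ p i * (\<Prod>j\<in>UNIV - {i}. M t $ j $ p j))) =
     (\<Sum>p\<in>{p. p permutes (UNIV::'m set)}. if p = id then trace M' else 0)"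
  proof (intro sum.cong refl)
    fix p :: "'m \<Rightarrow> 'm" assume p: "p \<in> {p. p permutes UNIV}"
    have off: "(\<Prod>j\<in>UNIV - {i}. M t $ j $ p j) = 0" if "p \<noteq> id" for i
    proof -
      obtain j where j: "p j \<noteq> j" using \<open>p \<noteq> id\<close> by (auto simp: fun_eq_iff)
      have "p (p j) \<noteq> p j"
        using p j by (metis mem_Collect_eq permutes_inj injD)
      with j obtain k where k: "k \<noteq> i" "p k \<noteq> k" by (cases "j = i") auto
      show ?thesis
        by (rule prod_zero) (use k in \<open>auto simp: t mat_def intro!: bexI[of _ k]\<close>)
    qed
    show "of_int (sign p) * (\<Sum>i\<in>UNIV. M' $ i $ p i * (\<Prod>j\<in>UNIV - {i}. M t $ j $ p j))
        = (if p = id then trace M' else 0)"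
    proof (cases "p = id")
      case False
      then show ?thesis by (simp add: off[OF False])
    qed (auto simp: trace_def t mat_def sign_id)
  qed
  also have "\<dots> = trace M'"
    by (subst sum.delta) (auto simp: permutes_id)
  finally show ?thesis .
qed

text \<open>Multiplication by the constant inverse of \<open>G t\<close> moves the base point to the
  identity matrix.\<close>

lemma has_real_derivative_det:
  fixes G :: "real \<Rightarrow> real^'m^'m"
  assumes G: "\<And>i j. ((\<lambda>s. G s $ i $ j) has_real_derivative G' $ i $ j) (at t)"
    and t: "det (G t) \<noteq> 0"
  shows "((\<lambda>s. det (G s)) has_real_derivative det (G t) * trace (matrix_inv (G t) ** G')) (at t)"
proof -
  define B where "B = matrix_inv (G t)"
  have B: "G t ** B = mat 1" "B ** G t = mat 1"
    using matrix_inv_works[OF t] by (auto simp: B_def)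
  have "((\<lambda>s. det (B ** G s)) has_real_derivative trace (B ** G')) (at t)"
  proof (rule has_real_derivative_det_at_mat_1)
    fix i j
    show "((\<lambda>s. (B ** G s) $ i $ j) has_real_derivative (B ** G') $ i $ j) (at t)"
      unfolding matrix_matrix_mult_def by (simp, intro DERIV_sum DERIV_cmult G)
  qed (rule B)
  then have "((\<lambda>s. det (G t) * det (B ** G s)) has_real_derivative det (G t) * trace (B ** G')) (at t)"
    by (rule DERIV_cmult)
  moreover have "det (G t) * det (B ** G s) = det (G s)" for s
    by (metis B(1) det_mul matrix_mul_assoc matrix_mul_lid)
  ultimately show ?thesis by (simp add: B_def)
qed

lemma has_real_derivative_sqrt_det:
  fixes G :: "real \<Rightarrow> real^'m^'m"
  assumes G: "\<And>i j. ((\<lambda>s. G s $ i $ j) has_real_derivative G' $ i $ j) (at t)"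
    and t: "det (G t) > 0"
  shows "((\<lambda>s. sqrt (det (G s))) has_real_derivative
    sqrt (det (G t)) * (trace (matrix_inv (G t) ** G') / 2)) (at t)"
proof -
  have "((\<lambda>s. sqrt (det (G s))) has_real_derivative
    inverse (sqrt (det (G t))) / 2 * (det (G t) * trace (matrix_inv (G t) ** G'))) (at t)"
    using t by (intro DERIV_chain2[OF DERIV_real_sqrt] has_real_derivative_det G) auto
  also have "inverse (sqrt (det (G t))) / 2 * (det (G t) * trace (matrix_inv (G t) ** G')) =
     sqrt (det (G t)) * (trace (matrix_inv (G t) ** G') / 2)"
    using t by (simp add: field_simps)
  finally show ?thesis .
qed

text \<open>The two summands in the derivative of the Gram matrix are transposes of each other and
  have equal trace against the symmetric inverse. Their sum cancels the factor 1/2 coming from the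
  square root.\<close>

lemma trace_matrix_inv_gram_deriv:
  fixes Y X :: "real^'m^'n"
  assumes "det (transpose Y ** Y) \<noteq> 0"
  shows "trace (matrix_inv (transpose Y ** Y) ** (transpose X ** Y + transpose Y ** X)) / 2 = tangential_trace Y X"
proof -
  define G where "G = matrix_inv (transpose Y ** Y)"
  have sym: "transpose G = G" unfolding G_def
    by (rule matrix_inv_symmetric[OF assms]) (simp add: matrix_transpose_mul)
  have tt: "trace (transpose B) = trace B" for B :: "real^'m^'m"
    by (simp add: trace_def transpose_def)
  have "trace (G ** (transpose X ** Y)) = trace (transpose (G ** (transpose X ** Y)))" by (simp add: tt)
  also have "\<dots> = trace ((transpose Y ** X) ** G)" by (simp add: matrix_transpose_mul sym)
  also have "\<dots> = trace (G ** (transpose Y ** X))" by (rule trace_mul_sym)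
  finally show ?thesis
    by (simp add: tangential_trace_def G_def[symmetric] matrix_add_ldistrib trace_add)
qed

section \<open>Continuously differentiable maps\<close>

text \<open>Smoothness is used only to see that the data and their first derivatives are C1. All
  later constructions need closure rules at this one level, without induction over the order of
  differentiability.\<close>

definition C1_on :: "'b::real_normed_vector set \<Rightarrow> ('b \<Rightarrow> 'c::real_normed_vector) \<Rightarrow> bool" where
  "C1_on S f \<longleftrightarrow> Ck_on (Suc 0) S f"

lemma C1_onI:
  assumes "\<And>u. u \<in> S \<Longrightarrow> (f has_derivative f' u) (at u)" "\<And>v. continuous_on S (\<lambda>u. f' u v)"
  shows "C1_on S f"
proof -
  have *: "frechet_derivative f (at u) = f' u" if "u \<in> S" for u
    using frechet_derivative_at[OF assms(1)[OF that]] by simp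
  have "continuous_on S (\<lambda>u. frechet_derivative f (at u) v)" for v
    using assms(2)[of v] by (rule continuous_on_eq) (simp add: *)
  then show ?thesis
    unfolding C1_on_def using assms(1) by (auto simp: differentiable_def)
qed

lemma C1_on_has_derivative:
  "C1_on S f \<Longrightarrow> u \<in> S \<Longrightarrow> (f has_derivative frechet_derivative f (at u)) (at u)"
  by (auto simp: C1_on_def frechet_derivative_works)

lemma C1_on_differentiable: "C1_on S f \<Longrightarrow> u \<in> S \<Longrightarrow> f differentiable (at u)"
  by (auto simp: C1_on_def)

lemma C1_on_continuous_deriv: "C1_on S f \<Longrightarrow> continuous_on S (\<lambda>u. frechet_derivative f (at u) v)"
  by (auto simp: C1_on_def)

lemma C1_on_imp_continuous_on: "C1_on S f \<Longrightarrow> continuous_on S f"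
  by (auto intro!: continuous_at_imp_continuous_on differentiable_imp_continuous_within C1_on_differentiable)

lemma C1_on_subset: "C1_on S f \<Longrightarrow> T \<subseteq> S \<Longrightarrow> C1_on T f"
  by (auto simp: C1_on_def intro: continuous_on_subset)

lemma C1_on_cong:
  assumes "open S" "C1_on S f" "\<And>u. u \<in> S \<Longrightarrow> f u = g u"
  shows "C1_on S g"
proof (rule C1_onI)
  show "(g has_derivative frechet_derivative f (at u)) (at u)" if "u \<in> S" for u
    using has_derivative_transform_within_open[OF C1_on_has_derivative[OF assms(2) that] assms(1) that] assms(3)
    by blast
qed (rule C1_on_continuous_deriv[OF assms(2)])

lemma C1_on_local:
  assumes "\<And>u. u \<in> S \<Longrightarrow> \<exists>T. open T \<and> u \<in> T \<and> C1_on T f"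
  shows "C1_on S f"
proof (rule C1_onI)
  show "(f has_derivative frechet_derivative f (at u)) (at u)" if "u \<in> S" for u
    using assms[OF that] C1_on_has_derivative by blast
  show "continuous_on S (\<lambda>u. frechet_derivative f (at u) v)" for v
  proof (intro continuous_at_imp_continuous_on ballI)
    fix u assume "u \<in> S"
    with assms obtain T where "open T" "u \<in> T" "C1_on T f" by blast
    then show "isCont (\<lambda>u. frechet_derivative f (at u) v) u"
      using C1_on_continuous_deriv continuous_on_eq_continuous_at by blast
  qed
qed

lemma C1_on_const [intro]: "C1_on S (\<lambda>u. c)"
  by (rule C1_onI[where f' = "\<lambda>u v. 0"]) auto

lemma C1_on_id [intro]: "C1_on S (\<lambda>u. u)"
  by (rule C1_onI[where f' = "\<lambda>u v. v"]) auto

lemma C1_on_bounded_linear: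
  assumes "bounded_linear L" "C1_on S f"
  shows "C1_on S (\<lambda>u. L (f u))"
  by (rule C1_onI[OF bounded_linear.has_derivative[OF assms(1) C1_on_has_derivative[OF assms(2)]]])
    (auto intro: bounded_linear.continuous_on[OF assms(1)] C1_on_continuous_deriv[OF assms(2)])

lemma C1_on_add [intro]:
  assumes "C1_on S f" "C1_on S g"
  shows "C1_on S (\<lambda>u. f u + g u)"
  by (rule C1_onI[OF has_derivative_add[OF C1_on_has_derivative[OF assms(1)] C1_on_has_derivative[OF assms(2)]]])
    (auto intro!: continuous_on_add C1_on_continuous_deriv assms)

lemma C1_on_minus [intro]: "C1_on S f \<Longrightarrow> C1_on S (\<lambda>u. - f u)"
  by (rule C1_on_bounded_linear[OF bounded_linear_minus[OF bounded_linear_ident]])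

lemma C1_on_diff [intro]: "C1_on S f \<Longrightarrow> C1_on S g \<Longrightarrow> C1_on S (\<lambda>u. f u - g u)"
  using C1_on_add[OF _ C1_on_minus, of S f g] by simp

lemma C1_on_sum [intro]:
  assumes "\<And>i. i \<in> I \<Longrightarrow> C1_on S (f i)"
  shows "C1_on S (\<lambda>u. \<Sum>i\<in>I. f i u)"
  using assms by (induction I rule: infinite_finite_induct) (auto intro!: C1_on_add)

lemma C1_on_bilinear:
  assumes "bounded_bilinear bl" "C1_on S f" "C1_on S g"
  shows "C1_on S (\<lambda>u. bl (f u) (g u))"
  by (rule C1_onI[OF bounded_bilinear.FDERIV[OF assms(1) C1_on_has_derivative[OF assms(2)] C1_on_has_derivative[OF assms(3)]]],
      assumption, assumption)
    (intro continuous_on_add bounded_bilinear.continuous_on[OF assms(1)]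
       C1_on_continuous_deriv[OF assms(2)] C1_on_continuous_deriv[OF assms(3)]
       C1_on_imp_continuous_on[OF assms(2)] C1_on_imp_continuous_on[OF assms(3)])

lemmas C1_on_scaleR [intro] = C1_on_bilinear[OF bounded_bilinear_scaleR]
lemmas C1_on_mult [intro] = C1_on_bilinear[OF bounded_bilinear_mult]
lemmas C1_on_inner [intro] = C1_on_bilinear[OF bounded_bilinear_inner]

lemma C1_on_prod [intro]:
  fixes f :: "'i \<Rightarrow> 'b::real_normed_vector \<Rightarrow> real"
  assumes "\<And>i. i \<in> I \<Longrightarrow> C1_on S (f i)"
  shows "C1_on S (\<lambda>u. \<Prod>i\<in>I. f i u)"
  using assms by (induction I rule: infinite_finite_induct) (auto intro!: C1_on_mult)

text \<open>\<open>C1_on\<close> gives continuity of the derivative in each fixed direction only. In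
  finite dimension a varying direction is expanded in the basis, which restores joint continuity;
  the chain rule for C1 maps rests on this.\<close>

lemma continuous_on_deriv_comp:
  fixes f :: "'b::topological_space \<Rightarrow> 'c::euclidean_space"
  assumes g: "C1_on T g" and f: "continuous_on S f" "f ` S \<subseteq> T" and w: "continuous_on S w"
  shows "continuous_on S (\<lambda>u. frechet_derivative g (at (f u)) (w u))"
proof -
  have "continuous_on S (\<lambda>u. \<Sum>b\<in>Basis. (w u \<bullet> b) *\<^sub>R frechet_derivative g (at (f u)) b)"
    by (intro continuous_intros w continuous_on_compose2[OF C1_on_continuous_deriv[OF g] f])
  moreover have "(\<Sum>b\<in>Basis. (w u \<bullet> b) *\<^sub>R frechet_derivative g (at (f u)) b)
      = frechet_derivative g (at (f u)) (w u)" if "u \<in> S" for u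
  proof -
    have "linear (frechet_derivative g (at (f u)))"
      using that f by (intro linear_frechet_derivative C1_on_differentiable[OF g]) auto
    then have "frechet_derivative g (at (f u)) (\<Sum>b\<in>Basis. (w u \<bullet> b) *\<^sub>R b) =
        (\<Sum>b\<in>Basis. (w u \<bullet> b) *\<^sub>R frechet_derivative g (at (f u)) b)"
      by (simp add: linear_sum linear_cmul)
    then show ?thesis by (simp add: euclidean_representation)
  qed
  ultimately show ?thesis by (rule continuous_on_eq)
qed

lemma C1_on_compose:
  fixes f :: "'b::real_normed_vector \<Rightarrow> 'c::euclidean_space"
  assumes "C1_on S f" "C1_on T g" "f ` S \<subseteq> T"
  shows "C1_on S (\<lambda>u. g (f u))"
proof (rule C1_onI)
  show "((\<lambda>u. g (f u)) has_derivative
      (\<lambda>v. frechet_derivative g (at (f u)) (frechet_derivative f (at u) v))) (at u)" if "u \<in> S" for u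
    using that assms by (intro has_derivative_compose[OF C1_on_has_derivative C1_on_has_derivative]) auto
  show "continuous_on S (\<lambda>u. frechet_derivative g (at (f u)) (frechet_derivative f (at u) v))" for v
    by (intro continuous_on_deriv_comp[OF assms(2) _ assms(3)] C1_on_imp_continuous_on C1_on_continuous_deriv assms)
qed

lemma C1_on_real_compose:
  fixes f :: "'b::real_normed_vector \<Rightarrow> real"
  assumes "C1_on S f" "\<And>u. u \<in> S \<Longrightarrow> (\<phi> has_real_derivative \<phi>' (f u)) (at (f u))"
    "continuous_on S (\<lambda>u. \<phi>' (f u))"
  shows "C1_on S (\<lambda>u. \<phi> (f u))"
proof (rule C1_onI)
  show "((\<lambda>u. \<phi> (f u)) has_derivative (\<lambda>v. \<phi>' (f u) * frechet_derivative f (at u) v)) (at u)" if "u \<in> S" for u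
    using has_derivative_compose[OF C1_on_has_derivative[OF assms(1) that] assms(2)[OF that, unfolded has_field_derivative_def]] .
qed (intro continuous_intros C1_on_continuous_deriv assms)

lemma C1_on_exp [intro]:
  fixes f :: "'b::real_normed_vector \<Rightarrow> real"
  assumes "C1_on S f" shows "C1_on S (\<lambda>u. exp (f u))"
  by (rule C1_on_real_compose[OF assms DERIV_exp]) (intro continuous_intros C1_on_imp_continuous_on assms)

lemma C1_on_inverse:
  fixes f :: "'b::real_normed_vector \<Rightarrow> real"
  assumes "C1_on S f" "\<And>u. u \<in> S \<Longrightarrow> f u \<noteq> 0" shows "C1_on S (\<lambda>u. inverse (f u))"
  by (rule C1_on_real_compose[OF assms(1) DERIV_inverse])
    (use assms in \<open>auto intro!: continuous_on_minus continuous_on_mult continuous_on_inverse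
      C1_on_imp_continuous_on[OF assms(1)]\<close>)

lemma C1_on_divide:
  fixes f g :: "'b::real_normed_vector \<Rightarrow> real"
  assumes "C1_on S f" "C1_on S g" "\<And>u. u \<in> S \<Longrightarrow> g u \<noteq> 0" shows "C1_on S (\<lambda>u. f u / g u)"
  using C1_on_mult[OF assms(1) C1_on_inverse[OF assms(2,3)]] by (simp add: divide_inverse)

lemma C1_on_sqrt:
  fixes f :: "'b::real_normed_vector \<Rightarrow> real"
  assumes "C1_on S f" "\<And>u. u \<in> S \<Longrightarrow> f u > 0" shows "C1_on S (\<lambda>u. sqrt (f u))"
proof (rule C1_on_real_compose[OF assms(1) DERIV_real_sqrt])
  have "continuous_on S f" by (rule C1_on_imp_continuous_on[OF assms(1)])
  then show "continuous_on S (\<lambda>u. inverse (sqrt (f u)) / 2)"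
    using assms(2) by (intro continuous_intros) force+
qed (rule assms(2))

lemma C1_on_det:
  fixes G :: "'b::real_normed_vector \<Rightarrow> real^'m^'m"
  assumes "\<And>i j. C1_on S (\<lambda>u. G u $ i $ j)"
  shows "C1_on S (\<lambda>u. det (G u))"
  unfolding det_def by (intro C1_on_sum C1_on_mult C1_on_const C1_on_prod assms)

lemma C1_on_matrix_inv:
  fixes G :: "'b::real_normed_vector \<Rightarrow> real^'m^'m"
  assumes G: "\<And>i j. C1_on S (\<lambda>u. G u $ i $ j)" and nz: "\<And>u. u \<in> S \<Longrightarrow> det (G u) \<noteq> 0" and "open S"
  shows "C1_on S (\<lambda>u. matrix_inv (G u) $ i $ j)"
proof (rule C1_on_cong[OF \<open>open S\<close>])
  have "C1_on S (\<lambda>u. (\<chi> k l. if l = i then (if k = j then 1 else 0) else G u $ k $ l) $ a $ b)" for a b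
    using G by (cases "b = i") (auto intro: C1_on_const)
  then show "C1_on S (\<lambda>u. det (\<chi> k l. if l = i then (if k = j then 1 else 0) else G u $ k $ l) / det (G u))"
    using nz G by (intro C1_on_divide C1_on_det) auto
qed (use nz in \<open>simp add: matrix_inv_component\<close>)

lemma smooth_on_imp_C1_on: "smooth_on S f \<Longrightarrow> C1_on S f"
  by (simp add: smooth_on_def C1_on_def del: Ck_on.simps)

lemma smooth_on_imp_C1_on_deriv: "smooth_on S f \<Longrightarrow> C1_on S (\<lambda>u. frechet_derivative f (at u) v)"
  unfolding C1_on_def smooth_on_def using Ck_on.simps(2)[of "Suc 0" S f] by (auto simp del: Ck_on.simps(2))

lemma has_vector_derivative_line:
  assumes "f differentiable (at (u + s *\<^sub>R v))"
  shows "((\<lambda>s. f (u + s *\<^sub>R v)) has_vector_derivative frechet_derivative f (at (u + s *\<^sub>R v)) v) (at s)"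
proof -
  have "((\<lambda>s. u + s *\<^sub>R v) has_derivative (\<lambda>r. r *\<^sub>R v)) (at s)"
    by (auto intro!: derivative_eq_intros)
  from has_derivative_compose[OF this, of f "frechet_derivative f (at (u + s *\<^sub>R v))"] assms
  show ?thesis
    using linear_cmul[OF linear_frechet_derivative[OF assms]]
    by (simp add: has_vector_derivative_def frechet_derivative_works)
qed

section \<open>Symmetry of second derivatives\<close>

lemma second_difference_mean_value:
  fixes f :: "'b::real_normed_vector \<Rightarrow> real"
  assumes f: "C1_on S f" and f': "C1_on S (\<lambda>u. frechet_derivative f (at u) v)"
    and h: "h > 0" and sub: "\<And>s t. \<lbrakk>0 \<le> s; s \<le> h; 0 \<le> t; t \<le> h\<rbrakk> \<Longrightarrow> u + s *\<^sub>R v + t *\<^sub>R w \<in> S"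
  obtains s t where "0 \<le> s" "s \<le> h" "0 \<le> t" "t \<le> h"
    "f (u + h *\<^sub>R v + h *\<^sub>R w) - f (u + h *\<^sub>R v) - f (u + h *\<^sub>R w) + f u =
      h * h * frechet_derivative (\<lambda>u. frechet_derivative f (at u) v) (at (u + s *\<^sub>R v + t *\<^sub>R w)) w"
proof -
  let ?D = "\<lambda>u. frechet_derivative f (at u) v"
  let ?\<phi> = "\<lambda>s. f (u + s *\<^sub>R v + h *\<^sub>R w) - f (u + s *\<^sub>R v + 0 *\<^sub>R w)"
  have d1: "((\<lambda>s. f (u + s *\<^sub>R v + t *\<^sub>R w)) has_real_derivative ?D (u + s *\<^sub>R v + t *\<^sub>R w)) (at s)"
    if "0 \<le> s" "s \<le> h" "0 \<le> t" "t \<le> h" for s t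
    using has_vector_derivative_line[of f "u + t *\<^sub>R w" s v] C1_on_differentiable[OF f sub[OF that]]
    by (simp add: has_real_derivative_iff_has_vector_derivative ac_simps)
  have d2: "((\<lambda>t. ?D (u + s *\<^sub>R v + t *\<^sub>R w)) has_real_derivative
       frechet_derivative ?D (at (u + s *\<^sub>R v + t *\<^sub>R w)) w) (at t)"
    if "0 \<le> s" "s \<le> h" "0 \<le> t" "t \<le> h" for s t
    using has_vector_derivative_line[of ?D "u + s *\<^sub>R v" t w] C1_on_differentiable[OF f' sub[OF that]]
    by (simp add: has_real_derivative_iff_has_vector_derivative)
  have "\<exists>s>0. s < h \<and> ?\<phi> h - ?\<phi> 0 = (h - 0) * (?D (u + s *\<^sub>R v + h *\<^sub>R w) - ?D (u + s *\<^sub>R v + 0 *\<^sub>R w))"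
    using h by (intro MVT2 DERIV_diff d1) auto
  then obtain s where s: "0 < s" "s < h"
    and s_eq: "?\<phi> h - ?\<phi> 0 = h * (?D (u + s *\<^sub>R v + h *\<^sub>R w) - ?D (u + s *\<^sub>R v + 0 *\<^sub>R w))" by auto
  have "\<exists>t>0. t < h \<and> ?D (u + s *\<^sub>R v + h *\<^sub>R w) - ?D (u + s *\<^sub>R v + 0 *\<^sub>R w) =
      (h - 0) * frechet_derivative ?D (at (u + s *\<^sub>R v + t *\<^sub>R w)) w"
    using h s by (intro MVT2 d2) auto
  then obtain t where t: "0 < t" "t < h"
    and t_eq: "?D (u + s *\<^sub>R v + h *\<^sub>R w) - ?D (u + s *\<^sub>R v + 0 *\<^sub>R w) =
      h * frechet_derivative ?D (at (u + s *\<^sub>R v + t *\<^sub>R w)) w" by auto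
  show ?thesis
    using s t s_eq unfolding t_eq
    by (intro that[of s t]) (auto simp: algebra_simps)
qed

text \<open>The second difference of \<open>f\<close> over a small parallelogram is symmetric in
  \<open>v\<close> and \<open>w\<close>. Two applications of the mean value theorem equate it with
  \<open>h * h\<close> times either mixed derivative at some point of the parallelogram, and
  continuity of both derivatives at \<open>u\<close> finishes.\<close>

lemma frechet_derivative_commute_real:
  fixes f :: "'b::real_normed_vector \<Rightarrow> real"
  assumes "open S" "u \<in> S" and f: "C1_on S f" and f': "\<And>v. C1_on S (\<lambda>u. frechet_derivative f (at u) v)"
  shows "frechet_derivative (\<lambda>u. frechet_derivative f (at u) v) (at u) w =
    frechet_derivative (\<lambda>u. frechet_derivative f (at u) w) (at u) v" (is "?A u = ?B u")
proof -
  have *: "\<bar>?A u - ?B u\<bar> \<le> 2 * e" if "e > 0" for e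
  proof -
    have "isCont ?A u" "isCont ?B u"
      using C1_on_continuous_deriv[OF f'] assms(1,2) continuous_on_eq_continuous_at by blast+
    then obtain d1 d2 where d: "d1 > 0" "\<And>x. dist x u < d1 \<Longrightarrow> dist (?A x) (?A u) < e"
       "d2 > 0" "\<And>x. dist x u < d2 \<Longrightarrow> dist (?B x) (?B u) < e"
      using \<open>e > 0\<close> unfolding continuous_at_eps_delta by blast
    obtain d3 where d3: "d3 > 0" "ball u d3 \<subseteq> S" using assms(1,2) open_contains_ball by blast
    define d where "d = Min {d1, d2, d3}"
    have d0: "d > 0" using d d3 by (simp add: d_def)
    \<comment> \<open>Chosen so that \<open>h * (norm v + norm w)\<close> is at most
      \<open>d / 2\<close>, which keeps the parallelogram inside the ball of radius
      \<open>d\<close>; the summand 1 prevents division by zero.\<close>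
    define h where "h = d / 2 / (norm v + norm w + 1)"
    have nn: "norm v + norm w + 1 > 0" by (smt (verit) norm_ge_zero)
    have h: "h > 0" unfolding h_def using d0 nn by simp
    have near: "dist (u + s *\<^sub>R v + t *\<^sub>R w) u < d" if "0 \<le> s" "s \<le> h" "0 \<le> t" "t \<le> h" for s t
    proof -
      have "dist (u + s *\<^sub>R v + t *\<^sub>R w) u \<le> s * norm v + t * norm w"
        using that norm_triangle_ineq[of "s *\<^sub>R v" "t *\<^sub>R w"] by (simp add: dist_norm add.assoc)
      also have "\<dots> \<le> h * norm v + h * norm w"
        using that by (intro add_mono mult_right_mono) auto
      also have "\<dots> \<le> h * (norm v + norm w + 1)" using h by (simp add: algebra_simps)
      also have "\<dots> = d / 2" unfolding h_def using nn by (intro nonzero_eq_divide_eq[THEN iffD1]) auto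
      finally show ?thesis using d0 by simp
    qed
    have sub: "u + s *\<^sub>R v + t *\<^sub>R w \<in> S" if "0 \<le> s" "s \<le> h" "0 \<le> t" "t \<le> h" for s t
      using near[OF that] d3 by (auto simp: d_def dist_commute)
    have sub': "u + s *\<^sub>R w + t *\<^sub>R v \<in> S" if "0 \<le> s" "s \<le> h" "0 \<le> t" "t \<le> h" for s t
      using sub[OF that(3,4,1,2)] by (simp add: algebra_simps)
    obtain s t where st: "0 \<le> s" "s \<le> h" "0 \<le> t" "t \<le> h"
      "f (u + h *\<^sub>R v + h *\<^sub>R w) - f (u + h *\<^sub>R v) - f (u + h *\<^sub>R w) + f u = h * h * ?A (u + s *\<^sub>R v + t *\<^sub>R w)"
      using second_difference_mean_value[OF f f' h sub] by blast
    obtain s' t' where st': "0 \<le> s'" "s' \<le> h" "0 \<le> t'" "t' \<le> h"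
      "f (u + h *\<^sub>R w + h *\<^sub>R v) - f (u + h *\<^sub>R w) - f (u + h *\<^sub>R v) + f u = h * h * ?B (u + s' *\<^sub>R w + t' *\<^sub>R v)"
      using second_difference_mean_value[OF f f' h sub'] by blast
    \<comment> \<open>Both sides are the same second difference, computed with the directions in the
      two orders.\<close>
    have "h * h * ?A (u + s *\<^sub>R v + t *\<^sub>R w) = h * h * ?B (u + s' *\<^sub>R w + t' *\<^sub>R v)"
      using st(5) st'(5) by (simp add: algebra_simps)
    then have eq: "?A (u + s *\<^sub>R v + t *\<^sub>R w) = ?B (u + t' *\<^sub>R v + s' *\<^sub>R w)"
      using h by (simp add: add.assoc add.commute[of "s' *\<^sub>R w"])
    have "dist (?A (u + s *\<^sub>R v + t *\<^sub>R w)) (?A u) < e"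
      using near[OF st(1-4)] by (intro d) (simp add: d_def)
    moreover have "dist (?B (u + t' *\<^sub>R v + s' *\<^sub>R w)) (?B u) < e"
      using near[OF st'(3,4,1,2)] by (intro d) (simp add: d_def)
    ultimately show ?thesis using eq by (simp add: dist_real_def)
  qed
  have "\<bar>?A u - ?B u\<bar> \<le> 0"
  proof (rule field_le_epsilon)
    fix e :: real assume "e > 0"
    then show "\<bar>?A u - ?B u\<bar> \<le> 0 + e" using *[of "e / 2"] by simp
  qed
  then show ?thesis by simp
qed

lemma frechet_derivative_bounded_linear:
  assumes "bounded_linear L" "f differentiable (at u)"
  shows "frechet_derivative (\<lambda>u. L (f u)) (at u) v = L (frechet_derivative f (at u) v)"
  using frechet_derivative_at[OF bounded_linear.has_derivative[OF assms(1) assms(2)[unfolded frechet_derivative_works]]]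
  by (rule fun_cong[symmetric])

lemma frechet_derivative_commute:
  fixes f :: "'b::real_normed_vector \<Rightarrow> 'c::euclidean_space"
  assumes "open S" "u \<in> S" and f: "C1_on S f" and f': "\<And>v. C1_on S (\<lambda>u. frechet_derivative f (at u) v)"
  shows "frechet_derivative (\<lambda>u. frechet_derivative f (at u) v) (at u) w =
    frechet_derivative (\<lambda>u. frechet_derivative f (at u) w) (at u) v"
proof (rule euclidean_eqI)
  fix b :: 'c
  let ?f = "\<lambda>u. f u \<bullet> b"
  have bl: "bounded_linear (\<lambda>x::'c. x \<bullet> b)" by (rule bounded_linear_inner_left)
  have D: "frechet_derivative ?f (at x) v = frechet_derivative f (at x) v \<bullet> b" if "x \<in> S" for x v
    by (rule frechet_derivative_bounded_linear[OF bl C1_on_differentiable[OF f that]])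
  have C: "C1_on S (\<lambda>u. frechet_derivative ?f (at u) v)" for v
    by (rule C1_on_cong[OF assms(1) C1_on_bounded_linear[OF bl f'[of v]]]) (simp add: D)
  have DD: "frechet_derivative (\<lambda>u. frechet_derivative ?f (at u) v) (at u) w =
      frechet_derivative (\<lambda>u. frechet_derivative f (at u) v) (at u) w \<bullet> b" for v w
  proof -
    have "((\<lambda>u. frechet_derivative f (at u) v \<bullet> b) has_derivative
        (\<lambda>w. frechet_derivative (\<lambda>u. frechet_derivative f (at u) v) (at u) w \<bullet> b)) (at u)"
      by (intro bounded_linear.has_derivative[OF bl] C1_on_has_derivative[OF f'] assms)
    from has_derivative_transform_within_open[OF this assms(1,2)] D
    have "((\<lambda>u. frechet_derivative ?f (at u) v) has_derivative
        (\<lambda>w. frechet_derivative (\<lambda>u. frechet_derivative f (at u) v) (at u) w \<bullet> b)) (at u)" by simp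
    then show ?thesis by (simp add: frechet_derivative_at[symmetric])
  qed
  show "frechet_derivative (\<lambda>u. frechet_derivative f (at u) v) (at u) w \<bullet> b =
    frechet_derivative (\<lambda>u. frechet_derivative f (at u) w) (at u) v \<bullet> b"
    using frechet_derivative_commute_real[OF assms(1,2) C1_on_bounded_linear[OF bl f] C]
    unfolding DD .
qed

section \<open>Charts\<close>

definition jac :: "(real^'m \<Rightarrow> real^'k) \<Rightarrow> real^'m \<Rightarrow> real^'m^'k" where
  "jac f u = matrix (frechet_derivative f (at u))"

lemma jac_eqI: "(f has_derivative f') (at u) \<Longrightarrow> jac f u = matrix f'"
  by (simp add: jac_def frechet_derivative_at[symmetric])

lemma jac_mult_vec: "f differentiable (at u) \<Longrightarrow> jac f u *v v = frechet_derivative f (at u) v"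
  unfolding jac_def by (simp add: matrix_vector_mul linear_frechet_derivative)

lemma column_jac: "column i (jac f u) = partial f i u"
  by (simp add: jac_def matrix_def column_def partial_def vec_eq_iff)

lemma metric_matrix_eq: "metric_matrix c y u = transpose (jac (y \<circ> chart_inv c) u) ** jac (y \<circ> chart_inv c) u"
  by (simp add: metric_matrix_def vec_eq_iff matrix_matrix_mult_def transpose_def inner_vec_def
      jac_def matrix_def partial_def)

locale smooth_manifold =
  fixes A :: "('a::{t2_space, second_countable_topology}, 'm::finite) chart set"
  assumes atlas: "smooth_atlas A"
begin

lemma chart_open: "c \<in> A \<Longrightarrow> open (fst c)" "c \<in> A \<Longrightarrow> open (snd c ` fst c)"
  using atlas by (auto simp: smooth_atlas_def)

lemma chart_homeomorphism: "c \<in> A \<Longrightarrow> homeomorphism (fst c) (snd c ` fst c) (snd c) (chart_inv c)"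
  using atlas by (auto simp: smooth_atlas_def)

lemma chart_inv_left: "c \<in> A \<Longrightarrow> p \<in> fst c \<Longrightarrow> chart_inv c (snd c p) = p"
  using chart_homeomorphism by (auto simp: homeomorphism_def)

lemma chart_inv_in: "c \<in> A \<Longrightarrow> u \<in> snd c ` fst c \<Longrightarrow> chart_inv c u \<in> fst c"
  using chart_inv_left[of c] by auto

lemma chart_inv_right: "c \<in> A \<Longrightarrow> u \<in> snd c ` fst c \<Longrightarrow> snd c (chart_inv c u) = u"
  using chart_inv_left[of c] by auto

lemma continuous_on_chart: "c \<in> A \<Longrightarrow> continuous_on (fst c) (snd c)"
  using chart_homeomorphism by (auto simp: homeomorphism_def)

lemma continuous_on_chart_inv: "c \<in> A \<Longrightarrow> continuous_on (snd c ` fst c) (chart_inv c)"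
  using chart_homeomorphism by (auto simp: homeomorphism_def)

lemma chart_at_in: "chart_at A p \<in> A" "p \<in> fst (chart_at A p)"
proof -
  have "p \<in> (\<Union>c\<in>A. fst c)" using atlas unfolding smooth_atlas_def by blast
  then have "\<exists>c. c \<in> A \<and> p \<in> fst c" by blast
  then have "chart_at A p \<in> A \<and> p \<in> fst (chart_at A p)" unfolding chart_at_def by (rule someI_ex)
  then show "chart_at A p \<in> A" "p \<in> fst (chart_at A p)" by auto
qed

lemma chart_image_eq:
  assumes "c \<in> A" "W \<subseteq> fst c"
  shows "snd c ` W = {u \<in> snd c ` fst c. chart_inv c u \<in> W}"
  using assms chart_inv_left[OF assms(1)] by (force simp: image_iff)

lemma open_chart_image:
  assumes "c \<in> A" "open W" "W \<subseteq> fst c"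
  shows "open (snd c ` W)"
  using continuous_open_preimage[OF continuous_on_chart_inv[OF assms(1)] chart_open(2)[OF assms(1)] assms(2)]
  by (simp add: chart_image_eq[OF assms(1,3)] vimage_def Int_def)

lemma transition_C1_on:
  assumes "c \<in> A" "d \<in> A"
  shows "C1_on (snd c ` (fst c \<inter> fst d)) (snd d \<circ> chart_inv c)"
  using assms atlas smooth_on_imp_C1_on unfolding smooth_atlas_def by blast

lemma transition_differentiable:
  assumes "c \<in> A" "d \<in> A" "p \<in> fst c" "p \<in> fst d"
  shows "(snd d \<circ> chart_inv c) differentiable (at (snd c p))"
  using assms by (intro C1_on_differentiable[OF transition_C1_on[OF assms(1,2)]]) auto

lemma has_derivative_transition:
  assumes c: "c \<in> A" "d \<in> A" "p \<in> fst c" "p \<in> fst d"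
    and f: "(f \<circ> chart_inv d) differentiable (at (snd d p))"
  shows "(f \<circ> chart_inv c has_derivative
     frechet_derivative (f \<circ> chart_inv d) (at (snd d p)) \<circ>
     frechet_derivative (snd d \<circ> chart_inv c) (at (snd c p))) (at (snd c p))"
proof (rule has_derivative_transform_within_open)
  show "((f \<circ> chart_inv d) \<circ> (snd d \<circ> chart_inv c) has_derivative
     frechet_derivative (f \<circ> chart_inv d) (at (snd d p)) \<circ>
     frechet_derivative (snd d \<circ> chart_inv c) (at (snd c p))) (at (snd c p))"
    using transition_differentiable[OF c] f c
    by (intro diff_chain_at) (auto simp: frechet_derivative_works[symmetric] chart_inv_left)
  show "open (snd c ` (fst c \<inter> fst d))"
    using c by (intro open_chart_image open_Int chart_open) auto
qed (use c in \<open>auto simp: chart_inv_left\<close>)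

lemma frechet_derivative_transition:
  assumes "c \<in> A" "d \<in> A" "p \<in> fst c" "p \<in> fst d"
    "(f \<circ> chart_inv d) differentiable (at (snd d p))"
  shows "frechet_derivative (f \<circ> chart_inv c) (at (snd c p)) =
     frechet_derivative (f \<circ> chart_inv d) (at (snd d p)) \<circ>
     frechet_derivative (snd d \<circ> chart_inv c) (at (snd c p))"
  using frechet_derivative_at[OF has_derivative_transition[OF assms]] by simp

lemma jac_transition:
  assumes "c \<in> A" "d \<in> A" "p \<in> fst c" "p \<in> fst d"
    "(f \<circ> chart_inv d) differentiable (at (snd d p))"
  shows "jac (f \<circ> chart_inv c) (snd c p) =
     jac (f \<circ> chart_inv d) (snd d p) ** jac (snd d \<circ> chart_inv c) (snd c p)"
  unfolding jac_def frechet_derivative_transition[OF assms]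
  by (intro matrix_compose linear_frechet_derivative transition_differentiable assms)

lemma jac_self:
  assumes "c \<in> A" "p \<in> fst c"
  shows "jac (snd c \<circ> chart_inv c) (snd c p) = mat 1"
proof -
  have "(snd c \<circ> chart_inv c has_derivative (\<lambda>v. v)) (at (snd c p))"
    by (rule has_derivative_transform_within_open[OF has_derivative_ident chart_open(2)[OF assms(1)]])
      (use assms in \<open>auto simp: chart_inv_right chart_inv_left\<close>)
  then show ?thesis by (simp add: jac_eqI matrix_id_mat_1 flip: id_def)
qed

text \<open>The transition maps in the two directions are mutually inverse, so by the chain rule
  their Jacobians multiply to the identity.\<close>

lemma det_jac_transition:
  assumes "c \<in> A" "d \<in> A" "p \<in> fst c" "p \<in> fst d"
  shows "det (jac (snd d \<circ> chart_inv c) (snd c p)) \<noteq> 0"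
proof -
  have "jac (snd c \<circ> chart_inv d) (snd d p) ** jac (snd d \<circ> chart_inv c) (snd c p) = mat 1"
    using jac_transition[OF assms transition_differentiable[OF assms(2,1,4,3)]] jac_self assms by simp
  then have "det (jac (snd c \<circ> chart_inv d) (snd d p)) * det (jac (snd d \<circ> chart_inv c) (snd c p)) = 1"
    by (metis det_I det_mul)
  then show ?thesis by auto
qed

section \<open>C1 maps on the manifold\<close>

definition C1_map :: "('a \<Rightarrow> 'b::real_normed_vector) \<Rightarrow> bool" where
  "C1_map f \<longleftrightarrow> (\<forall>c\<in>A. C1_on (snd c ` fst c) (f \<circ> chart_inv c))"

lemma smooth_map_imp_C1_map: "smooth_map A f \<Longrightarrow> C1_map f"
  by (auto simp: smooth_map_def C1_map_def smooth_on_imp_C1_on)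

lemma C1_map_D: "C1_map f \<Longrightarrow> c \<in> A \<Longrightarrow> C1_on (snd c ` fst c) (f \<circ> chart_inv c)"
  by (simp add: C1_map_def)

lemma C1_map_differentiable: "C1_map f \<Longrightarrow> c \<in> A \<Longrightarrow> p \<in> fst c \<Longrightarrow> (f \<circ> chart_inv c) differentiable (at (snd c p))"
  by (auto intro: C1_on_differentiable[OF C1_map_D])

text \<open>One suitable chart around each point suffices, because transition maps are C1. This is
  how functions defined piecewise, in particular those extended by zero, are recognized as
  C1.\<close>

lemma C1_map_local:
  assumes "\<And>p. \<exists>d W. d \<in> A \<and> p \<in> fst d \<and> open W \<and> snd d p \<in> W \<and> C1_on W (f \<circ> chart_inv d)"
  shows "C1_map f"
  unfolding C1_map_def
proof (intro ballI C1_on_local)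
  fix c u assume c: "c \<in> A" and "u \<in> snd c ` fst c"
  then obtain p where p: "p \<in> fst c" "u = snd c p" by auto
  obtain d W where d: "d \<in> A" "p \<in> fst d" and W: "open W" "snd d p \<in> W" "C1_on W (f \<circ> chart_inv d)"
    using assms by blast
  let ?T = "snd d \<circ> chart_inv c"
  let ?S = "snd c ` (fst c \<inter> fst d)"
  have oS: "open ?S" using c d by (intro open_chart_image open_Int chart_open) auto
  have T: "C1_on ?S ?T" by (rule transition_C1_on[OF c d(1)])
  let ?W = "?S \<inter> ?T -` W"
  have oW: "open ?W"
    by (rule continuous_open_preimage[OF C1_on_imp_continuous_on[OF T] oS W(1)])
  have "C1_on ?W (\<lambda>u. (f \<circ> chart_inv d) (?T u))"
    by (rule C1_on_compose[OF C1_on_subset[OF T] W(3)]) auto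
  then have "C1_on ?W (f \<circ> chart_inv c)"
    by (rule C1_on_cong[OF oW]) (use c d in \<open>auto simp: chart_inv_left\<close>)
  moreover have "u \<in> ?W" using p d W(2) c by (auto simp: chart_inv_left)
  ultimately show "\<exists>T. open T \<and> u \<in> T \<and> C1_on T (f \<circ> chart_inv c)" using oW by blast
qed

text \<open>Applied to functions defined pointwise through \<open>chart_at\<close>: in one fixed
  chart they are replaced by their chart formula, which no longer involves the selection.\<close>

lemma continuous_on_UNIV_by_charts:
  assumes "\<And>c. c \<in> A \<Longrightarrow> continuous_on (snd c ` fst c) (f \<circ> chart_inv c)"
  shows "continuous_on UNIV f"
proof (intro continuous_at_imp_continuous_on ballI)
  fix p
  let ?c = "chart_at A p"
  have "continuous_on (fst ?c) (\<lambda>q. (f \<circ> chart_inv ?c) (snd ?c q))"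
    by (intro continuous_on_compose2[OF assms] continuous_on_chart chart_at_in) auto
  then have "continuous_on (fst ?c) f"
    by (rule continuous_on_eq) (simp add: chart_inv_left chart_at_in)
  then show "isCont f p"
    using chart_at_in chart_open(1) continuous_on_eq_continuous_at by blast
qed

lemma C1_map_imp_continuous_on: "C1_map f \<Longrightarrow> continuous_on UNIV f"
  by (intro continuous_on_UNIV_by_charts C1_on_imp_continuous_on C1_map_D)

lemma C1_map_const: "C1_map (\<lambda>q. k)" by (auto simp: C1_map_def comp_def)
lemma C1_map_diff: "C1_map f \<Longrightarrow> C1_map g \<Longrightarrow> C1_map (\<lambda>q. f q - g q)" by (auto simp: C1_map_def comp_def)
lemma C1_map_minus: "C1_map f \<Longrightarrow> C1_map (\<lambda>q. - f q)" by (auto simp: C1_map_def comp_def)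
lemma C1_map_scaleR: "C1_map f \<Longrightarrow> C1_map g \<Longrightarrow> C1_map (\<lambda>q. f q *\<^sub>R g q)" by (auto simp: C1_map_def comp_def)
lemma C1_map_mult: "C1_map f \<Longrightarrow> C1_map (g::_\<Rightarrow>real) \<Longrightarrow> C1_map (\<lambda>q. f q * g q)" by (auto simp: C1_map_def comp_def)
lemma C1_map_inner: "C1_map f \<Longrightarrow> C1_map g \<Longrightarrow> C1_map (\<lambda>q. f q \<bullet> g q)" by (auto simp: C1_map_def comp_def)
lemma C1_map_exp: "C1_map (g::_\<Rightarrow>real) \<Longrightarrow> C1_map (\<lambda>q. exp (g q))" by (auto simp: C1_map_def comp_def)
lemma C1_map_sum: "(\<And>i. i \<in> I \<Longrightarrow> C1_map (f i)) \<Longrightarrow> C1_map (\<lambda>q. \<Sum>i\<in>I. f i q)"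
  unfolding C1_map_def comp_def by (intro ballI C1_on_sum) blast

section \<open>Immersions\<close>

lemma immersion_C1_map: "immersion A y \<Longrightarrow> C1_map y"
  by (simp add: immersion_def smooth_map_imp_C1_map)

lemma immersion_C1_on_partial:
  "immersion A y \<Longrightarrow> c \<in> A \<Longrightarrow> C1_on (snd c ` fst c) (partial (y \<circ> chart_inv c) i)"
  unfolding partial_def by (auto simp: immersion_def smooth_map_def intro!: smooth_on_imp_C1_on_deriv)

lemma immersion_det_pos:
  assumes "immersion A y" "c \<in> A" "u \<in> snd c ` fst c"
  shows "det (metric_matrix c y u) > 0"
proof -
  from assms(3) obtain p where p: "p \<in> fst c" "u = snd c p" by auto
  have "(*v) (jac (y \<circ> chart_inv c) u) = frechet_derivative (y \<circ> chart_inv c) (at u)"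
    using jac_mult_vec C1_map_differentiable[OF immersion_C1_map[OF assms(1)] assms(2) p(1)] p by auto
  moreover have "inj (frechet_derivative (y \<circ> chart_inv c) (at u))"
    using assms p by (auto simp: immersion_def)
  ultimately show ?thesis unfolding metric_matrix_eq by (intro det_gram_pos) simp
qed

lemma volume_density_pos:
  assumes "immersion A y" "c \<in> A" "u \<in> snd c ` fst c"
  shows "volume_density c y u > 0"
  using immersion_det_pos[OF assms] by (simp add: volume_density_def)

lemma C1_on_metric_matrix:
  assumes "immersion A y" "c \<in> A"
  shows "C1_on (snd c ` fst c) (\<lambda>u. metric_matrix c y u $ i $ j)"
  using immersion_C1_on_partial[OF assms] by (simp add: metric_matrix_def C1_on_inner)

lemma C1_on_volume_density:
  assumes "immersion A y" "c \<in> A"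
  shows "C1_on (snd c ` fst c) (volume_density c y)"
  unfolding volume_density_def
  by (intro C1_on_sqrt C1_on_det C1_on_metric_matrix immersion_det_pos assms)

lemma C1_on_metric_inv:
  assumes "immersion A y" "c \<in> A"
  shows "C1_on (snd c ` fst c) (\<lambda>u. matrix_inv (metric_matrix c y u) $ i $ j)"
  by (intro C1_on_matrix_inv C1_on_metric_matrix assms chart_open)
    (use immersion_det_pos[OF assms] in fastforce)

text \<open>The metric matrix changes by congruence with the transition Jacobian, so its determinant
  picks up the square of the Jacobian determinant and the root picks up the absolute value, as in
  the change of variables formula.\<close>

lemma volume_density_transition:
  assumes y: "immersion A y" and c: "c \<in> A" "d \<in> A" "p \<in> fst c" "p \<in> fst d"
  shows "volume_density c y (snd c p) =
     volume_density d y (snd d p) * \<bar>det (jac (snd d \<circ> chart_inv c) (snd c p))\<bar>"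
proof -
  have "y \<circ> chart_inv d differentiable (at (snd d p))"
    using C1_map_differentiable[OF immersion_C1_map[OF y]] c by auto
  note jt = jac_transition[OF c this]
  let ?J = "jac (snd d \<circ> chart_inv c) (snd c p)"
  have "metric_matrix c y (snd c p) = transpose ?J ** metric_matrix d y (snd d p) ** ?J"
    by (simp add: metric_matrix_eq jt matrix_transpose_mul matrix_mul_assoc)
  then have "det (metric_matrix c y (snd c p)) = det (metric_matrix d y (snd d p)) * (det ?J)\<^sup>2"
    by (simp add: det_mul power2_eq_square)
  then show ?thesis by (simp add: volume_density_def real_sqrt_mult)
qed

section \<open>Divergence along an immersion, tangent spaces and normal projection\<close>

definition tdiv :: "('a, 'm) chart \<Rightarrow> ('a \<Rightarrow> real^'n) \<Rightarrow> ('a \<Rightarrow> real^'n) \<Rightarrow> 'a \<Rightarrow> real" where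
  "tdiv c y X p = tangential_trace (jac (y \<circ> chart_inv c) (snd c p)) (jac (X \<circ> chart_inv c) (snd c p))"

lemma tdiv_transition:
  assumes y: "immersion A y" and c: "c \<in> A" "d \<in> A" "p \<in> fst c" "p \<in> fst d"
    and X: "X \<circ> chart_inv d differentiable (at (snd d p))"
  shows "tdiv c y X p = tdiv d y X p"
proof -
  have y': "y \<circ> chart_inv d differentiable (at (snd d p))"
    using C1_map_differentiable[OF immersion_C1_map[OF y]] c by auto
  show ?thesis
    using immersion_det_pos[OF y c(2), of "snd d p"] c(4) det_jac_transition[OF c]
    unfolding tdiv_def jac_transition[OF c y'] jac_transition[OF c X]
    by (intro tangential_trace_mult_right) (auto simp: metric_matrix_eq)
qed

lemma tdiv_eq_sum:
  "tdiv c y X p = (\<Sum>i\<in>UNIV. \<Sum>j\<in>UNIV. matrix_inv (metric_matrix c y (snd c p)) $ i $ j *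
      (partial (y \<circ> chart_inv c) j (snd c p) \<bullet> partial (X \<circ> chart_inv c) i (snd c p)))"
  by (simp add: tdiv_def tangential_trace_eq_sum metric_matrix_eq column_jac)

text \<open>The two Jacobians differ by an invertible factor on the right, hence have the same
  range. Thus the definition through \<open>chart_at\<close> can be evaluated in any chart.\<close>

lemma tangent_space_chart:
  assumes y: "immersion A y" and c: "c \<in> A" "p \<in> fst c"
  shows "tangent_space A y p = range ((*v) (jac (y \<circ> chart_inv c) (snd c p)))"
proof -
  let ?d = "chart_at A p"
  let ?J = "jac (snd c \<circ> chart_inv ?d) (snd ?d p)"
  note d = chart_at_in[of p]
  have diff: "y \<circ> chart_inv c differentiable (at (snd c p))" "y \<circ> chart_inv ?d differentiable (at (snd ?d p))"
    using C1_map_differentiable[OF immersion_C1_map[OF y]] c d by auto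
  have "surj ((*v) ?J)"
    using det_jac_transition[OF d(1) c(1) d(2) c(2)] invertible_det_nz[of ?J] invertible_right_inverse[of ?J]
      matrix_right_invertible_surjective by blast
  moreover have "chart_deriv A y p = (*v) (jac (y \<circ> chart_inv c) (snd c p)) \<circ> (*v) ?J"
    using jac_mult_vec[OF diff(2)] jac_transition[OF d(1) c(1) d(2) c(2) diff(1)]
    by (simp add: chart_deriv_def fun_eq_iff matrix_vector_mul_assoc)
  ultimately show ?thesis
    unfolding tangent_space_def by (simp only: image_comp[symmetric])
qed

lemma tangent_space_scaleR:
  assumes y: "immersion A y" and v: "v \<in> tangent_space A y p"
  shows "r *\<^sub>R v \<in> tangent_space A y p"
proof -
  obtain a where "v = jac (y \<circ> chart_inv (chart_at A p)) (snd (chart_at A p) p) *v a"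
    using v unfolding tangent_space_chart[OF y chart_at_in] by auto
  then have "r *\<^sub>R v = jac (y \<circ> chart_inv (chart_at A p)) (snd (chart_at A p) p) *v (r *\<^sub>R a)"
    by (simp add: matrix_vector_mult_scaleR)
  then show ?thesis unfolding tangent_space_chart[OF y chart_at_in] by blast
qed

text \<open>The explicit projection formula satisfies the defining description; it is the only
  solution because the difference of two solutions is tangent and orthogonal to itself. In this form
  the normal part visibly depends on the point in a C1 way.\<close>

lemma normal_part_chart:
  assumes y: "immersion A y" and c: "c \<in> A" "p \<in> fst c"
  defines "Y \<equiv> jac (y \<circ> chart_inv c) (snd c p)"
  shows "normal_part A y p v = v - Y *v (matrix_inv (metric_matrix c y (snd c p)) *v (transpose Y *v v))"
proof -
  let ?G = "metric_matrix c y (snd c p)"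
  let ?w = "Y *v (matrix_inv ?G *v (transpose Y *v v))"
  have G: "?G = transpose Y ** Y" by (simp add: metric_matrix_eq Y_def)
  have "det ?G \<noteq> 0" using immersion_det_pos[OF y c(1)] c by fastforce
  then have Yw: "transpose Y *v (v - ?w) = 0"
    unfolding G by (rule transpose_mult_gram_residual)
  have orth: "orthogonal (v - ?w) (Y *v s)" for s
    unfolding orthogonal_def
    by (metis Yw dot_lmul_matrix inner_commute inner_zero_right transpose_matrix_vector)
  have T: "tangent_space A y p = range ((*v) Y)"
    unfolding Y_def by (rule tangent_space_chart[OF y c])
  have "(THE w. w \<in> tangent_space A y p \<and> (\<forall>s\<in>tangent_space A y p. orthogonal (v - w) s)) = ?w"
  proof (rule the_equality)
    show "?w \<in> tangent_space A y p \<and> (\<forall>s\<in>tangent_space A y p. orthogonal (v - ?w) s)"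
      using orth by (auto simp: T)
    fix w assume w: "w \<in> tangent_space A y p \<and> (\<forall>s\<in>tangent_space A y p. orthogonal (v - w) s)"
    then obtain a where a: "w = Y *v a" by (auto simp: T)
    define z where "z = ?w - w"
    have z: "z = Y *v (matrix_inv ?G *v (transpose Y *v v) - a)"
      by (simp add: a z_def matrix_vector_mult_diff_distrib)
    have "(v - w) \<bullet> z = 0" "(v - ?w) \<bullet> z = 0"
      using w orth unfolding z T orthogonal_def by auto
    then have "z \<bullet> z = 0" by (simp add: z_def inner_diff_left inner_diff_right)
    then show "w = ?w" by (simp add: z_def)
  qed
  then show ?thesis by (simp add: normal_part_def)
qed

lemma normal_part_orthogonal:
  assumes y: "immersion A y" and s: "s \<in> tangent_space A y p"
  shows "normal_part A y p v \<bullet> s = 0"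
proof -
  let ?c = "chart_at A p"
  let ?Y = "jac (y \<circ> chart_inv ?c) (snd ?c p)"
  let ?G = "metric_matrix ?c y (snd ?c p)"
  let ?w = "?Y *v (matrix_inv ?G *v (transpose ?Y *v v))"
  note c = chart_at_in[of p]
  obtain b where b: "s = ?Y *v b" using s by (auto simp: tangent_space_chart[OF y c])
  have G: "?G = transpose ?Y ** ?Y" by (simp add: metric_matrix_eq)
  have "det ?G \<noteq> 0" using immersion_det_pos[OF y c(1)] c by fastforce
  then have Yw: "transpose ?Y *v (v - ?w) = 0"
    unfolding G by (rule transpose_mult_gram_residual)
  then show ?thesis
    unfolding b normal_part_chart[OF y c]
    by (metis dot_lmul_matrix inner_zero_left transpose_matrix_vector)
qed

lemma tangent_part_in:
  assumes y: "immersion A y"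
  shows "v - normal_part A y p v \<in> tangent_space A y p"
  using normal_part_chart[OF y chart_at_in, of p v] by (simp add: tangent_space_chart[OF y chart_at_in])

end

section \<open>Change of variables without an order on the index type\<close>

text \<open>The library states the change of variables formula for index types that are well-orders.
  The type \<open>'m windex\<close> is a well-ordered copy of an arbitrary finite index type \<open>'m\<close>.\<close>

typedef ('m::finite) windex = "{..<CARD('m)}"
  by (auto intro!: exI[of _ 0])

setup_lifting type_definition_windex

instantiation windex :: (finite) wellorder
begin

lift_definition less_eq_windex :: "'a windex \<Rightarrow> 'a windex \<Rightarrow> bool" is "(\<le>)" .
lift_definition less_windex :: "'a windex \<Rightarrow> 'a windex \<Rightarrow> bool" is "(<)" .

instance
proof
  fix P :: "'a windex \<Rightarrow> bool" and a
  assume step: "\<And>x. (\<And>y. y < x \<Longrightarrow> P y) \<Longrightarrow> P x"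
  show "P a"
    by (induction "Rep_windex a" arbitrary: a rule: less_induct) (metis step less_windex.rep_eq)
qed (transfer; auto)+

end

instance windex :: (finite) finite
proof
  have "range (Rep_windex :: 'a windex \<Rightarrow> nat) \<subseteq> {..<CARD('a)}"
    using Rep_windex by auto
  then have "finite (range (Rep_windex :: 'a windex \<Rightarrow> nat))"
    by (rule finite_subset) simp
  then show "finite (UNIV :: 'a windex set)"
    by (rule finite_imageD) (simp add: inj_on_def Rep_windex_inject)
qed

lemma card_windex: "CARD('m windex) = CARD('m::finite)"
  by (simp add: type_definition.card[OF type_definition_windex])

definition reindex :: "'m windex \<Rightarrow> 'm::finite" where
  "reindex = (SOME f. bij f)"

lemma bij_reindex: "bij (reindex :: 'm windex \<Rightarrow> 'm::finite)"
proof -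
  have "\<exists>f :: 'm windex \<Rightarrow> 'm. bij f"
    by (rule finite_same_card_bij) (simp_all add: card_windex)
  then show ?thesis unfolding reindex_def by (rule someI_ex)
qed

text \<open>Conjugation by \<beta> is a sign-preserving bijection between the permutations of the
  two index types and matches the Leibniz sums term by term.\<close>

lemma det_reindex:
  fixes M :: "real^'m^'m" and \<beta> :: "'k::finite \<Rightarrow> 'm::finite"
  assumes "bij \<beta>"
  shows "det (\<chi> i j. M $ \<beta> i $ \<beta> j) = det M"
proof -
  let ?c = "\<lambda>p. \<beta> \<circ> p \<circ> inv \<beta>"
  let ?d = "\<lambda>p. inv \<beta> \<circ> p \<circ> \<beta>"
  have \<beta>: "inv \<beta> (\<beta> i) = i" "\<beta> (inv \<beta> j) = j" for i j
    using assms by (auto simp: bij_is_inj bij_is_surj surj_f_inv_f)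
  have bi: "bij (inv \<beta>)" using assms by (rule bij_imp_bij_inv)
  have sgn: "sign (?c p) = sign p" if "p permutes (UNIV :: 'k set)" for p
  proof -
    have "map_permutation UNIV \<beta> p = ?c p"
      using assms by (simp add: map_permutation_def restrict_id_def bij_is_surj fun_eq_iff)
    then show ?thesis
      using sign_map_permutation[OF bij_is_inj[OF assms] that] by simp
  qed
  have "det (\<chi> i j. M $ \<beta> i $ \<beta> j) =
     (\<Sum>p\<in>{p. p permutes (UNIV :: 'k set)}. of_int (sign p) * (\<Prod>i\<in>UNIV. M $ \<beta> i $ \<beta> (p i)))"
    by (simp add: det_def)
  also have "\<dots> = (\<Sum>p\<in>{p. p permutes (UNIV :: 'm set)}. of_int (sign p) * (\<Prod>i\<in>UNIV. M $ i $ p i))"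
  proof (rule sum.reindex_bij_witness[where j = ?c and i = ?d])
    fix p assume "p \<in> {p. p permutes (UNIV :: 'k set)}"
    then have p: "p permutes UNIV" by simp
    show "?d (?c p) = p" by (simp add: fun_eq_iff \<beta>)
    show "?c p \<in> {p. p permutes UNIV}" using permutes_bij[OF p] assms bi by (auto intro!: bij_imp_permutes bij_comp)
    have "(\<Prod>i\<in>UNIV. M $ i $ ?c p i) = (\<Prod>i\<in>UNIV. M $ \<beta> i $ \<beta> (p i))"
      by (rule prod.reindex_bij_witness[where i = \<beta> and j = "inv \<beta>"]) (auto simp: \<beta>)
    then show "of_int (sign (?c p)) * (\<Prod>i\<in>UNIV. M $ i $ ?c p i) =
       of_int (sign p) * (\<Prod>i\<in>UNIV. M $ \<beta> i $ \<beta> (p i))"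
      by (simp only: sgn[OF p])
  next
    fix p assume "p \<in> {p. p permutes (UNIV :: 'm set)}"
    then have p: "p permutes UNIV" by simp
    show "?c (?d p) = p" by (simp add: fun_eq_iff \<beta>)
    show "?d p \<in> {p. p permutes UNIV}" using permutes_bij[OF p] assms bi by (auto intro!: bij_imp_permutes bij_comp)
  qed
  finally show ?thesis by (simp add: det_def)
qed

definition to_w :: "real^'m \<Rightarrow> real^'m windex" where "to_w v = (\<chi> i. v $ reindex i)"
definition of_w :: "real^'m windex \<Rightarrow> real^'m" where "of_w w = (\<chi> j. w $ inv reindex j)"

lemma of_w_to_w [simp]: "of_w (to_w v) = v"
  using bij_reindex[where 'm = 'a] by (simp add: of_w_def to_w_def vec_eq_iff bij_is_surj surj_f_inv_f)

lemma to_w_of_w [simp]: "to_w (of_w w) = w"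
  using bij_reindex[where 'm = 'a] by (simp add: of_w_def to_w_def vec_eq_iff bij_is_inj)

lemma bounded_linear_to_w: "bounded_linear to_w"
  by (intro linear_conv_bounded_linear[THEN iffD1] linearI) (simp_all add: to_w_def vec_eq_iff)

lemma bounded_linear_of_w: "bounded_linear of_w"
  by (intro linear_conv_bounded_linear[THEN iffD1] linearI) (simp_all add: of_w_def vec_eq_iff)

lemma to_w_measurable [measurable]: "to_w \<in> borel_measurable borel"
  by (intro borel_measurable_continuous_onI bounded_linear.continuous_on[OF bounded_linear_to_w] continuous_on_id)

lemma of_w_measurable [measurable]: "of_w \<in> borel_measurable borel"
  by (intro borel_measurable_continuous_onI bounded_linear.continuous_on[OF bounded_linear_of_w] continuous_on_id)

lemma emeasure_lborel_box_cart:
  fixes l u :: "real^'k"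
  assumes "\<And>i. l $ i \<le> u $ i"
  shows "emeasure lborel (box l u) = ennreal (\<Prod>i\<in>UNIV. u $ i - l $ i)"
proof -
  have "emeasure lborel (box l u) = ennreal (\<Prod>b\<in>Basis. (u - l) \<bullet> b)"
    using assms by (intro emeasure_lborel_box) (auto simp: Basis_vec_def inner_axis)
  also have "(\<Prod>b\<in>Basis. (u - l) \<bullet> b) = (\<Prod>i\<in>UNIV. u $ i - l $ i)"
    by (simp add: Basis_vec_def cart_eq_inner_axis axis_eq_axis prod.UNION_disjoint inner_diff_left)
  finally show ?thesis .
qed

text \<open>Lebesgue measure is determined by its values on boxes, and \<open>to_w\<close> only
  permutes the sides of a box.\<close>

lemma lborel_to_w: "(lborel :: (real^'m windex) measure) = distr lborel borel (to_w :: real^'m \<Rightarrow> _)"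
proof (rule lborel_eqI)
  fix l u :: "real^'m windex"
  assume "\<And>b. b \<in> Basis \<Longrightarrow> l \<bullet> b \<le> u \<bullet> b"
  then have lu: "l $ i \<le> u $ i" for i
    using axis_in_Basis_iff[of i "1::real"] by (auto simp: cart_eq_inner_axis)
  have eq: "to_w -` box l u = box (of_w l) (of_w u :: real^'m)"
  proof -
    have "v \<in> box (of_w l) (of_w u) \<longleftrightarrow> to_w v \<in> box l u" for v :: "real^'m"
      unfolding mem_box_cart to_w_def of_w_def
      using bij_reindex[where 'm = 'm]
      by (auto simp: bij_is_inj) (metis bij_inv_eq_iff)+
    then show ?thesis by auto
  qed
  have "emeasure (distr lborel borel to_w) (box l u) = emeasure lborel (box (of_w l) (of_w u :: real^'m))"
    by (simp add: emeasure_distr eq)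
  also have "\<dots> = ennreal (\<Prod>j\<in>UNIV. u $ inv (reindex :: _ \<Rightarrow> 'm) j - l $ inv (reindex :: _ \<Rightarrow> 'm) j)"
    using lu by (subst emeasure_lborel_box_cart) (auto simp: of_w_def)
  also have "(\<Prod>j\<in>UNIV. u $ inv (reindex :: _ \<Rightarrow> 'm) j - l $ inv (reindex :: _ \<Rightarrow> 'm) j) = (\<Prod>i\<in>UNIV. u $ i - l $ i)"
    using bij_reindex[where 'm = 'm]
    by (intro prod.reindex_bij_witness[where j = "inv reindex" and i = reindex])
      (auto simp: bij_is_inj bij_is_surj surj_f_inv_f)
  also have "ennreal \<dots> = emeasure lborel (box l u)"
    using lu by (rule emeasure_lborel_box_cart[symmetric])
  also have "\<dots> = (\<Prod>b\<in>Basis. (u - l) \<bullet> b)"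
    by (rule emeasure_lborel_box) fact
  finally show "emeasure (distr lborel borel (to_w :: real^'m \<Rightarrow> _)) (box l u) = (\<Prod>b\<in>Basis. (u - l) \<bullet> b)" .
qed simp

lemma det_matrix_conj_to_w:
  fixes L :: "real^'m \<Rightarrow> real^'m"
  shows "det (matrix (to_w \<circ> L \<circ> of_w)) = det (matrix L)"
proof -
  have ax: "of_w (axis j 1) = axis (reindex j) 1" for j :: "'m windex"
    using bij_reindex[where 'm = 'm]
    by (auto simp: of_w_def axis_def vec_eq_iff bij_is_inj) (metis bij_inv_eq_iff)+
  have "matrix (to_w \<circ> L \<circ> of_w) = (\<chi> i j. matrix L $ reindex i $ reindex j)"
    by (simp add: matrix_def vec_eq_iff to_w_def ax)
  then show ?thesis by (simp add: det_reindex[OF bij_reindex])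
qed

text \<open>Translates between extended nonnegative integrals and absolute integrability on a set,
  the language of the available change of variables theorem. The value infinity corresponds exactly
  to failure of integrability, so an equivalence of integrability also settles the infinite
  case.\<close>

lemma set_nn_integral_eq_absolutely_integrable:
  fixes f :: "'b::euclidean_space \<Rightarrow> real"
  assumes m: "(\<lambda>x. indicator S x * f x) \<in> borel_measurable borel" and nn: "\<And>x. x \<in> S \<Longrightarrow> f x \<ge> 0"
  shows "(\<integral>\<^sup>+x\<in>S. ennreal (f x) \<partial>lborel) =
    (if f absolutely_integrable_on S then ennreal (integral S f) else \<infinity>)"
proof -
  have eq: "(\<integral>\<^sup>+x\<in>S. ennreal (f x) \<partial>lborel) = (\<integral>\<^sup>+x. ennreal (indicator S x * f x) \<partial>lborel)"
    by (intro nn_integral_cong) (auto simp: indicator_def)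
  have iff: "f absolutely_integrable_on S \<longleftrightarrow> integrable lborel (\<lambda>x. indicator S x * f x)"
    using m by (simp add: set_integrable_def integrable_completion)
  show ?thesis
  proof (cases "f absolutely_integrable_on S")
    case True
    then have "(\<integral>\<^sup>+x. ennreal (indicator S x * f x) \<partial>lborel) = ennreal (LINT x|lborel. indicator S x * f x)"
      using iff nn by (intro nn_integral_eq_integral) (auto simp: indicator_def)
    also have "(LINT x|lborel. indicator S x * f x) = (LINT x:S|lebesgue. f x)"
      using m by (simp add: set_lebesgue_integral_def integral_completion)
    also have "\<dots> = integral S f"
      using True by (rule set_lebesgue_integral_eq_integral)
    finally show ?thesis using True eq by simp
  next
    case False
    then have "\<not> (\<integral>\<^sup>+x. ennreal (norm (indicator S x * f x)) \<partial>lborel) < \<infinity>"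
      using iff m by (simp add: integrable_iff_bounded)
    moreover have "(\<integral>\<^sup>+x. ennreal (norm (indicator S x * f x)) \<partial>lborel) = (\<integral>\<^sup>+x\<in>S. ennreal (f x) \<partial>lborel)"
      unfolding eq by (intro nn_integral_cong) (use nn in \<open>auto simp: indicator_def\<close>)
    ultimately show ?thesis using False by (simp add: less_top[symmetric])
  qed
qed

lemma nn_integral_change_of_variables_wellorder:
  fixes g :: "real^'m::{finite,wellorder} \<Rightarrow> real^'m::_" and f :: "real^'m::_ \<Rightarrow> real"
  assumes S: "S \<in> sets borel"
    and der: "\<And>x. x \<in> S \<Longrightarrow> (g has_derivative g' x) (at x)" and inj: "inj_on g S"
    and fm: "(\<lambda>x. indicator (g ` S) x * f x) \<in> borel_measurable borel"
    and gm: "(\<lambda>x. indicator S x * (\<bar>det (matrix (g' x))\<bar> * f (g x))) \<in> borel_measurable borel"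
    and nn: "\<And>x. x \<in> S \<Longrightarrow> f (g x) \<ge> 0"
  shows "(\<integral>\<^sup>+x\<in>g ` S. ennreal (f x) \<partial>lborel) =
    (\<integral>\<^sup>+x\<in>S. ennreal (\<bar>det (matrix (g' x))\<bar> * f (g x)) \<partial>lborel)"
proof -
  have S': "S \<in> sets lebesgue" using S by (simp add: sets_completionI_sets)
  \<comment> \<open>The underlying theorem is about vector-valued functions, hence the detour
    through \<open>real^1\<close>. Having the equivalence for every value \<open>b\<close> yields
    both the transfer of integrability and the equality of the integrals.\<close>
  have eq: "((\<lambda>x. \<bar>det (matrix (g' x))\<bar> * f (g x)) absolutely_integrable_on S \<and>
       integral S (\<lambda>x. \<bar>det (matrix (g' x))\<bar> * f (g x)) = b) \<longleftrightarrow>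
     (f absolutely_integrable_on (g ` S) \<and> integral (g ` S) f = b)" for b
    using has_absolute_integral_change_of_variables[OF S' has_derivative_at_withinI[OF der] inj,
        of "\<lambda>x. vec (f x) :: real^1" "vec b"]
    unfolding absolutely_integrable_on_1_iff integral_on_1_eq by simp
  show ?thesis
    using nn eq[of "integral S (\<lambda>x. \<bar>det (matrix (g' x))\<bar> * f (g x))"] eq[of "integral (g ` S) f"]
    by (subst (1 2) set_nn_integral_eq_absolutely_integrable) (auto intro!: fm gm)
qed

text \<open>Conjugation by the measure-preserving linear isomorphism \<open>to_w\<close> reduces
  this to the well-ordered case and leaves the Jacobian determinant unchanged.\<close>

lemma nn_integral_change_of_variables:
  fixes g :: "real^'m \<Rightarrow> real^'m" and f :: "real^'m \<Rightarrow> real"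
  assumes S: "S \<in> sets borel" and gS: "g ` S \<in> sets borel"
    and der: "\<And>x. x \<in> S \<Longrightarrow> (g has_derivative g' x) (at x)" and inj: "inj_on g S"
    and fm: "(\<lambda>x. indicator (g ` S) x * f x) \<in> borel_measurable borel"
    and gm: "(\<lambda>x. indicator S x * (\<bar>det (matrix (g' x))\<bar> * f (g x))) \<in> borel_measurable borel"
    and nn: "\<And>x. x \<in> S \<Longrightarrow> f (g x) \<ge> 0"
  shows "(\<integral>\<^sup>+x\<in>g ` S. ennreal (f x) \<partial>lborel) =
    (\<integral>\<^sup>+x\<in>S. ennreal (\<bar>det (matrix (g' x))\<bar> * f (g x)) \<partial>lborel)"
proof -
  let ?g = "to_w \<circ> g \<circ> of_w"
  let ?g' = "\<lambda>x. to_w \<circ> g' (of_w x) \<circ> of_w"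
  let ?S = "to_w ` S"
  have mem: "x \<in> to_w ` X \<longleftrightarrow> of_w x \<in> X" for x :: "real^'m windex" and X :: "(real^'m) set"
    by (metis image_iff of_w_to_w to_w_of_w)
  have ind: "indicator (to_w ` X) x = (indicator X (of_w x) :: 'z::zero_neq_one)" for X :: "(real^'m) set" and x
    by (simp add: indicator_def mem)
  have gS': "?g ` ?S = to_w ` (g ` S)" by (simp add: image_image)
  have "?S = of_w -` S" by (auto simp: mem)
  then have S': "?S \<in> sets borel"
    using measurable_sets[OF of_w_measurable S] by simp
  have der': "(?g has_derivative ?g' x) (at x)" if "x \<in> ?S" for x
    using der[of "of_w x"] that unfolding mem
    by (intro diff_chain_at bounded_linear_imp_has_derivative bounded_linear_of_w bounded_linear_to_w) auto
  have inj': "inj_on ?g ?S"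
    using inj by (auto simp: inj_on_def) (metis of_w_to_w)
  have fm': "(\<lambda>x. indicator (?g ` ?S) x * f (of_w x)) \<in> borel_measurable borel"
    unfolding gS' ind using measurable_compose[OF of_w_measurable fm] by simp
  have gm': "(\<lambda>x. indicator ?S x * (\<bar>det (matrix (?g' x))\<bar> * f (of_w (?g x)))) \<in> borel_measurable borel"
    unfolding ind det_matrix_conj_to_w using measurable_compose[OF of_w_measurable gm] by (simp add: comp_def)
  have *: "(\<integral>\<^sup>+x\<in>?g ` ?S. ennreal (f (of_w x)) \<partial>lborel) =
    (\<integral>\<^sup>+x\<in>?S. ennreal (\<bar>det (matrix (?g' x))\<bar> * f (of_w (?g x))) \<partial>lborel)"
    using nn by (intro nn_integral_change_of_variables_wellorder S' der' inj' fm' gm') auto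
  have tr: "(\<integral>\<^sup>+x\<in>to_w ` X. ennreal (h (of_w x)) \<partial>lborel) = (\<integral>\<^sup>+x\<in>X. ennreal (h x) \<partial>lborel)"
    if h: "(\<lambda>x. indicator X x * h x) \<in> borel_measurable borel" for X and h :: "real^'m \<Rightarrow> real"
  proof -
    have "(\<integral>\<^sup>+x\<in>to_w ` X. ennreal (h (of_w x)) \<partial>lborel) =
       (\<integral>\<^sup>+x. ennreal (indicator X (of_w x) * h (of_w x)) \<partial>distr lborel borel (to_w :: real^'m \<Rightarrow> _))"
      unfolding lborel_to_w[symmetric]
      by (intro nn_integral_cong) (simp add: ind split: split_indicator)
    also have "\<dots> = (\<integral>\<^sup>+x. ennreal (indicator X x * h x) \<partial>lborel)"
      using measurable_compose[OF of_w_measurable h] by (subst nn_integral_distr) auto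
    also have "\<dots> = (\<integral>\<^sup>+x\<in>X. ennreal (h x) \<partial>lborel)"
      by (intro nn_integral_cong) (auto simp: indicator_def)
    finally show ?thesis .
  qed
  show ?thesis
    using * tr[OF fm] tr[OF gm] unfolding gS' det_matrix_conj_to_w by simp
qed

section \<open>The volume measure\<close>

context smooth_manifold
begin

text \<open>The volume element restricted to one chart domain, as a Borel measure on the whole
  manifold: it gives measure zero to everything outside \<open>fst c\<close>.\<close>

definition chart_measure :: "('a, 'm) chart \<Rightarrow> ('a \<Rightarrow> real^'n) \<Rightarrow> 'a measure" where
  "chart_measure c y =
     distr (density (restrict_space lborel (snd c ` fst c)) (\<lambda>u. ennreal (volume_density c y u))) borel (chart_inv c)"

lemma sets_chart_measure [simp]: "sets (chart_measure c y) = sets borel"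
  by (simp add: chart_measure_def)

lemma measurable_restrict_chart:
  assumes "c \<in> A" "continuous_on (snd c ` fst c) f"
  shows "f \<in> measurable (restrict_space lborel (snd c ` fst c)) borel"
  using borel_measurable_continuous_on_restrict[OF assms(2)]
  by (simp cong: measurable_cong_sets add: sets_restrict_space)

lemma chart_inv_measurable:
  "c \<in> A \<Longrightarrow> chart_inv c \<in> measurable (restrict_space lborel (snd c ` fst c)) borel"
  by (intro measurable_restrict_chart continuous_on_chart_inv)

lemma volume_density_measurable:
  "immersion A y \<Longrightarrow> c \<in> A \<Longrightarrow>
   volume_density c y \<in> borel_measurable (restrict_space lborel (snd c ` fst c))"
  by (intro measurable_restrict_chart C1_on_imp_continuous_on C1_on_volume_density)

lemma sets_chart_image:
  assumes "c \<in> A" "E \<in> sets borel" "E \<subseteq> fst c"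
  shows "snd c ` E \<in> sets borel"
proof -
  have "snd c ` E = chart_inv c -` E \<inter> space (restrict_space lborel (snd c ` fst c))"
    using chart_image_eq[OF assms(1,3)] by (auto simp: space_restrict_space)
  also have "\<dots> \<in> sets (restrict_space lborel (snd c ` fst c))"
    by (rule measurable_sets[OF chart_inv_measurable assms(2)]) fact
  finally show ?thesis
    using chart_open(2)[OF assms(1)] by (auto simp: sets_restrict_space)
qed

lemma nn_integral_chart_measure:
  assumes y: "immersion A y" and c: "c \<in> A" and h: "h \<in> borel_measurable borel"
  shows "(\<integral>\<^sup>+p. h p \<partial>chart_measure c y) =
    (\<integral>\<^sup>+u\<in>snd c ` fst c. (ennreal (volume_density c y u) * h (chart_inv c u)) \<partial>lborel)"
proof -
  note [measurable] = chart_inv_measurable[OF c] volume_density_measurable[OF y c]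
  have "(\<integral>\<^sup>+p. h p \<partial>chart_measure c y) =
    (\<integral>\<^sup>+u. ennreal (volume_density c y u) * h (chart_inv c u) \<partial>restrict_space lborel (snd c ` fst c))"
    unfolding chart_measure_def using h by (simp add: nn_integral_distr nn_integral_density)
  also have "\<dots> = (\<integral>\<^sup>+u\<in>snd c ` fst c. (ennreal (volume_density c y u) * h (chart_inv c u)) \<partial>lborel)"
    using chart_open(2)[OF c] by (intro nn_integral_restrict_space) simp
  finally show ?thesis .
qed

lemma emeasure_chart_measure:
  assumes y: "immersion A y" and c: "c \<in> A" and E: "E \<in> sets borel"
  shows "emeasure (chart_measure c y) E = (\<integral>\<^sup>+u\<in>snd c ` (E \<inter> fst c). ennreal (volume_density c y u) \<partial>lborel)"
proof -
  have "emeasure (chart_measure c y) E = (\<integral>\<^sup>+p. indicator E p \<partial>chart_measure c y)"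
    using E by simp
  also have "\<dots> = (\<integral>\<^sup>+u\<in>snd c ` (E \<inter> fst c). ennreal (volume_density c y u) \<partial>lborel)"
    using E chart_image_eq[OF c, of "E \<inter> fst c"]
    by (subst nn_integral_chart_measure[OF y c])
      (auto intro!: nn_integral_cong simp: indicator_def chart_inv_left[OF c])
  finally show ?thesis .
qed

text \<open>Change of variables along the transition map: its Jacobian factor is exactly the ratio
  of the two volume densities.\<close>

lemma emeasure_chart_measure_agree:
  assumes y: "immersion A y" and c: "c \<in> A" "d \<in> A" and E: "E \<in> sets borel" "E \<subseteq> fst c" "E \<subseteq> fst d"
  shows "emeasure (chart_measure c y) E = emeasure (chart_measure d y) E"
proof -
  let ?g = "snd d \<circ> chart_inv c"
  let ?g' = "\<lambda>u. frechet_derivative ?g (at u)"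
  let ?S = "snd c ` E"
  have gS: "?g ` ?S = snd d ` E"
    using E by (force simp: image_comp chart_inv_left[OF c(1)])
  have S: "?S \<in> sets borel" and S': "snd d ` E \<in> sets borel"
    using sets_chart_image c E by auto
  have der: "(?g has_derivative ?g' u) (at u)" if "u \<in> ?S" for u
    using that E by (intro C1_on_has_derivative[OF transition_C1_on[OF c]]) auto
  have inj: "inj_on ?g ?S"
    using E chart_inv_left[OF c(1)] chart_inv_left[OF c(2)]
    by (auto simp: inj_on_def) (metis subsetD)
  \<comment> \<open>The density is known to be continuous only on the coordinate domain and is
    arbitrary elsewhere, so measurability can be claimed only after cutting off with an
    indicator.\<close>
  have dens: "(\<lambda>u. indicator (snd e ` E) u * volume_density e y u) \<in> borel_measurable borel"
    if e: "e \<in> A" "E \<subseteq> fst e" for e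
  proof -
    have "(\<lambda>u. indicator (snd e ` fst e) u * volume_density e y u) \<in> borel_measurable borel"
      using borel_measurable_continuous_on_indicator[OF _ C1_on_imp_continuous_on[OF C1_on_volume_density[OF y e(1)]]]
        chart_open(2)[OF e(1)] by simp
    then have "(\<lambda>u. indicator (snd e ` E) u * (indicator (snd e ` fst e) u * volume_density e y u)) \<in> borel_measurable borel"
      using sets_chart_image[OF e(1) E(1) e(2)] by measurable
    also have "(\<lambda>u. indicator (snd e ` E) u * (indicator (snd e ` fst e) u * volume_density e y u)) =
       (\<lambda>u. indicator (snd e ` E) u * volume_density e y u)"
      using e by (auto simp: fun_eq_iff indicator_def)
    finally show ?thesis .
  qed
  have trans: "\<bar>det (matrix (?g' u))\<bar> * volume_density d y (?g u) = volume_density c y u" if u: "u \<in> ?S" for u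
  proof -
    obtain p where p: "p \<in> fst c" "p \<in> fst d" "u = snd c p" using u E by auto
    then show ?thesis
      using volume_density_transition[OF y c p(1,2)]
      by (simp add: chart_inv_left[OF c(1)] jac_def mult.commute)
  qed
  have "emeasure (chart_measure d y) E = (\<integral>\<^sup>+u\<in>?g ` ?S. ennreal (volume_density d y u) \<partial>lborel)"
    using E unfolding gS by (simp add: emeasure_chart_measure[OF y c(2)] Int_absorb2)
  also have "\<dots> = (\<integral>\<^sup>+u\<in>?S. ennreal (\<bar>det (matrix (?g' u))\<bar> * volume_density d y (?g u)) \<partial>lborel)"
  proof (rule nn_integral_change_of_variables[OF S _ der inj])
    show "?g ` ?S \<in> sets borel" using S' gS by simp
    show "(\<lambda>u. indicator (?g ` ?S) u * volume_density d y u) \<in> borel_measurable borel"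
      unfolding gS by (rule dens) (use c E in auto)
    have "(\<lambda>u. indicator ?S u * (\<bar>det (matrix (?g' u))\<bar> * volume_density d y (?g u))) =
       (\<lambda>u. indicator ?S u * volume_density c y u)"
      using trans by (auto simp: fun_eq_iff indicator_def)
    then show "(\<lambda>u. indicator ?S u * (\<bar>det (matrix (?g' u))\<bar> * volume_density d y (?g u))) \<in> borel_measurable borel"
      using dens[OF c(1) E(2)] by simp
    show "volume_density d y (?g u) \<ge> 0" if u: "u \<in> ?S" for u
    proof -
      obtain p where p: "p \<in> fst c" "p \<in> fst d" "u = snd c p" using u E by auto
      then show ?thesis
        using volume_density_pos[OF y c(2), of "snd d p"] by (simp add: chart_inv_left[OF c(1)])
    qed
  qed
  also have "\<dots> = (\<integral>\<^sup>+u\<in>?S. ennreal (volume_density c y u) \<partial>lborel)"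
    by (intro nn_integral_cong) (use trans in \<open>simp split: split_indicator\<close>)
  also have "\<dots> = emeasure (chart_measure c y) E"
    using E by (simp add: emeasure_chart_measure[OF y c(1)] Int_absorb2)
  finally show ?thesis by simp
qed

text \<open>Second countability enters here through the Lindelof property. A countable cover is what
  allows the chart measures to be glued by a countable sum.\<close>

lemma countable_charts:
  obtains C :: "nat \<Rightarrow> ('a, 'm) chart" where "\<And>n. C n \<in> A" "(\<Union>n. fst (C n)) = UNIV"
proof -
  obtain \<F> where \<F>: "\<F> \<subseteq> fst ` A" "countable \<F>" "\<Union>\<F> = \<Union>(fst ` A)"
    using Lindelof[of "fst ` A"] chart_open(1) by blast
  have U: "\<Union>\<F> = UNIV" using \<F>(3) chart_at_in by blast
  then have ne: "\<F> \<noteq> {}" by auto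
  define C where "C = (\<lambda>n. SOME c. c \<in> A \<and> fst c = from_nat_into \<F> n)"
  have C: "C n \<in> A" "fst (C n) = from_nat_into \<F> n" for n
  proof -
    have "\<exists>c. c \<in> A \<and> fst c = from_nat_into \<F> n"
      using from_nat_into[OF ne, of n] \<F>(1) by blast
    then have "C n \<in> A \<and> fst (C n) = from_nat_into \<F> n"
      unfolding C_def by (rule someI_ex)
    then show "C n \<in> A" "fst (C n) = from_nat_into \<F> n" by auto
  qed
  have "(\<Union>n. fst (C n)) = UNIV"
    using U range_from_nat_into[OF ne \<F>(2)] by (simp add: C(2))
  with C(1) show ?thesis by (rule that)
qed

text \<open>The manifold is cut into countably many disjoint Borel pieces \<open>D n\<close>, each
  inside one chart, and the chart measures of the pieces are added. Agreement on overlaps makes the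
  sum correct in every chart; uniqueness holds because any candidate is determined on each
  piece.\<close>

lemma volume_measure_ex1:
  assumes y: "immersion A y"
  shows "\<exists>!\<mu>. sets \<mu> = sets borel \<and>
     (\<forall>c\<in>A. \<forall>E\<in>sets borel. E \<subseteq> fst c \<longrightarrow>
        emeasure \<mu> E = (\<integral>\<^sup>+u\<in>snd c ` E. ennreal (volume_density c y u) \<partial>lborel))"
proof -
  obtain C :: "nat \<Rightarrow> ('a, 'm) chart" where C: "\<And>n. C n \<in> A" "(\<Union>n. fst (C n)) = UNIV"
    using countable_charts by metis
  define D where "D = disjointed (\<lambda>n. fst (C n))"
  have D: "D n \<subseteq> fst (C n)" "disjoint_family D" "(\<Union>n. D n) = UNIV" for n
    unfolding D_def using C(2) disjointed_subset[of "\<lambda>n. fst (C n)" n]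
    by (simp_all add: disjoint_family_disjointed UN_disjointed_eq)
  have Db [measurable]: "D n \<in> sets borel" for n
  proof -
    have "range (\<lambda>n. fst (C n)) \<subseteq> sets borel" using chart_open(1)[OF C(1)] by auto
    from sets.range_disjointed_sets[OF this] show ?thesis unfolding D_def by blast
  qed
  \<comment> \<open>The sum over the pieces is written as an integral against counting measure, so
    that countable additivity becomes an interchange of a sum with an integral.\<close>
  let ?m = "\<lambda>E. \<integral>\<^sup>+n. emeasure (chart_measure (C n) y) (E \<inter> D n) \<partial>count_space UNIV"
  define \<mu> where "\<mu> = measure_of UNIV (sets (borel :: 'a measure)) ?m"
  have sets\<mu>: "sets \<mu> = sets borel"
    unfolding \<mu>_def using sets.sigma_sets_eq[of "borel :: 'a measure"] by simp
  have em: "emeasure \<mu> E = ?m E" if "E \<in> sets borel" for E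
    unfolding \<mu>_def
  proof (rule emeasure_measure_of_sigma)
    show "sigma_algebra UNIV (sets (borel :: 'a measure))"
      using sets.sigma_algebra_axioms[of "borel :: 'a measure"] by simp
    show "positive (sets borel) ?m" by (simp add: positive_def)
    show "countably_additive (sets borel) ?m"
      unfolding countably_additive_def
    proof (intro allI impI)
      fix E :: "nat \<Rightarrow> 'a set"
      assume E: "range E \<subseteq> sets borel" "disjoint_family E" "\<Union> (range E) \<in> sets borel"
      have "(\<Sum>i. ?m (E i)) = (\<integral>\<^sup>+n. (\<Sum>i. emeasure (chart_measure (C n) y) (E i \<inter> D n)) \<partial>count_space UNIV)"
        by (rule nn_integral_suminf[symmetric]) simp
      also have "\<dots> = ?m (\<Union> (range E))"
      proof (intro nn_integral_cong)
        fix n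
        have "(\<Sum>i. emeasure (chart_measure (C n) y) (E i \<inter> D n)) = emeasure (chart_measure (C n) y) (\<Union>i. E i \<inter> D n)"
          using E by (intro suminf_emeasure) (auto simp: disjoint_family_on_def)
        then show "(\<Sum>i. emeasure (chart_measure (C n) y) (E i \<inter> D n)) =
            emeasure (chart_measure (C n) y) (\<Union> (range E) \<inter> D n)"
          by (simp add: Int_UN_distrib2)
      qed
      finally show "(\<Sum>i. ?m (E i)) = ?m (\<Union> (range E))" .
    qed
  qed (fact that)
  have split: "(\<integral>\<^sup>+n. emeasure \<nu> (E \<inter> D n) \<partial>count_space UNIV) = emeasure \<nu> E"
    if "sets \<nu> = sets borel" "E \<in> sets borel" for \<nu> E
  proof -
    have "(\<Sum>n. emeasure \<nu> (E \<inter> D n)) = emeasure \<nu> (\<Union>n. E \<inter> D n)"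
      using that D(2) by (intro suminf_emeasure) (auto simp: disjoint_family_on_def)
    also have "(\<Union>n. E \<inter> D n) = E" using D(3) by auto
    finally show ?thesis by (simp add: nn_integral_count_space_nat)
  qed
  show ?thesis
  proof (rule ex1I[of _ \<mu>], intro conjI ballI impI)
    fix c E assume c: "c \<in> A" and E: "E \<in> sets borel" "E \<subseteq> fst c"
    have "emeasure \<mu> E = (\<integral>\<^sup>+n. emeasure (chart_measure c y) (E \<inter> D n) \<partial>count_space UNIV)"
      unfolding em[OF E(1)] using E D(1)
      by (intro nn_integral_cong emeasure_chart_measure_agree[OF y C(1) c]) auto
    also have "\<dots> = emeasure (chart_measure c y) E"
      using E by (intro split) auto
    finally show "emeasure \<mu> E = (\<integral>\<^sup>+u\<in>snd c ` E. ennreal (volume_density c y u) \<partial>lborel)"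
      using E by (simp add: emeasure_chart_measure[OF y c] Int_absorb2)
  next
    fix \<nu> assume \<nu>: "sets \<nu> = sets borel \<and>
     (\<forall>c\<in>A. \<forall>E\<in>sets borel. E \<subseteq> fst c \<longrightarrow>
        emeasure \<nu> E = (\<integral>\<^sup>+u\<in>snd c ` E. ennreal (volume_density c y u) \<partial>lborel))"
    show "\<nu> = \<mu>"
    proof (rule measure_eqI)
      show "sets \<nu> = sets \<mu>" using \<nu> sets\<mu> by simp
      fix E assume "E \<in> sets \<nu>"
      then have E: "E \<in> sets borel" using \<nu> by simp
      have "emeasure \<nu> E = (\<integral>\<^sup>+n. emeasure \<nu> (E \<inter> D n) \<partial>count_space UNIV)"
        using \<nu> E by (simp add: split)
      also have "\<dots> = ?m E"
      proof (intro nn_integral_cong)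
        fix n
        have s: "E \<inter> D n \<subseteq> fst (C n)" using D(1) by auto
        show "emeasure \<nu> (E \<inter> D n) = emeasure (chart_measure (C n) y) (E \<inter> D n)"
          using \<nu> C(1)[of n] E s by (simp add: emeasure_chart_measure[OF y C(1)] Int_absorb2)
      qed
      finally show "emeasure \<nu> E = emeasure \<mu> E" using em[OF E] by simp
    qed
  qed (fact sets\<mu>)
qed

lemma volume_measure_works:
  assumes y: "immersion A y"
  shows "sets (volume_measure A y) = sets borel"
    and "\<lbrakk>c \<in> A; E \<in> sets borel; E \<subseteq> fst c\<rbrakk> \<Longrightarrow> emeasure (volume_measure A y) E = emeasure (chart_measure c y) E"
  using theI'[OF volume_measure_ex1[OF y], folded volume_measure_def]
  by (auto simp: emeasure_chart_measure[OF y] Int_absorb2)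

lemma volume_measure_eqI:
  assumes y: "immersion A y" and "sets \<nu> = sets borel"
    and "\<And>c E. \<lbrakk>c \<in> A; E \<in> sets borel; E \<subseteq> fst c\<rbrakk> \<Longrightarrow> emeasure \<nu> E = emeasure (chart_measure c y) E"
  shows "volume_measure A y = \<nu>"
  unfolding volume_measure_def
  by (rule the1_equality[OF volume_measure_ex1[OF y]])
    (use assms in \<open>auto simp: emeasure_chart_measure[OF y] Int_absorb2\<close>)

lemma measurable_volume_measure:
  "immersion A y \<Longrightarrow> f \<in> borel_measurable (volume_measure A y) \<longleftrightarrow> f \<in> borel_measurable borel"
  by (simp add: measurable_cong_sets[OF volume_measure_works(1) refl])

text \<open>Reduces integrals of functions supported in a chart domain to integrals over the
  coordinate domain.\<close>

lemma density_indicator_volume_measure: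
  assumes y: "immersion A y" and c: "c \<in> A"
  shows "density (volume_measure A y) (\<lambda>p. ennreal (indicator (fst c) p)) = chart_measure c y"
proof (rule measure_eqI)
  show "sets (density (volume_measure A y) (\<lambda>p. ennreal (indicator (fst c) p))) = sets (chart_measure c y)"
    by (simp add: volume_measure_works(1)[OF y])
  fix E assume "E \<in> sets (density (volume_measure A y) (\<lambda>p. ennreal (indicator (fst c) p)))"
  then have E: "E \<in> sets borel" by (simp add: volume_measure_works(1)[OF y])
  have fc: "fst c \<in> sets borel" using chart_open(1)[OF c] by simp
  have "emeasure (density (volume_measure A y) (\<lambda>p. ennreal (indicator (fst c) p))) E =
     (\<integral>\<^sup>+p. ennreal (indicator (fst c) p) * indicator E p \<partial>volume_measure A y)"
    using E fc by (intro emeasure_density)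
      (simp_all add: measurable_volume_measure[OF y] volume_measure_works(1)[OF y])
  also have "\<dots> = (\<integral>\<^sup>+p. indicator (fst c \<inter> E) p \<partial>volume_measure A y)"
    by (intro nn_integral_cong) (simp split: split_indicator)
  also have "\<dots> = emeasure (volume_measure A y) (fst c \<inter> E)"
    using E fc by (simp add: volume_measure_works(1)[OF y])
  also have "\<dots> = emeasure (chart_measure c y) (fst c \<inter> E)"
    using E fc by (intro volume_measure_works(2)[OF y c]) auto
  also have "\<dots> = emeasure (chart_measure c y) E"
  proof -
    have "fst c \<inter> E \<inter> fst c = E \<inter> fst c" by auto
    then show ?thesis
      using E fc emeasure_chart_measure[OF y c, of "fst c \<inter> E"] emeasure_chart_measure[OF y c, of E] by simp
  qed
  finally show "emeasure (density (volume_measure A y) (\<lambda>p. ennreal (indicator (fst c) p))) E =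
    emeasure (chart_measure c y) E" .
qed

lemma nn_integral_volume_measure_chart:
  assumes y: "immersion A y" and c: "c \<in> A" and h: "h \<in> borel_measurable borel"
  shows "(\<integral>\<^sup>+p\<in>fst c. h p \<partial>volume_measure A y) =
    (\<integral>\<^sup>+u\<in>snd c ` fst c. (ennreal (volume_density c y u) * h (chart_inv c u)) \<partial>lborel)"
proof -
  have fc: "fst c \<in> sets borel" using chart_open(1)[OF c] by simp
  have "(\<integral>\<^sup>+p\<in>fst c. h p \<partial>volume_measure A y) =
      (\<integral>\<^sup>+p. h p \<partial>density (volume_measure A y) (\<lambda>p. ennreal (indicator (fst c) p)))"
    using fc h by (subst nn_integral_density)
      (auto simp: measurable_volume_measure[OF y] indicator_def intro!: nn_integral_cong)
  then show ?thesis
    by (simp add: density_indicator_volume_measure[OF y c] nn_integral_chart_measure[OF y c h])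
qed

lemma has_bochner_integral_volume_measure_chart:
  fixes h :: "'a \<Rightarrow> real"
  assumes y: "immersion A y" and c: "c \<in> A" and h: "h \<in> borel_measurable borel"
    and off: "\<And>p. p \<notin> fst c \<Longrightarrow> h p = 0"
    and I: "has_bochner_integral lborel
       (\<lambda>u. indicator (snd c ` fst c) u *\<^sub>R (volume_density c y u * h (chart_inv c u))) I"
  shows "has_bochner_integral (volume_measure A y) h I"
proof -
  have fc: "fst c \<in> sets borel" using chart_open(1)[OF c] by simp
  note [measurable] = chart_inv_measurable[OF c] volume_density_measurable[OF y c] h
  let ?R = "restrict_space lborel (snd c ` fst c)"
  have "has_bochner_integral ?R (\<lambda>u. volume_density c y u * h (chart_inv c u)) I"
    using I chart_open(2)[OF c] by (subst has_bochner_integral_restrict_space) auto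
  then have "has_bochner_integral (density ?R (\<lambda>u. ennreal (volume_density c y u))) (\<lambda>u. h (chart_inv c u)) I"
    using volume_density_pos[OF y c]
    by (intro has_bochner_integral_density) (auto simp: space_restrict_space intro!: less_imp_le AE_I2)
  then have "has_bochner_integral (chart_measure c y) h I"
    unfolding chart_measure_def by (intro has_bochner_integral_distr) auto
  moreover have "h \<in> borel_measurable (volume_measure A y)"
      "(\<lambda>p. indicator (fst c) p :: real) \<in> borel_measurable (volume_measure A y)"
    using fc h by (simp_all add: measurable_volume_measure[OF y])
  note integrable_density[OF this AE_I2] integral_density[OF this AE_I2]
  ultimately have "has_bochner_integral (volume_measure A y) (\<lambda>p. indicator (fst c) p *\<^sub>R h p) I"
    unfolding density_indicator_volume_measure[OF y c, symmetric] has_bochner_integral_iff by simp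
  moreover have "(\<lambda>p. indicator (fst c) p *\<^sub>R h p) = h"
    using off by (auto simp: fun_eq_iff indicator_def)
  ultimately show ?thesis by simp
qed

text \<open>Each point has an open neighbourhood of finite measure, because the volume density is
  bounded on a closed coordinate ball; finitely many of them cover \<open>K\<close>. As a
  consequence, constants supported on a compact set can serve as dominating functions.\<close>

lemma emeasure_volume_measure_compact:
  assumes y: "immersion A y" and K: "compact K"
  shows "emeasure (volume_measure A y) K < \<infinity>"
proof -
  have "\<exists>W. open W \<and> p \<in> W \<and> emeasure (volume_measure A y) W < \<infinity>" for p
  proof -
    let ?c = "chart_at A p"
    note c = chart_at_in[of p]
    obtain r where r: "r > 0" "cball (snd ?c p) r \<subseteq> snd ?c ` fst ?c"
      using open_contains_cball[THEN iffD1, OF chart_open(2)[OF c(1)], rule_format, OF imageI[OF c(2)]] by auto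
    let ?W = "fst ?c \<inter> snd ?c -` ball (snd ?c p) r"
    have oW: "open ?W"
      by (rule continuous_open_preimage[OF continuous_on_chart[OF c(1)] chart_open(1)[OF c(1)]]) simp
    have "continuous_on (cball (snd ?c p) r) (volume_density ?c y)"
      by (rule continuous_on_subset[OF C1_on_imp_continuous_on[OF C1_on_volume_density[OF y c(1)]] r(2)])
    then have "bounded (volume_density ?c y ` cball (snd ?c p) r)"
      by (intro compact_imp_bounded compact_continuous_image compact_cball)
    then obtain B where B: "\<forall>x\<in>volume_density ?c y ` cball (snd ?c p) r. norm x \<le> B"
      unfolding bounded_iff by (elim exE)
    have B': "volume_density ?c y u \<le> B" if "u \<in> cball (snd ?c p) r" for u
      using bspec[OF B imageI[OF that]] by simp
    have "emeasure (volume_measure A y) ?W = emeasure (chart_measure ?c y) ?W"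
      using oW by (intro volume_measure_works(2)[OF y c(1)]) auto
    also have "\<dots> = (\<integral>\<^sup>+u\<in>snd ?c ` (?W \<inter> fst ?c). ennreal (volume_density ?c y u) \<partial>lborel)"
      using oW by (intro emeasure_chart_measure[OF y c(1)]) auto
    also have "\<dots> \<le> (\<integral>\<^sup>+u. ennreal B * indicator (cball (snd ?c p) r) u \<partial>lborel)"
      using B' ball_subset_cball by (intro nn_integral_mono) (auto simp: indicator_def intro!: ennreal_leI)
    also have "\<dots> = ennreal B * emeasure lborel (cball (snd ?c p) r)"
      by (rule nn_integral_cmult_indicator) simp
    also have "\<dots> < \<infinity>"
      using emeasure_lborel_cball_finite by (auto simp: ennreal_mult_less_top)
    finally have "emeasure (volume_measure A y) ?W < \<infinity>" .
    moreover have "p \<in> ?W" using c(2) r(1) by simp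
    ultimately show ?thesis using oW by (intro exI[of _ ?W] conjI)
  qed
  then have "K \<subseteq> \<Union>{W. open W \<and> emeasure (volume_measure A y) W < \<infinity>}" by blast
  then obtain \<D> where \<D>: "\<D> \<subseteq> {W. open W \<and> emeasure (volume_measure A y) W < \<infinity>}"
      "finite \<D>" "K \<subseteq> \<Union>\<D>"
    by (rule compactE[OF K]) auto
  have sets: "W \<in> sets (volume_measure A y)" if "W \<in> \<D>" for W
    using \<D>(1) that by (auto simp: volume_measure_works(1)[OF y])
  have "emeasure (volume_measure A y) K \<le> emeasure (volume_measure A y) (\<Union>W\<in>\<D>. W)"
    using \<D> sets by (intro emeasure_mono sets.finite_UN) auto
  also have "\<dots> \<le> (\<Sum>W\<in>\<D>. emeasure (volume_measure A y) W)"
    using sets \<D>(2) by (intro emeasure_subadditive_finite) auto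
  also have "\<dots> < \<infinity>" using \<D>(1,2) by auto
  finally show ?thesis .
qed

section \<open>Comparison of the volume elements of two immersions\<close>

text \<open>This is the Radon-Nikodym derivative dV_z / dV_y. The Jacobian factors of a chart change
  cancel in the quotient, so the selected chart does not matter.\<close>

definition density_ratio :: "('a \<Rightarrow> real^'n) \<Rightarrow> ('a \<Rightarrow> real^'n) \<Rightarrow> 'a \<Rightarrow> real" where
  "density_ratio y z p =
     volume_density (chart_at A p) z (snd (chart_at A p) p) / volume_density (chart_at A p) y (snd (chart_at A p) p)"

lemma density_ratio_chart:
  assumes y: "immersion A y" and z: "immersion A z" and c: "c \<in> A" "p \<in> fst c"
  shows "density_ratio y z p = volume_density c z (snd c p) / volume_density c y (snd c p)"
  using volume_density_transition[OF y c(1) chart_at_in(1)[of p] c(2) chart_at_in(2)]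
    volume_density_transition[OF z c(1) chart_at_in(1)[of p] c(2) chart_at_in(2)]
    det_jac_transition[OF c(1) chart_at_in(1)[of p] c(2) chart_at_in(2)]
  by (simp add: density_ratio_def)

lemma continuous_on_density_ratio:
  assumes y: "immersion A y" and z: "immersion A z"
  shows "continuous_on UNIV (density_ratio y z)"
proof (rule continuous_on_UNIV_by_charts)
  fix c assume c: "c \<in> A"
  have "continuous_on (snd c ` fst c) (\<lambda>u. volume_density c z u / volume_density c y u)"
    by (intro continuous_on_divide C1_on_imp_continuous_on C1_on_volume_density y z c ballI
        less_imp_neq[THEN not_sym] volume_density_pos)
  then show "continuous_on (snd c ` fst c) (density_ratio y z \<circ> chart_inv c)"
    by (rule continuous_on_eq) (auto simp: density_ratio_chart[OF y z c] chart_inv_left[OF c])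
qed

lemma density_ratio_pos:
  assumes y: "immersion A y" and z: "immersion A z"
  shows "density_ratio y z p > 0"
  using volume_density_pos[OF y chart_at_in(1)[of p]] volume_density_pos[OF z chart_at_in(1)[of p]]
    chart_at_in(2)[of p] by (simp add: density_ratio_def)

lemma volume_measure_eq_density:
  assumes y: "immersion A y" and z: "immersion A z"
  shows "volume_measure A z = density (volume_measure A y) (\<lambda>p. ennreal (density_ratio y z p))"
proof (rule volume_measure_eqI[OF z])
  show "sets (density (volume_measure A y) (\<lambda>p. ennreal (density_ratio y z p))) = sets borel"
    by (simp add: volume_measure_works(1)[OF y])
  fix c E assume c: "c \<in> A" and E: "E \<in> sets borel" "E \<subseteq> fst c"
  note [measurable] = E(1)
  have m [measurable]: "density_ratio y z \<in> borel_measurable borel"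
    by (intro borel_measurable_continuous_onI continuous_on_density_ratio y z)
  have "emeasure (density (volume_measure A y) (\<lambda>p. ennreal (density_ratio y z p))) E =
     (\<integral>\<^sup>+p\<in>fst c. (ennreal (density_ratio y z p) * indicator E p) \<partial>volume_measure A y)"
    using E by (subst emeasure_density)
      (auto simp: measurable_volume_measure[OF y] volume_measure_works(1)[OF y] indicator_def intro!: nn_integral_cong)
  also have "\<dots> = (\<integral>\<^sup>+u\<in>snd c ` fst c. (ennreal (volume_density c y u) *
       (ennreal (density_ratio y z (chart_inv c u)) * indicator E (chart_inv c u))) \<partial>lborel)"
    by (intro nn_integral_volume_measure_chart[OF y c]) measurable
  also have "\<dots> = (\<integral>\<^sup>+u\<in>snd c ` E. ennreal (volume_density c z u) \<partial>lborel)"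
  proof (intro nn_integral_cong)
    fix u
    show "(ennreal (volume_density c y u) * (ennreal (density_ratio y z (chart_inv c u)) * indicator E (chart_inv c u))) *
       indicator (snd c ` fst c) u = ennreal (volume_density c z u) * indicator (snd c ` E) u"
    proof (cases "u \<in> snd c ` fst c")
      case True
      then obtain p where p: "p \<in> fst c" "u = snd c p" by auto
      have "volume_density c y u > 0" using volume_density_pos[OF y c] True by auto
      then have "ennreal (volume_density c y u) * ennreal (density_ratio y z p) = ennreal (volume_density c z u)"
        using p by (simp add: density_ratio_chart[OF y z c] ennreal_mult'[symmetric])
      moreover have "u \<in> snd c ` E \<longleftrightarrow> p \<in> E"
        using p chart_image_eq[OF c E(2)] chart_inv_left[OF c] by auto
      ultimately show ?thesis
        using True p by (simp add: chart_inv_left[OF c] mult.assoc[symmetric] indicator_def)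
    next
      case False
      then have "u \<notin> snd c ` E" using E by auto
      with False show ?thesis by simp
    qed
  qed
  also have "\<dots> = emeasure (chart_measure c z) E"
    using E by (simp add: emeasure_chart_measure[OF z c] Int_absorb2)
  finally show "emeasure (density (volume_measure A y) (\<lambda>p. ennreal (density_ratio y z p))) E =
     emeasure (chart_measure c z) E" .
qed

end

section \<open>Differentiation under the integral sign\<close>

lemma difference_quotient_bound:
  fixes f :: "real \<Rightarrow> real"
  assumes f: "\<And>r. \<bar>r - t\<bar> < \<delta> \<Longrightarrow> (f has_real_derivative f' r) (at r)"
    and bnd: "\<And>r. \<bar>r - t\<bar> < \<delta> \<Longrightarrow> \<bar>f' r\<bar> \<le> b" and s: "\<bar>s - t\<bar> < \<delta>" "s \<noteq> t"
  shows "\<bar>(f s - f t) / (s - t)\<bar> \<le> b"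
proof -
  have "\<exists>r. min s t < r \<and> r < max s t \<and> f (max s t) - f (min s t) = (max s t - min s t) * f' r"
    using s by (intro MVT2 f) auto
  then obtain r where r: "min s t < r" "r < max s t"
    "f (max s t) - f (min s t) = (max s t - min s t) * f' r" by auto
  have "(f s - f t) / (s - t) = f' r"
    using r(3) s(2) by (cases "s < t") (auto simp: field_simps)
  moreover have "\<bar>r - t\<bar> < \<delta>" using r s by (auto simp: min_def max_def split: if_splits)
  ultimately show ?thesis using bnd by simp
qed

text \<open>By the mean value theorem the bound on the derivatives also bounds the difference
  quotients. The limit is tested along sequences, where dominated convergence applies.\<close>

lemma has_real_derivative_integral:
  fixes f :: "'b \<Rightarrow> real \<Rightarrow> real"
  assumes \<delta>: "\<delta> > 0"
    and f: "\<And>s p. \<bar>s - t\<bar> < \<delta> \<Longrightarrow> p \<in> space M \<Longrightarrow> (f p has_real_derivative f' s p) (at s)"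
    and bnd: "\<And>s p. \<bar>s - t\<bar> < \<delta> \<Longrightarrow> p \<in> space M \<Longrightarrow> \<bar>f' s p\<bar> \<le> g p" and g: "integrable M g"
    and int: "\<And>s. \<bar>s - t\<bar> < \<delta> \<Longrightarrow> integrable M (\<lambda>p. f p s)"
    and f'm: "f' t \<in> borel_measurable M"
  shows "((\<lambda>s. LINT p|M. f p s) has_real_derivative (LINT p|M. f' t p)) (at t)"
proof -
  have "((\<lambda>s. ((LINT p|M. f p s) - (LINT p|M. f p t)) / (s - t)) \<longlongrightarrow> (LINT p|M. f' t p)) (at t)"
    unfolding tendsto_at_iff_sequentially
  proof (intro allI impI)
    fix X :: "nat \<Rightarrow> real" assume X: "\<forall>i. X i \<in> UNIV - {t}" "X \<longlonglongrightarrow> t"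
    then have "eventually (\<lambda>n. \<bar>X n - t\<bar> < \<delta>) sequentially"
      using \<delta> tendstoD[OF X(2) \<delta>] by (simp add: dist_real_def)
    \<comment> \<open>The sequence is near \<open>t\<close> only eventually; the shift by
      \<open>N\<close> makes the domination hold for every index.\<close>
    then obtain N where N: "\<And>n. \<bar>X (n + N) - t\<bar> < \<delta>"
      unfolding eventually_sequentially by (metis le_add2)
    have lim: "(\<lambda>n. LINT p|M. (f p (X (n + N)) - f p t) / (X (n + N) - t)) \<longlonglongrightarrow> (LINT p|M. f' t p)"
    proof (rule integral_dominated_convergence[OF f'm _ g])
      show "AE p in M. (\<lambda>n. (f p (X (n + N)) - f p t) / (X (n + N) - t)) \<longlonglongrightarrow> f' t p"
      proof (intro AE_I2)
        fix p assume "p \<in> space M"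
        then have "((\<lambda>s. (f p s - f p t) / (s - t)) \<longlongrightarrow> f' t p) (at t)"
          using f[of t p] \<delta> by (simp add: has_field_derivative_iff)
        then have "(\<lambda>n. (f p (X n) - f p t) / (X n - t)) \<longlonglongrightarrow> f' t p"
          using X unfolding tendsto_at_iff_sequentially comp_def by blast
        then show "(\<lambda>n. (f p (X (n + N)) - f p t) / (X (n + N) - t)) \<longlonglongrightarrow> f' t p"
          by (rule LIMSEQ_ignore_initial_segment)
      qed
      show "AE p in M. norm ((f p (X (n + N)) - f p t) / (X (n + N) - t)) \<le> g p" for n
      proof (intro AE_I2)
        fix p assume p: "p \<in> space M"
        show "norm ((f p (X (n + N)) - f p t) / (X (n + N) - t)) \<le> g p"
          using difference_quotient_bound[of t \<delta> "f p" "\<lambda>r. f' r p" "g p", OF f bnd N] p X(1) by simp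
      qed
      show "(\<lambda>p. (f p (X (n + N)) - f p t) / (X (n + N) - t)) \<in> borel_measurable M" for n
        using borel_measurable_integrable[OF int[OF N]] borel_measurable_integrable[OF int[of t]] \<delta> by simp
    qed
    have eq: "(LINT p|M. (f p (X (n + N)) - f p t) / (X (n + N) - t)) =
        ((LINT p|M. f p (X (n + N))) - (LINT p|M. f p t)) / (X (n + N) - t)" for n
      using int[OF N] int[of t] \<delta> by simp
    have "(\<lambda>n. ((LINT p|M. f p (X (n + N))) - (LINT p|M. f p t)) / (X (n + N) - t)) \<longlonglongrightarrow> (LINT p|M. f' t p)"
      using lim unfolding eq .
    then show "((\<lambda>s. ((LINT p|M. f p s) - (LINT p|M. f p t)) / (s - t)) \<circ> X) \<longlonglongrightarrow> (LINT p|M. f' t p)"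
      unfolding comp_def by (rule LIMSEQ_offset)
  qed
  then show ?thesis by (simp add: has_field_derivative_iff)
qed

text \<open>Integrability at \<open>t\<close> spreads to nearby parameters, since the difference of
  the two functions is dominated by a multiple of \<open>g\<close>. Hence a weighted volume that is
  finite at one time is finite at neighbouring times.\<close>

lemma integrable_of_deriv_bound:
  fixes f :: "'b \<Rightarrow> real \<Rightarrow> real"
  assumes f: "\<And>r p. \<bar>r - t\<bar> < \<delta> \<Longrightarrow> (f p has_real_derivative f' r p) (at r)"
    and bnd: "\<And>r p. \<bar>r - t\<bar> < \<delta> \<Longrightarrow> \<bar>f' r p\<bar> \<le> g p" and g: "integrable M g"
    and int: "integrable M (\<lambda>p. f p t)" and m: "(\<lambda>p. f p s) \<in> borel_measurable M" and s: "\<bar>s - t\<bar> < \<delta>"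
  shows "integrable M (\<lambda>p. f p s)"
proof (cases "s = t")
  case False
  have "integrable M (\<lambda>p. f p s - f p t)"
  proof (rule Bochner_Integration.integrable_bound)
    show "integrable M (\<lambda>p. \<bar>s - t\<bar> * g p)" using g by simp
    show "(\<lambda>p. f p s - f p t) \<in> borel_measurable M" using m borel_measurable_integrable[OF int] by simp
    show "AE p in M. norm (f p s - f p t) \<le> norm (\<bar>s - t\<bar> * g p)"
    proof (intro AE_I2)
      fix p
      have "\<bar>f p s - f p t\<bar> \<le> g p * \<bar>s - t\<bar>"
        using difference_quotient_bound[of t \<delta> "f p", OF f bnd s False] False by (simp add: abs_divide pos_divide_le_eq)
      then show "norm (f p s - f p t) \<le> norm (\<bar>s - t\<bar> * g p)" by (simp add: mult.commute)
    qed
  qed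
  from Bochner_Integration.integrable_add[OF this int] show ?thesis by simp
qed (use int in simp)

lemma frechet_derivative_zero_off_support:
  assumes "closed K" "\<And>u. u \<notin> K \<Longrightarrow> h u = 0" "u \<notin> K"
  shows "frechet_derivative h (at u) v = 0"
proof -
  have "((\<lambda>_. 0) has_derivative (\<lambda>_. 0)) (at u)" by simp
  from has_derivative_transform_within_open[OF this, of "- K" h] assms
  have "(h has_derivative (\<lambda>_. 0)) (at u)" by auto
  then show ?thesis by (metis frechet_derivative_at)
qed

lemma integrable_continuous_compact_support:
  fixes f :: "'b::euclidean_space \<Rightarrow> real"
  assumes "continuous_on UNIV f" "compact K" "\<And>u. u \<notin> K \<Longrightarrow> f u = 0"
  shows "integrable lborel f"
proof -
  have "integrable lborel (\<lambda>u. indicator K u *\<^sub>R f u)"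
    using assms by (intro borel_integrable_compact) (auto intro: continuous_on_subset)
  also have "(\<lambda>u. indicator K u *\<^sub>R f u) = f" using assms by (auto simp: fun_eq_iff indicator_def)
  finally show ?thesis .
qed

text \<open>By translation invariance the integral of \<open>h (u + s v)\<close> over \<open>u\<close> does not depend on \<open>s\<close>.\<close>

lemma has_bochner_integral_deriv_compact_support:
  fixes h :: "'b::euclidean_space \<Rightarrow> real"
  assumes h: "C1_on UNIV h" and K: "compact K" and off: "\<And>u. u \<notin> K \<Longrightarrow> h u = 0"
  shows "has_bochner_integral lborel (\<lambda>u. frechet_derivative h (at u) v) 0"
proof -
  let ?D = "\<lambda>u. frechet_derivative h (at u) v"
  have contD: "continuous_on UNIV ?D" by (rule C1_on_continuous_deriv[OF h])
  have conth: "continuous_on UNIV h" by (rule C1_on_imp_continuous_on[OF h])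
  have offD: "?D u = 0" if "u \<notin> K" for u
    by (rule frechet_derivative_zero_off_support[OF compact_imp_closed[OF K] off that])
  have intD: "integrable lborel ?D"
    by (rule integrable_continuous_compact_support[OF contD K offD])
  have "bounded (?D ` K)"
    using K by (intro compact_imp_bounded compact_continuous_image continuous_on_subset[OF contD]) auto
  then obtain B0 where "\<And>u. u \<in> K \<Longrightarrow> norm (?D u) \<le> B0" unfolding bounded_iff by blast
  \<comment> \<open>The maximum with 0 keeps the bound valid off \<open>K\<close>, also when
    \<open>K\<close> is empty and \<open>B0\<close> carries no information.\<close>
  then have B: "\<bar>?D u\<bar> \<le> max B0 0" for u
    using offD[of u] by (cases "u \<in> K") (auto simp: le_max_iff_disj)
  \<comment> \<open>A compact set containing the supports of all translates with parameter of
    absolute value below 1; it carries the dominating constant.\<close>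
  let ?K = "(\<lambda>(a, s). a - s *\<^sub>R v) ` (K \<times> {-1..1::real})"
  have cK: "compact ?K"
    by (intro compact_continuous_image compact_Times K compact_Icc)
      (auto simp: case_prod_unfold intro!: continuous_intros)
  have inK: "u \<in> ?K" if "u + s *\<^sub>R v \<in> K" "\<bar>s\<bar> < 1" for u s
    using that by (intro image_eqI[of _ _ "(u + s *\<^sub>R v, s)"]) auto
  have shift: "integrable lborel (\<lambda>u. h (u + s *\<^sub>R v))" "(LINT u|lborel. h (u + s *\<^sub>R v)) = (LINT u|lborel. h u)" for s
  proof -
    have i: "integrable (distr lborel borel ((+) (s *\<^sub>R v))) h"
      unfolding lborel_distr_plus by (rule integrable_continuous_compact_support[OF conth K off])
    have m: "h \<in> borel_measurable borel" by (rule borel_measurable_continuous_onI[OF conth])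
    show "integrable lborel (\<lambda>u. h (u + s *\<^sub>R v))"
      using i m by (subst (asm) integrable_distr_eq) (auto simp: add.commute)
    have "(LINT u|lborel. h u) = (LINT u|distr lborel borel ((+) (s *\<^sub>R v)). h u)"
      by (simp add: lborel_distr_plus)
    also have "\<dots> = (LINT u|lborel. h (u + s *\<^sub>R v))"
      using m by (subst integral_distr) (auto simp: add.commute)
    finally show "(LINT u|lborel. h (u + s *\<^sub>R v)) = (LINT u|lborel. h u)" ..
  qed
  have "((\<lambda>s. LINT u|lborel. h (u + s *\<^sub>R v)) has_real_derivative (LINT u|lborel. ?D (u + 0 *\<^sub>R v))) (at 0)"
  proof (rule has_real_derivative_integral[where \<delta> = 1 and g = "\<lambda>u. indicator ?K u *\<^sub>R max B0 0"])
    fix s :: real and u :: 'b assume s: "\<bar>s - 0\<bar> < 1"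
    show "((\<lambda>s. h (u + s *\<^sub>R v)) has_real_derivative ?D (u + s *\<^sub>R v)) (at s)"
      using has_vector_derivative_line[OF C1_on_differentiable[OF h UNIV_I]]
      by (simp add: has_real_derivative_iff_has_vector_derivative)
    show "\<bar>?D (u + s *\<^sub>R v)\<bar> \<le> indicator ?K u *\<^sub>R max B0 0"
      using B[of "u + s *\<^sub>R v"] offD[of "u + s *\<^sub>R v"] inK[of u s] s
      by (cases "u \<in> ?K") auto
  next
    show "integrable lborel (\<lambda>u. indicator ?K u *\<^sub>R max B0 0)"
      by (intro borel_integrable_compact cK continuous_on_const)
    show "(\<lambda>u. ?D (u + 0 *\<^sub>R v)) \<in> borel_measurable lborel"
      using borel_measurable_integrable[OF intD] by simp
  qed (simp_all add: shift)
  \<comment> \<open>The function of \<open>s\<close> is constant by translation invariance, so its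
    derivative, the integral of \<open>?D\<close>, is 0.\<close>
  then have "((\<lambda>s. LINT u|lborel. h u) has_real_derivative (LINT u|lborel. ?D u)) (at 0)"
    by (simp add: shift)
  then have "(LINT u|lborel. ?D u) = 0" using DERIV_const DERIV_unique by blast
  with intD show ?thesis by (simp add: has_bochner_integral_iff)
qed

section \<open>Derivative of the Gram volume, and rules for partial derivatives\<close>

text \<open>Serves twice: with the parameter running along a coordinate line, for the divergence
  theorem, and with the parameter being time, for the variation of the volume element.\<close>

lemma has_real_derivative_sqrt_det_gram:
  fixes Y :: "real \<Rightarrow> real^'m^'n"
  assumes Y: "\<And>i. ((\<lambda>s. column i (Y s)) has_vector_derivative column i X) (at t)"
    and pos: "det (transpose (Y t) ** Y t) > 0"
  shows "((\<lambda>s. sqrt (det (transpose (Y s) ** Y s))) has_real_derivative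
    sqrt (det (transpose (Y t) ** Y t)) * tangential_trace (Y t) X) (at t)"
proof -
  have G: "((\<lambda>s. (transpose (Y s) ** Y s) $ i $ j) has_real_derivative
      (transpose X ** Y t + transpose (Y t) ** X) $ i $ j) (at t)" for i j
  proof -
    have eq: "(transpose P ** Q) $ i $ j = column i P \<bullet> column j Q" for P Q :: "real^'m^'n"
      by (simp add: matrix_matrix_mult_def transpose_def column_def inner_vec_def)
    have "((\<lambda>s. column i (Y s) \<bullet> column j (Y s)) has_vector_derivative
       column i (Y t) \<bullet> column j X + column i X \<bullet> column j (Y t)) (at t)"
      by (rule bounded_bilinear.has_vector_derivative[OF bounded_bilinear_inner Y Y])
    then show ?thesis
      by (simp add: has_real_derivative_iff_has_vector_derivative eq add.commute)
  qed
  show ?thesis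
    using has_real_derivative_sqrt_det[OF G pos] trace_matrix_inv_gram_deriv[of "Y t" X] pos by simp
qed

lemma partial_eqI: "(f has_derivative f') (at u) \<Longrightarrow> partial f i u = f' (axis i 1)"
  by (simp add: partial_def frechet_derivative_at[symmetric])

lemma partial_sum:
  assumes "\<And>k. k \<in> I \<Longrightarrow> f k differentiable (at u)"
  shows "partial (\<lambda>u. \<Sum>k\<in>I. f k u) i u = (\<Sum>k\<in>I. partial (f k) i u)"
proof -
  have "((\<lambda>u. \<Sum>k\<in>I. f k u) has_derivative (\<lambda>v. \<Sum>k\<in>I. frechet_derivative (f k) (at u) v)) (at u)"
    using assms by (intro has_derivative_sum) (simp add: frechet_derivative_works[symmetric])
  from partial_eqI[OF this] show ?thesis by (simp add: partial_def)
qed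

lemma partial_bilinear:
  assumes bl: "bounded_bilinear bl" and "f differentiable (at u)" "g differentiable (at u)"
  shows "partial (\<lambda>u. bl (f u) (g u)) i u = bl (f u) (partial g i u) + bl (partial f i u) (g u)"
proof -
  have "((\<lambda>u. bl (f u) (g u)) has_derivative
      (\<lambda>v. bl (f u) (frechet_derivative g (at u) v) + bl (frechet_derivative f (at u) v) (g u))) (at u)"
    using assms by (intro bounded_bilinear.FDERIV[OF bl]) (simp_all add: frechet_derivative_works[symmetric])
  from partial_eqI[OF this] show ?thesis by (simp add: partial_def)
qed

lemma partial_cong_open:
  assumes "open S" "u \<in> S" "\<And>u. u \<in> S \<Longrightarrow> f u = g u" "f differentiable (at u)"
  shows "partial f i u = partial g i u"
  unfolding partial_def
  using frechet_derivative_transform_within_open[OF assms(4,1,2)] assms(3) by metis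

section \<open>The divergence theorem\<close>

context smooth_manifold
begin

text \<open>Jacobi's formula along the line \<open>u + s *\<^sub>R axis k 1\<close>, where the
  columns of the Jacobian have the second partial derivatives of \<open>y\<close> as their
  derivatives.\<close>

lemma partial_volume_density:
  fixes y :: "'a \<Rightarrow> real^'n"
  assumes y: "immersion A y" and c: "c \<in> A" and u: "u \<in> snd c ` fst c"
  shows "partial (volume_density c y) k u = volume_density c y u *
    (\<Sum>i\<in>UNIV. \<Sum>j\<in>UNIV. matrix_inv (metric_matrix c y u) $ i $ j *
       (partial (y \<circ> chart_inv c) j u \<bullet> partial (partial (y \<circ> chart_inv c) i) k u))"
proof -
  let ?y = "y \<circ> chart_inv c"
  let ?Y = "\<lambda>s::real. jac ?y (u + s *\<^sub>R axis k 1)"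
  let ?X = "(\<chi> l i. partial (partial ?y i) k u $ l) :: real^'m^'n"
  have X: "column i ?X = partial (partial ?y i) k u" for i
    by (simp add: column_def vec_eq_iff)
  have "((\<lambda>s. column i (?Y s)) has_vector_derivative column i ?X) (at 0)" for i
    unfolding column_jac X
    using has_vector_derivative_line[of "partial ?y i" u 0] C1_on_differentiable[OF immersion_C1_on_partial[OF y c] u]
    by (simp add: partial_def)
  from has_real_derivative_sqrt_det_gram[OF this]
  have "((\<lambda>s. volume_density c y (u + s *\<^sub>R axis k 1)) has_real_derivative
     volume_density c y u * tangential_trace (jac ?y u) ?X) (at 0)"
    using immersion_det_pos[OF y c u] by (simp add: volume_density_def metric_matrix_eq)
  moreover have "((\<lambda>s. volume_density c y (u + s *\<^sub>R axis k 1)) has_real_derivative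
     partial (volume_density c y) k u) (at 0)"
    using has_vector_derivative_line[of "volume_density c y" u 0] C1_on_differentiable[OF C1_on_volume_density[OF y c] u]
    by (simp add: has_real_derivative_iff_has_vector_derivative partial_def)
  ultimately have "partial (volume_density c y) k u = volume_density c y u * tangential_trace (jac ?y u) ?X"
    by (rule DERIV_unique[symmetric])
  then show ?thesis
    by (simp only: tangential_trace_eq_sum metric_matrix_eq column_jac X)
qed

text \<open>The contravariant components of the tangent part of \<open>Z\<close>, that is, its
  coefficients in the basis of partial derivatives of \<open>y\<close>.\<close>

definition tangent_coord :: "('a, 'm) chart \<Rightarrow> ('a \<Rightarrow> real^'n) \<Rightarrow> ('a \<Rightarrow> real^'n) \<Rightarrow> 'm \<Rightarrow> real^'m \<Rightarrow> real" where
  "tangent_coord c y Z i u = (\<Sum>j\<in>UNIV. matrix_inv (metric_matrix c y u) $ i $ j *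
     ((Z \<circ> chart_inv c) u \<bullet> partial (y \<circ> chart_inv c) j u))"

lemma C1_on_tangent_coord:
  assumes y: "immersion A y" and c: "c \<in> A" and Z: "C1_map Z"
  shows "C1_on (snd c ` fst c) (tangent_coord c y Z i)"
  unfolding tangent_coord_def
  by (intro C1_on_sum C1_on_mult C1_on_inner C1_on_metric_inv immersion_C1_on_partial C1_map_D y c Z)

lemma mult_vec_eq_sum_partial:
  "jac f u *v a = (\<Sum>i\<in>UNIV. a $ i *\<^sub>R partial f i u)"
  by (simp add: matrix_mult_sum column_jac scalar_mult_eq_scaleR)

lemma tangent_coord_eq:
  "tangent_coord c y Z i u =
    (matrix_inv (metric_matrix c y u) *v (transpose (jac (y \<circ> chart_inv c) u) *v Z (chart_inv c u))) $ i"
  by (simp add: tangent_coord_def matrix_vector_mult_def[of "matrix_inv _"]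
      vector_matrix_mult_def inner_vec_def mult_ac flip: column_jac)
    (simp add: column_def mult.commute)

lemma tangent_coord_works:
  assumes y: "immersion A y" and c: "c \<in> A" and u: "u \<in> snd c ` fst c"
    and Z: "Z (chart_inv c u) \<in> tangent_space A y (chart_inv c u)"
  shows "(Z \<circ> chart_inv c) u = (\<Sum>i\<in>UNIV. tangent_coord c y Z i u *\<^sub>R partial (y \<circ> chart_inv c) i u)"
proof -
  let ?Y = "jac (y \<circ> chart_inv c) u"
  let ?G = "metric_matrix c y u"
  obtain a where a: "Z (chart_inv c u) = ?Y *v a"
    using Z chart_inv_in[OF c u] tangent_space_chart[OF y c, of "chart_inv c u"] chart_inv_right[OF c u] by auto
  have "det ?G \<noteq> 0" using immersion_det_pos[OF y c u] by simp
  have "matrix_inv ?G *v (transpose ?Y *v (?Y *v a)) = (matrix_inv ?G ** ?G) *v a"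
    by (simp only: matrix_vector_mul_assoc metric_matrix_eq matrix_mul_assoc)
  then have "tangent_coord c y Z i u = a $ i" for i
    unfolding tangent_coord_eq a by (simp add: matrix_inv_works[OF \<open>det ?G \<noteq> 0\<close>])
  then show ?thesis by (simp add: a mult_vec_eq_sum_partial)
qed

text \<open>The classical expression of the divergence as sqrt(det g)^(-1) times the coordinate
  divergence of sqrt(det g) Z^k. The coefficients of Z differentiate to the trace term; the basis
  vectors contribute second derivatives of \<open>y\<close>, which after swapping their order
  contract to the logarithmic derivative of the volume density.\<close>

lemma tdiv_tangent:
  fixes y Z :: "'a \<Rightarrow> real^'n"
  assumes y: "immersion A y" and c: "c \<in> A" and u: "u \<in> snd c ` fst c"
    and Z: "C1_map Z" "\<And>p. Z p \<in> tangent_space A y p"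
  shows "volume_density c y u * tdiv c y Z (chart_inv c u) =
    (\<Sum>k\<in>UNIV. partial (\<lambda>u. volume_density c y u * tangent_coord c y Z k u) k u)"
proof -
  let ?U = "snd c ` fst c"
  let ?y = "y \<circ> chart_inv c"
  let ?W = "tangent_coord c y Z"
  let ?g = "\<lambda>i j. matrix_inv (metric_matrix c y u) $ i $ j"
  note dW = C1_on_differentiable[OF C1_on_tangent_coord[OF y c Z(1)] u]
  note dy = C1_on_differentiable[OF immersion_C1_on_partial[OF y c] u]
  note dv = C1_on_differentiable[OF C1_on_volume_density[OF y c] u]
  have det: "det (metric_matrix c y u) \<noteq> 0" using immersion_det_pos[OF y c u] by simp
  have pZ: "partial (Z \<circ> chart_inv c) i u =
      (\<Sum>k\<in>UNIV. ?W k u *\<^sub>R partial (partial ?y k) i u + partial (?W k) i u *\<^sub>R partial ?y k u)" for i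
  proof -
    have "partial (Z \<circ> chart_inv c) i u = partial (\<lambda>u. \<Sum>k\<in>UNIV. ?W k u *\<^sub>R partial ?y k u) i u"
      by (intro partial_cong_open[OF chart_open(2)[OF c] u] tangent_coord_works y c Z(2)
          C1_on_differentiable[OF C1_map_D[OF Z(1) c] u])
    also have "\<dots> = (\<Sum>k\<in>UNIV. partial (\<lambda>u. ?W k u *\<^sub>R partial ?y k u) i u)"
      by (intro partial_sum differentiable_scaleR dW dy)
    also have "\<dots> = (\<Sum>k\<in>UNIV. ?W k u *\<^sub>R partial (partial ?y k) i u + partial (?W k) i u *\<^sub>R partial ?y k u)"
      by (intro sum.cong refl partial_bilinear[OF bounded_bilinear_scaleR] dW dy)
    finally show ?thesis .
  qed
  have sym: "partial (partial ?y k) i u = partial (partial ?y i) k u" for i k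
  proof -
    have "C1_on ?U (\<lambda>u. frechet_derivative ?y (at u) v)" for v
      using y c unfolding immersion_def smooth_map_def by (auto intro: smooth_on_imp_C1_on_deriv)
    from frechet_derivative_commute[OF chart_open(2)[OF c] u C1_map_D[OF immersion_C1_map[OF y] c] this]
    show ?thesis by (simp add: partial_def[abs_def])
  qed
  have delta: "(\<Sum>j\<in>UNIV. ?g i j * (partial ?y j u \<bullet> partial ?y k u)) = (if i = k then 1 else 0)" for i k
  proof -
    have "(matrix_inv (metric_matrix c y u) ** metric_matrix c y u) $ i $ k = (if i = k then 1 else 0)"
      unfolding matrix_inv_works(2)[OF det] by (simp add: mat_def)
    then show ?thesis by (simp add: matrix_matrix_mult_def metric_matrix_def)
  qed
  have rotate: "(\<Sum>i\<in>UNIV. \<Sum>j\<in>UNIV. \<Sum>k\<in>UNIV. f i j k) = (\<Sum>k\<in>UNIV. \<Sum>i\<in>UNIV. \<Sum>j\<in>UNIV. f i j k)"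
    for f :: "'m \<Rightarrow> 'm \<Rightarrow> 'm \<Rightarrow> real"
    by (subst (2) sum.swap, subst sum.swap) (rule refl)
  have "tdiv c y Z (chart_inv c u) = (\<Sum>i\<in>UNIV. \<Sum>j\<in>UNIV. ?g i j * (partial ?y j u \<bullet> partial (Z \<circ> chart_inv c) i u))"
    by (simp add: tdiv_eq_sum chart_inv_right[OF c u])
  also have "\<dots> = (\<Sum>i\<in>UNIV. \<Sum>j\<in>UNIV. \<Sum>k\<in>UNIV. ?W k u * (?g i j * (partial ?y j u \<bullet> partial (partial ?y i) k u))
      + partial (?W k) i u * (?g i j * (partial ?y j u \<bullet> partial ?y k u)))"
    unfolding pZ sym by (simp add: inner_sum_right inner_add_right sum_distrib_left algebra_simps)
  also have "\<dots> = (\<Sum>k\<in>UNIV. \<Sum>i\<in>UNIV. \<Sum>j\<in>UNIV. ?W k u * (?g i j * (partial ?y j u \<bullet> partial (partial ?y i) k u))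
      + partial (?W k) i u * (?g i j * (partial ?y j u \<bullet> partial ?y k u)))"
    by (rule rotate)
  also have "\<dots> = (\<Sum>k\<in>UNIV. ?W k u * (\<Sum>i\<in>UNIV. \<Sum>j\<in>UNIV. ?g i j * (partial ?y j u \<bullet> partial (partial ?y i) k u))
      + (\<Sum>i\<in>UNIV. partial (?W k) i u * (if i = k then 1 else 0)))"
    by (simp add: sum.distrib sum_distrib_left[symmetric] delta)
  also have "\<dots> = (\<Sum>k\<in>UNIV. ?W k u * (\<Sum>i\<in>UNIV. \<Sum>j\<in>UNIV. ?g i j * (partial ?y j u \<bullet> partial (partial ?y i) k u))
      + partial (?W k) k u)"
    by (simp add: if_distrib sum.delta cong: if_cong)
  finally have t: "tdiv c y Z (chart_inv c u) = (\<Sum>k\<in>UNIV. ?W k u *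
      (\<Sum>i\<in>UNIV. \<Sum>j\<in>UNIV. ?g i j * (partial ?y j u \<bullet> partial (partial ?y i) k u)) + partial (?W k) k u)" .
  have "partial (\<lambda>u. volume_density c y u * ?W k u) k u =
     volume_density c y u * (?W k u * (\<Sum>i\<in>UNIV. \<Sum>j\<in>UNIV. ?g i j * (partial ?y j u \<bullet> partial (partial ?y i) k u))
       + partial (?W k) k u)" for k
    unfolding partial_bilinear[OF bounded_bilinear_mult dv dW] partial_volume_density[OF y c u]
    by (simp add: algebra_simps)
  then show ?thesis by (simp add: t sum_distrib_left)
qed

abbreviation tdivg :: "('a \<Rightarrow> real^'n) \<Rightarrow> ('a \<Rightarrow> real^'n) \<Rightarrow> 'a \<Rightarrow> real" where
  "tdivg y Z p \<equiv> tdiv (chart_at A p) y Z p"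

lemma tdivg_chart:
  assumes y: "immersion A y" and c: "c \<in> A" "p \<in> fst c" and Z: "C1_map Z"
  shows "tdivg y Z p = tdiv c y Z p"
  by (intro tdiv_transition y chart_at_in c C1_map_differentiable Z)

lemma continuous_on_tdivg:
  fixes y Z :: "'a \<Rightarrow> real^'n"
  assumes y: "immersion A y" and Z: "C1_map Z"
  shows "continuous_on UNIV (tdivg y Z)"
proof (rule continuous_on_UNIV_by_charts)
  fix c assume c: "c \<in> A"
  have "continuous_on (snd c ` fst c) (\<lambda>u. \<Sum>i\<in>UNIV. \<Sum>j\<in>UNIV. matrix_inv (metric_matrix c y u) $ i $ j *
      (partial (y \<circ> chart_inv c) j u \<bullet> partial (Z \<circ> chart_inv c) i u))"
    unfolding partial_def[of "Z \<circ> chart_inv c"]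
    by (intro continuous_on_sum continuous_on_mult continuous_on_inner C1_on_continuous_deriv[OF C1_map_D[OF Z c]]
       C1_on_imp_continuous_on[OF C1_on_metric_inv[OF y c]] C1_on_imp_continuous_on[OF immersion_C1_on_partial[OF y c]])
  then show "continuous_on (snd c ` fst c) (tdivg y Z \<circ> chart_inv c)"
  proof (rule continuous_on_eq)
    fix u assume u: "u \<in> snd c ` fst c"
    have "(tdivg y Z \<circ> chart_inv c) u = tdiv c y Z (chart_inv c u)"
      using tdivg_chart[OF y c chart_inv_in[OF c u] Z] by simp
    then show "(\<Sum>i\<in>UNIV. \<Sum>j\<in>UNIV. matrix_inv (metric_matrix c y u) $ i $ j *
      (partial (y \<circ> chart_inv c) j u \<bullet> partial (Z \<circ> chart_inv c) i u)) = (tdivg y Z \<circ> chart_inv c) u"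
      by (simp only: tdiv_eq_sum chart_inv_right[OF c u])
  qed
qed

lemma tdivg_zero_off_support:
  assumes "closed K" "\<And>p. p \<notin> K \<Longrightarrow> Z p = 0" "p \<notin> K"
  shows "tdivg y Z p = 0"
proof -
  let ?c = "chart_at A p"
  note c = chart_at_in[of p]
  have "closed (- (snd ?c ` (fst ?c - K)))"
    using assms(1) by (intro closed_Compl[OF open_chart_image] c open_Diff chart_open) auto
  then have "partial (Z \<circ> chart_inv ?c) i (snd ?c p) = 0" for i
    unfolding partial_def
    by (rule frechet_derivative_zero_off_support) (use assms c in \<open>auto simp: chart_inv_left\<close>)
  then show ?thesis by (simp add: tdiv_eq_sum)
qed

lemma compact_chart_image:
  assumes "c \<in> A" "compact K" "K \<subseteq> fst c"
  shows "compact (snd c ` K)"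
  using assms continuous_on_subset[OF continuous_on_chart] by (intro compact_continuous_image) auto

text \<open>In coordinates the integrand is a sum of partial derivatives of compactly supported C1
  functions, each of which integrates to zero.\<close>

lemma divergence_theorem_chart:
  fixes y Z :: "'a \<Rightarrow> real^'n"
  assumes y: "immersion A y" and c: "c \<in> A" and K: "compact K" "K \<subseteq> fst c"
    and Z: "C1_map Z" "\<And>p. Z p \<in> tangent_space A y p" and off: "\<And>p. p \<notin> K \<Longrightarrow> Z p = 0"
  shows "has_bochner_integral (volume_measure A y) (tdivg y Z) 0"
proof (rule has_bochner_integral_volume_measure_chart[OF y c])
  let ?U = "snd c ` fst c"
  show "tdivg y Z \<in> borel_measurable borel"
    by (rule borel_measurable_continuous_onI[OF continuous_on_tdivg[OF y Z(1)]])
  have offt: "tdivg y Z p = 0" if "p \<notin> K" for p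
    by (rule tdivg_zero_off_support[OF compact_imp_closed[OF K(1)] off that])
  show "tdivg y Z p = 0" if "p \<notin> fst c" for p using offt that K by auto
  \<comment> \<open>Extension by zero is C1 on the whole space because the coordinate domain and the
    complement of the compact support are open and cover it.\<close>
  define h where "h = (\<lambda>k u. if u \<in> ?U then volume_density c y u * tangent_coord c y Z k u else 0)"
  have cK: "compact (snd c ` K)" by (rule compact_chart_image[OF c K])
  have offh: "h k u = 0" if "u \<notin> snd c ` K" for k u
  proof (cases "u \<in> ?U")
    case True
    then obtain p where p: "p \<in> fst c" "u = snd c p" by auto
    then have "Z p = 0" using that by (intro off) auto
    with p show ?thesis by (simp add: h_def tangent_coord_def chart_inv_left[OF c])
  qed (simp add: h_def)
  have hC1: "C1_on UNIV (h k)" for k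
  proof (rule C1_on_local)
    fix u
    show "\<exists>T. open T \<and> u \<in> T \<and> C1_on T (h k)"
    proof (cases "u \<in> ?U")
      case True
      have "C1_on ?U (\<lambda>u. volume_density c y u * tangent_coord c y Z k u)"
        by (intro C1_on_mult C1_on_volume_density C1_on_tangent_coord y c Z)
      then have "C1_on ?U (h k)"
        by (rule C1_on_cong[OF chart_open(2)[OF c]]) (simp add: h_def)
      with True chart_open(2)[OF c] show ?thesis by blast
    next
      case False
      have "open (- (snd c ` K))" using compact_imp_closed[OF cK] by (rule open_Compl)
      moreover from this have "C1_on (- (snd c ` K)) (h k)"
        by (rule C1_on_cong[OF _ C1_on_const[where c = 0]]) (simp add: offh)
      ultimately show ?thesis using False K(2) by blast
    qed
  qed
  have "has_bochner_integral lborel (\<lambda>u. \<Sum>k\<in>UNIV. partial (h k) k u) (\<Sum>k\<in>(UNIV::'m set). 0)"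
    unfolding partial_def
    by (intro has_bochner_integral_sum has_bochner_integral_deriv_compact_support[OF hC1 cK offh])
  also have "(\<lambda>u. \<Sum>k\<in>UNIV. partial (h k) k u) =
      (\<lambda>u. indicator ?U u *\<^sub>R (volume_density c y u * tdivg y Z (chart_inv c u)))"
  proof
    fix u
    show "(\<Sum>k\<in>UNIV. partial (h k) k u) = indicator ?U u *\<^sub>R (volume_density c y u * tdivg y Z (chart_inv c u))"
    proof (cases "u \<in> ?U")
      case True
      have "partial (h k) k u = partial (\<lambda>u. volume_density c y u * tangent_coord c y Z k u) k u" for k
        by (rule partial_cong_open[OF chart_open(2)[OF c] True _ C1_on_differentiable[OF hC1 UNIV_I]]) (simp add: h_def)
      then show ?thesis
        using True tdiv_tangent[OF y c True Z] tdivg_chart[OF y c chart_inv_in[OF c True] Z(1)] by simp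
    next
      case False
      then have nu: "u \<notin> snd c ` K" using K(2) by auto
      have "partial (h k) k u = 0" for k
        unfolding partial_def by (rule frechet_derivative_zero_off_support[OF compact_imp_closed[OF cK] offh nu])
      with False show ?thesis by simp
    qed
  qed
  finally show "has_bochner_integral lborel
      (\<lambda>u. indicator ?U u *\<^sub>R (volume_density c y u * tdivg y Z (chart_inv c u))) 0" by simp
qed

end

section \<open>Bump functions and passage from one chart to the manifold\<close>

text \<open>The square of the positive part is an elementary C1 function vanishing on a half-line,
  which is enough regularity for the cut-offs below.\<close>

lemma has_real_derivative_pos_part_sq:
  "((\<lambda>x::real. (max 0 x)\<^sup>2) has_real_derivative 2 * max 0 x) (at x)"
proof (cases x "0::real" rule: linorder_cases)
  case less
  have "((\<lambda>x::real. 0) has_real_derivative 2 * max 0 x) (at x)" using less by simp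
  then show ?thesis
    by (rule has_field_derivative_transform_within_open[where S = "{..<0}"]) (use less in auto)
next
  case greater
  have "((\<lambda>x::real. x\<^sup>2) has_real_derivative 2 * max 0 x) (at x)"
    using greater by (auto intro!: derivative_eq_intros)
  then show ?thesis
    by (rule has_field_derivative_transform_within_open[where S = "{0<..}"]) (use greater in auto)
next
  case equal
  have "((\<lambda>h::real. (max 0 h)\<^sup>2 / h) \<longlongrightarrow> 0) (at 0)"
  proof (rule Lim_null_comparison[where g = "\<lambda>h. \<bar>h\<bar>"])
    show "\<forall>\<^sub>F h::real in at 0. norm ((max 0 h)\<^sup>2 / h) \<le> \<bar>h\<bar>"
      by (intro always_eventually allI) (auto simp: max_def power2_eq_square)
    show "((\<lambda>h::real. \<bar>h\<bar>) \<longlongrightarrow> 0) (at 0)" by (intro tendsto_rabs_zero tendsto_ident_at)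
  qed
  then show ?thesis by (simp add: has_field_derivative_iff equal)
qed

lemma C1_on_pos_part_sq:
  fixes f :: "'b::real_normed_vector \<Rightarrow> real"
  assumes "C1_on S f" shows "C1_on S (\<lambda>u. (max 0 (f u))\<^sup>2)"
  by (rule C1_on_real_compose[OF assms has_real_derivative_pos_part_sq])
    (intro continuous_intros continuous_on_max C1_on_imp_continuous_on assms)

context smooth_manifold
begin

text \<open>Off a closed set where all the nonzero values lie, the function is locally zero. This
  supplies the exterior case whenever \<open>C1_map_local\<close> is applied to an extension by
  zero.\<close>

lemma C1_near_vanishing:
  assumes "closed K" "\<And>q. q \<notin> K \<Longrightarrow> f q = 0" "p \<notin> K"
  shows "\<exists>d W. d \<in> A \<and> p \<in> fst d \<and> open W \<and> snd d p \<in> W \<and> C1_on W (f \<circ> chart_inv d)"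
proof -
  let ?d = "chart_at A p"
  note d = chart_at_in[of p]
  let ?W = "snd ?d ` (fst ?d - K)"
  have W: "open ?W"
    by (intro open_chart_image[OF d(1)] open_Diff chart_open(1)[OF d(1)] assms(1)) auto
  have "C1_on ?W (f \<circ> chart_inv ?d)"
    by (rule C1_on_cong[OF W C1_on_const[where c = 0]]) (auto simp: assms(2) chart_inv_left[OF d(1)])
  with W d assms(3) show ?thesis by (intro exI[of _ ?d] exI[of _ ?W]) auto
qed

text \<open>A squared positive part of r^2 minus the squared coordinate distance, extended by zero.
  The squared distance avoids the singularity of the norm at the centre. The image \<open>?K\<close>
  of the closed coordinate ball is compact, hence closed since the manifold is Hausdorff, which
  makes the extension C1.\<close>

lemma bump_function:
  obtains \<beta> :: "'a \<Rightarrow> real" and K c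
  where "C1_map \<beta>" "\<And>q. \<beta> q \<ge> 0" "\<beta> p > 0" "compact K" "\<And>q. q \<notin> K \<Longrightarrow> \<beta> q = 0" "c \<in> A" "K \<subseteq> fst c"
proof -
  let ?c = "chart_at A p"
  note c = chart_at_in[of p]
  let ?U = "snd ?c ` fst ?c"
  let ?a = "snd ?c p"
  obtain r where r: "r > 0" "cball ?a r \<subseteq> ?U"
    using open_contains_cball[THEN iffD1, OF chart_open(2)[OF c(1)], rule_format, OF imageI[OF c(2)]] by auto
  define \<beta> where "\<beta> q = (if q \<in> fst ?c then (max 0 (r\<^sup>2 - (snd ?c q - ?a) \<bullet> (snd ?c q - ?a)))\<^sup>2 else 0)" for q
  let ?K = "chart_inv ?c ` cball ?a r"
  have K: "compact ?K"
    by (intro compact_continuous_image continuous_on_subset[OF continuous_on_chart_inv[OF c(1)] r(2)] compact_cball)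
  have KU: "?K \<subseteq> fst ?c" using r(2) chart_inv_in[OF c(1)] by auto
  have off: "\<beta> q = 0" if "q \<notin> ?K" for q
  proof (cases "q \<in> fst ?c")
    case True
    have "snd ?c q \<notin> cball ?a r"
      using that chart_inv_left[OF c(1) True] by force
    then have "r < norm (snd ?c q - ?a)" by (simp add: dist_norm norm_minus_commute)
    then have "r\<^sup>2 < (norm (snd ?c q - ?a))\<^sup>2" using r(1) by (intro power_strict_mono) auto
    then show ?thesis by (simp add: \<beta>_def power2_norm_eq_inner)
  qed (simp add: \<beta>_def)
  have "C1_map \<beta>"
  proof (rule C1_map_local)
    fix q
    show "\<exists>d W. d \<in> A \<and> q \<in> fst d \<and> open W \<and> snd d q \<in> W \<and> C1_on W (\<beta> \<circ> chart_inv d)"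
    proof (cases "q \<in> fst ?c")
      case True
      have "C1_on ?U (\<lambda>u. (max 0 (r\<^sup>2 - (u - ?a) \<bullet> (u - ?a)))\<^sup>2)"
        by (intro C1_on_pos_part_sq C1_on_diff C1_on_inner C1_on_id C1_on_const)
      then have "C1_on ?U (\<beta> \<circ> chart_inv ?c)"
        by (rule C1_on_cong[OF chart_open(2)[OF c(1)]])
          (auto simp: \<beta>_def chart_inv_left[OF c(1)])
      with True c(1) chart_open(2)[OF c(1)] show ?thesis by (intro exI[of _ ?c] exI[of _ ?U]) auto
    next
      case False
      with KU have "q \<notin> ?K" by blast
      then show ?thesis by (intro C1_near_vanishing[OF compact_imp_closed[OF K] off])
    qed
  qed
  moreover have "\<beta> p > 0" using r c by (simp add: \<beta>_def)
  moreover have "\<beta> q \<ge> 0" for q by (simp add: \<beta>_def)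
  ultimately show ?thesis using that[of \<beta> ?K ?c] K off c(1) KU by simp
qed

lemma tdivg_sum:
  assumes "\<And>k. k \<in> I \<Longrightarrow> C1_map (Z k)"
  shows "tdivg y (\<lambda>q. \<Sum>k\<in>I. Z k q) p = (\<Sum>k\<in>I. tdivg y (Z k) p)"
proof -
  let ?c = "chart_at A p"
  have "partial ((\<lambda>q. \<Sum>k\<in>I. Z k q) \<circ> chart_inv ?c) i (snd ?c p) =
      (\<Sum>k\<in>I. partial (Z k \<circ> chart_inv ?c) i (snd ?c p))" for i
    using partial_sum[of I "\<lambda>k. Z k \<circ> chart_inv ?c"] C1_map_differentiable[OF assms chart_at_in]
    by (simp add: comp_def)
  then have "tdivg y (\<lambda>q. \<Sum>k\<in>I. Z k q) p = (\<Sum>i\<in>UNIV. \<Sum>j\<in>UNIV. \<Sum>k\<in>I.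
     matrix_inv (metric_matrix ?c y (snd ?c p)) $ i $ j *
      (partial (y \<circ> chart_inv ?c) j (snd ?c p) \<bullet> partial (Z k \<circ> chart_inv ?c) i (snd ?c p)))"
    by (simp add: tdiv_eq_sum inner_sum_right sum_distrib_left)
  also have "\<dots> = (\<Sum>i\<in>UNIV. \<Sum>k\<in>I. \<Sum>j\<in>UNIV.
     matrix_inv (metric_matrix ?c y (snd ?c p)) $ i $ j *
      (partial (y \<circ> chart_inv ?c) j (snd ?c p) \<bullet> partial (Z k \<circ> chart_inv ?c) i (snd ?c p)))"
    by (intro sum.cong refl) (rule sum.swap)
  also have "\<dots> = (\<Sum>k\<in>I. tdivg y (Z k) p)"
    unfolding tdiv_eq_sum by (rule sum.swap)
  finally show ?thesis .
qed

theorem divergence_theorem: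
  fixes y Z :: "'a \<Rightarrow> real^'n"
  assumes y: "immersion A y" and K: "compact K"
    and Z: "C1_map Z" "\<And>p. Z p \<in> tangent_space A y p" and off: "\<And>p. p \<notin> K \<Longrightarrow> Z p = 0"
  shows "has_bochner_integral (volume_measure A y) (tdivg y Z) 0"
proof -
  \<comment> \<open>All data of a bump function around \<open>p\<close> are packed into one
    predicate, so that a single application of choice yields them for all points.\<close>
  define B where "B = (\<lambda>p (\<beta> :: 'a \<Rightarrow> real, L, c). C1_map \<beta> \<and> (\<forall>q. \<beta> q \<ge> 0) \<and> \<beta> p > 0 \<and> compact L \<and>
      (\<forall>q. q \<notin> L \<longrightarrow> \<beta> q = 0) \<and> c \<in> A \<and> L \<subseteq> fst c)"
  have "\<forall>p. \<exists>b. B p b"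
  proof
    fix p
    show "\<exists>b. B p b"
    proof (rule bump_function[of p])
      fix \<beta> :: "'a \<Rightarrow> real" and L c
      assume "C1_map \<beta>" "\<And>q. \<beta> q \<ge> 0" "\<beta> p > 0" "compact L"
        "\<And>q. q \<notin> L \<Longrightarrow> \<beta> q = 0" "c \<in> A" "L \<subseteq> fst c"
      then have "B p (\<beta>, L, c)" by (simp add: B_def)
      then show "\<exists>b. B p b" ..
    qed
  qed
  from choice[OF this] obtain b where b: "\<forall>p. B p (b p)" ..
  define \<beta> where "\<beta> p = fst (b p)" for p
  define L where "L p = fst (snd (b p))" for p
  define C where "C p = snd (snd (b p))" for p
  have \<beta>: "C1_map (\<beta> p)" "\<beta> p q \<ge> 0" "\<beta> p p > 0" "compact (L p)" "q \<notin> L p \<Longrightarrow> \<beta> p q = 0"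
     "C p \<in> A" "L p \<subseteq> fst (C p)" for p q
    using b[rule_format, of p] by (auto simp: B_def \<beta>_def L_def C_def case_prod_unfold)
  have op: "open {q. \<beta> p q > 0}" for p
    using C1_map_imp_continuous_on[OF \<beta>(1)] by (intro open_Collect_less) auto
  have "K \<subseteq> (\<Union>p\<in>UNIV. {q. \<beta> p q > 0})" using \<beta>(3) by blast
  then obtain T where T: "finite T" "K \<subseteq> (\<Union>p\<in>T. {q. \<beta> p q > 0})"
    by (rule compactE_image[OF K op])
  define S where "S q = (\<Sum>p\<in>T. \<beta> p q)" for q
  have S: "C1_map S" unfolding S_def by (intro C1_map_sum \<beta>)
  have Spos: "S q > 0" if q: "q \<in> K" for q
  proof -
    obtain p where "p \<in> T" "\<beta> p q > 0" using T(2) q by auto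
    then show ?thesis unfolding S_def using T(1) \<beta>(2) by (intro sum_pos2)
  qed
  \<comment> \<open>\<open>S\<close> is positive only near \<open>K\<close>; elsewhere the quotient
    may be a division by zero. This is harmless because \<open>Z\<close> vanishes off
    \<open>K\<close>, so \<open>Y p\<close> is locally zero there.\<close>
  define Y where "Y p q = (\<beta> p q / S q) *\<^sub>R Z q" for p q
  have Y: "C1_map (Y p)" for p
  proof (rule C1_map_local)
    fix q
    show "\<exists>d W. d \<in> A \<and> q \<in> fst d \<and> open W \<and> snd d q \<in> W \<and> C1_on W (Y p \<circ> chart_inv d)"
    proof (cases "q \<in> K")
      case True
      let ?d = "chart_at A q"
      note d = chart_at_in[of q]
      let ?U = "snd ?d ` fst ?d"
      let ?W = "?U \<inter> (S \<circ> chart_inv ?d) -` {0<..}"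
      have W: "open ?W"
        by (rule continuous_open_preimage[OF C1_on_imp_continuous_on[OF C1_map_D[OF S d(1)]] chart_open(2)[OF d(1)]]) simp
      have "C1_on ?W (\<lambda>u. ((\<beta> p \<circ> chart_inv ?d) u / (S \<circ> chart_inv ?d) u) *\<^sub>R (Z \<circ> chart_inv ?d) u)"
        by (intro C1_on_scaleR C1_on_divide C1_on_subset[OF C1_map_D[OF \<beta>(1) d(1)]]
            C1_on_subset[OF C1_map_D[OF S d(1)]] C1_on_subset[OF C1_map_D[OF Z(1) d(1)]]) auto
      then have "C1_on ?W (Y p \<circ> chart_inv ?d)"
        by (simp add: Y_def comp_def)
      moreover have "snd ?d q \<in> ?W" using Spos[OF True] d by (simp add: chart_inv_left)
      ultimately show ?thesis using W d by (intro exI[of _ ?d] exI[of _ ?W]) auto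
    next
      case False
      then show ?thesis
        by (intro C1_near_vanishing[OF compact_imp_closed[OF K]]) (simp_all add: Y_def off)
    qed
  qed
  have Zeq: "Z = (\<lambda>q. \<Sum>p\<in>T. Y p q)"
  proof
    fix q
    show "Z q = (\<Sum>p\<in>T. Y p q)"
    proof (cases "q \<in> K")
      case True
      have "(\<Sum>p\<in>T. Y p q) = ((\<Sum>p\<in>T. \<beta> p q) / S q) *\<^sub>R Z q"
        by (simp add: Y_def scaleR_left.sum sum_divide_distrib)
      then show ?thesis using Spos[OF True] by (simp add: S_def)
    qed (simp add: Y_def off)
  qed
  have Yt: "Y p q \<in> tangent_space A y q" for p q
    unfolding Y_def by (rule tangent_space_scaleR[OF y Z(2)])
  have "has_bochner_integral (volume_measure A y) (tdivg y (Y p)) 0" for p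
  proof (rule divergence_theorem_chart[OF y \<beta>(6)])
    show "compact (L p)" "L p \<subseteq> fst (C p)" by (rule \<beta>)+
    show "Y p q = 0" if "q \<notin> L p" for q using \<beta>(5)[OF that] by (simp add: Y_def)
  qed (rule Y Yt)+
  then have "has_bochner_integral (volume_measure A y) (\<lambda>q. \<Sum>p\<in>T. tdivg y (Y p) q) (\<Sum>p\<in>T. 0)"
    by (intro has_bochner_integral_sum)
  also have "(\<lambda>q. \<Sum>p\<in>T. tdivg y (Y p) q) = tdivg y Z"
    unfolding Zeq by (intro ext tdivg_sum[symmetric] Y)
  finally show ?thesis by simp
qed

end

section \<open>The first variation integrand as a divergence\<close>

context smooth_manifold
begin

lemma tdivg_add:
  assumes "C1_map Z" "C1_map Z'"
  shows "tdivg y (\<lambda>q. Z q + Z' q) p = tdivg y Z p + tdivg y Z' p"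
proof -
  \<comment> \<open>Two summands are indexed by the booleans, which makes the finite sum rule
    applicable.\<close>
  have "tdivg y (\<lambda>q. \<Sum>b\<in>UNIV. (if b then Z else Z') q) p = (\<Sum>b\<in>UNIV. tdivg y (if b then Z else Z') p)"
    using assms by (intro tdivg_sum) auto
  then show ?thesis by (simp add: UNIV_bool add.commute)
qed

lemma tangent_part_chart:
  assumes y: "immersion A y" and c: "c \<in> A" and u: "u \<in> snd c ` fst c"
  shows "Z (chart_inv c u) - normal_part A y (chart_inv c u) (Z (chart_inv c u)) =
    (\<Sum>i\<in>UNIV. tangent_coord c y Z i u *\<^sub>R partial (y \<circ> chart_inv c) i u)"
  using normal_part_chart[OF y c chart_inv_in[OF c u], of "Z (chart_inv c u)"]
  unfolding chart_inv_right[OF c u] tangent_coord_eq mult_vec_eq_sum_partial by simp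

lemma C1_map_tangent_part:
  assumes y: "immersion A y" and Z: "C1_map Z"
  shows "C1_map (\<lambda>q. Z q - normal_part A y q (Z q))"
  unfolding C1_map_def
proof
  fix c assume c: "c \<in> A"
  have "C1_on (snd c ` fst c) (\<lambda>u. \<Sum>i\<in>UNIV. tangent_coord c y Z i u *\<^sub>R partial (y \<circ> chart_inv c) i u)"
    by (intro C1_on_sum C1_on_scaleR C1_on_tangent_coord immersion_C1_on_partial y c Z)
  then show "C1_on (snd c ` fst c) ((\<lambda>q. Z q - normal_part A y q (Z q)) \<circ> chart_inv c)"
    by (rule C1_on_cong[OF chart_open(2)[OF c]]) (simp add: tangent_part_chart[OF y c])
qed

lemma C1_map_normal_part:
  assumes y: "immersion A y" and Z: "C1_map Z"
  shows "C1_map (\<lambda>q. normal_part A y q (Z q))"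
  using C1_map_diff[OF Z C1_map_tangent_part[OF y Z]] by simp

text \<open>Both sides equal the inner product of the two normal parts, since a normal part is
  orthogonal to a tangent part.\<close>

lemma normal_part_self_adjoint:
  assumes y: "immersion A y"
  shows "normal_part A y p a \<bullet> b = a \<bullet> normal_part A y p b"
proof -
  have "normal_part A y p a \<bullet> (b - normal_part A y p b) = 0"
    by (rule normal_part_orthogonal[OF y tangent_part_in[OF y]])
  moreover have "normal_part A y p b \<bullet> (a - normal_part A y p a) = 0"
    by (rule normal_part_orthogonal[OF y tangent_part_in[OF y]])
  ultimately show ?thesis by (simp add: inner_diff_right inner_commute)
qed

lemma tdivg_normal:
  fixes y :: "'a \<Rightarrow> real^'n"
  assumes y: "immersion A y" and Z: "C1_map Z"
  shows "tdivg y (\<lambda>q. normal_part A y q (Z q)) p = - (mean_curvature A y p \<bullet> Z p)"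
proof -
  let ?c = "chart_at A p"
  note c = chart_at_in[of p]
  let ?u = "snd ?c p"
  let ?U = "snd ?c ` fst ?c"
  let ?y = "y \<circ> chart_inv ?c"
  let ?N = "\<lambda>q. normal_part A y q (Z q)"
  let ?n = "?N \<circ> chart_inv ?c"
  let ?g = "\<lambda>i j. matrix_inv (metric_matrix ?c y ?u) $ i $ j"
  have u: "?u \<in> ?U" using c by simp
  have N: "C1_map ?N" by (rule C1_map_normal_part[OF y Z])
  have dn: "?n differentiable (at ?u)" by (rule C1_map_differentiable[OF N c])
  have dy: "partial ?y j differentiable (at ?u)" for j
    by (rule C1_on_differentiable[OF immersion_C1_on_partial[OF y c(1)] u])
  \<comment> \<open>Needed on the whole coordinate domain and not only at \<open>p\<close>, because
    the relation is differentiated below.\<close>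
  have orth: "?n w \<bullet> partial ?y j w = 0" if w: "w \<in> ?U" for w j
  proof -
    have "partial ?y j w \<in> tangent_space A y (chart_inv ?c w)"
      unfolding tangent_space_chart[OF y c(1) chart_inv_in[OF c(1) w]] chart_inv_right[OF c(1) w]
      using mult_vec_eq_sum_partial[of ?y w "axis j 1"]
      by (intro image_eqI[of _ _ "axis j 1"]) (simp_all add: axis_def if_distrib[of "\<lambda>r. r *\<^sub>R _"] cong: if_cong)
    then show ?thesis using normal_part_orthogonal[OF y] by simp
  qed
  have "partial ?y j ?u \<bullet> partial ?n i ?u = - (Z p \<bullet> second_fundamental_form A y p i j)" for i j
  proof -
    have "((\<lambda>w. 0) has_derivative (\<lambda>v. 0::real)) (at ?u)" by simp
    from has_derivative_transform_within_open[OF this chart_open(2)[OF c(1)] u]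
    have "((\<lambda>w. ?n w \<bullet> partial ?y j w) has_derivative (\<lambda>v. 0)) (at ?u)" using orth by simp
    from partial_eqI[OF this] have "partial (\<lambda>w. ?n w \<bullet> partial ?y j w) i ?u = 0" .
    then have "?n ?u \<bullet> partial (partial ?y j) i ?u + partial ?n i ?u \<bullet> partial ?y j ?u = 0"
      unfolding partial_bilinear[OF bounded_bilinear_inner dn dy] .
    \<comment> \<open>Self-adjointness moves the projection from \<open>Z\<close> onto the second
      derivative of \<open>y\<close>, which is then the second fundamental form by the Gauss
      formula.\<close>
    moreover have "?n ?u \<bullet> partial (partial ?y j) i ?u = Z p \<bullet> second_fundamental_form A y p i j"
      using normal_part_self_adjoint[OF y] c by (simp add: second_fundamental_form_def Let_def chart_inv_left)
    ultimately show ?thesis by (simp add: inner_commute)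
  qed
  then show ?thesis
    unfolding tdiv_eq_sum mean_curvature_def Let_def
    by (simp add: inner_sum_right inner_commute[of _ "Z p"] sum_negf)
qed

lemma chart_deriv_eq:
  assumes "C1_map f"
  shows "(f \<circ> chart_inv (chart_at A p) has_derivative chart_deriv A f p) (at (snd (chart_at A p) p))"
  using C1_map_differentiable[OF assms chart_at_in] by (simp add: chart_deriv_def frechet_derivative_works)

lemma chart_deriv_eqI:
  "(f \<circ> chart_inv (chart_at A p) has_derivative D) (at (snd (chart_at A p) p)) \<Longrightarrow> chart_deriv A f p = D"
  by (simp add: chart_deriv_def frechet_derivative_at[symmetric])

text \<open>The witness is g^(ij) (d_j k) (d_i y). It is unique because the difference of two
  candidates is tangent and orthogonal to every tangent vector, including itself.\<close>

lemma induced_gradient_works: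
  assumes y: "immersion A y" and k: "C1_map k"
  shows "induced_gradient A y k p \<in> tangent_space A y p"
    and "induced_gradient A y k p \<bullet> chart_deriv A y p v = chart_deriv A k p v"
proof -
  let ?c = "chart_at A p"
  note c = chart_at_in[of p]
  let ?u = "snd ?c p"
  let ?Y = "jac (y \<circ> chart_inv ?c) ?u"
  let ?G = "metric_matrix ?c y ?u"
  let ?b = "(\<chi> j. chart_deriv A k p (axis j 1)) :: real^'m"
  let ?w = "?Y *v (matrix_inv ?G *v ?b)"
  have Dy: "chart_deriv A y p v = ?Y *v v" for v
    using jac_mult_vec[OF C1_map_differentiable[OF immersion_C1_map[OF y] c]] by (simp add: chart_deriv_def)
  have T: "tangent_space A y p = range ((*v) ?Y)" by (rule tangent_space_chart[OF y c])
  have det: "det ?G \<noteq> 0" using immersion_det_pos[OF y c(1), of ?u] c(2) by auto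
  have lin: "linear (chart_deriv A k p)"
    using has_derivative_linear[OF chart_deriv_eq[OF k]] .
  have Dk: "?b \<bullet> v = chart_deriv A k p v" for v
  proof -
    have "chart_deriv A k p v = chart_deriv A k p (\<Sum>j\<in>UNIV. v $ j *\<^sub>R axis j 1)"
      by (simp add: basis_expansion flip: scalar_mult_eq_scaleR)
    also have "\<dots> = (\<Sum>j\<in>UNIV. v $ j * chart_deriv A k p (axis j 1))"
      by (simp add: linear_sum[OF lin] linear_cmul[OF lin])
    finally show ?thesis by (simp add: inner_vec_def mult.commute)
  qed
  have w: "?w \<bullet> (?Y *v v) = chart_deriv A k p v" for v
  proof -
    have "?w \<bullet> (?Y *v v) = (transpose ?Y *v ?w) \<bullet> v"
      by (simp only: transpose_matrix_vector dot_lmul_matrix)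
    also have "transpose ?Y *v ?w = (?G ** matrix_inv ?G) *v ?b"
      by (simp only: metric_matrix_eq matrix_vector_mul_assoc matrix_mul_assoc)
    also have "((?G ** matrix_inv ?G) *v ?b) \<bullet> v = chart_deriv A k p v"
      by (simp only: matrix_inv_works[OF det] matrix_vector_mul_lid Dk)
    finally show ?thesis .
  qed
  have "\<exists>!w. w \<in> tangent_space A y p \<and> (\<forall>v. w \<bullet> chart_deriv A y p v = chart_deriv A k p v)"
  proof (rule ex1I[of _ ?w])
    show "?w \<in> tangent_space A y p \<and> (\<forall>v. ?w \<bullet> chart_deriv A y p v = chart_deriv A k p v)"
      using w by (simp add: T Dy)
    fix w' assume w': "w' \<in> tangent_space A y p \<and> (\<forall>v. w' \<bullet> chart_deriv A y p v = chart_deriv A k p v)"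
    then obtain a where a: "w' = ?Y *v a" by (auto simp: T)
    have d: "w' - ?w = ?Y *v (a - matrix_inv ?G *v ?b)" by (simp add: a matrix_vector_mult_diff_distrib)
    have "(w' - ?w) \<bullet> (?Y *v v) = 0" for v
      using w' w[of v] by (simp add: Dy inner_diff_left)
    then have "(w' - ?w) \<bullet> (w' - ?w) = 0" unfolding d by blast
    then show "w' = ?w" by simp
  qed
  from theI'[OF this, folded induced_gradient_def]
  show "induced_gradient A y k p \<in> tangent_space A y p"
    "induced_gradient A y k p \<bullet> chart_deriv A y p v = chart_deriv A k p v" by auto
qed

text \<open>Product rule for the divergence. The vector \<open>a\<close> represents
  \<open>Z p\<close> in coordinates: the differential of \<open>f\<close> acts on coordinate
  vectors, whereas \<open>Z\<close> takes values in the ambient space.\<close>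

lemma tdivg_scaled_tangent:
  fixes y Z :: "'a \<Rightarrow> real^'n"
  assumes y: "immersion A y" and Z: "C1_map Z" "\<And>q. Z q \<in> tangent_space A y q" and f: "C1_map f"
  obtains a where "Z p = chart_deriv A y p a"
    "tdivg y (\<lambda>q. exp (- f q) *\<^sub>R Z q) p = exp (- f p) * (tdivg y Z p - chart_deriv A f p a)"
proof -
  let ?c = "chart_at A p"
  note c = chart_at_in[of p]
  let ?u = "snd ?c p"
  let ?y = "y \<circ> chart_inv ?c"
  let ?z = "Z \<circ> chart_inv ?c"
  let ?f = "f \<circ> chart_inv ?c"
  let ?e = "\<lambda>w. exp (- ?f w)"
  have u: "?u \<in> snd ?c ` fst ?c" using c by simp
  define a where "a = (\<chi> i. tangent_coord ?c y Z i ?u)"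
  have df: "(?f has_derivative chart_deriv A f p) (at ?u)" by (rule chart_deriv_eq[OF f])
  then have de: "(?e has_derivative (\<lambda>v. - (exp (- ?f ?u) * chart_deriv A f p v))) (at ?u)"
    unfolding comp_def by (auto intro!: derivative_eq_intros)
  have dz: "?z differentiable (at ?u)" by (rule C1_map_differentiable[OF Z(1) c])
  have pe: "partial (\<lambda>w. ?e w *\<^sub>R ?z w) i ?u =
      exp (- f p) *\<^sub>R (partial ?z i ?u - chart_deriv A f p (axis i 1) *\<^sub>R Z p)" for i
    using partial_bilinear[OF bounded_bilinear_scaleR _ dz, of ?e i] de partial_eqI[OF de, of i]
    by (auto simp: differentiable_def chart_inv_left[OF c] scaleR_diff_right)
  have lin: "linear (chart_deriv A f p)" using has_derivative_linear[OF df] .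
  have "chart_deriv A f p a = chart_deriv A f p (\<Sum>i\<in>UNIV. a $ i *\<^sub>R axis i 1)"
    by (simp add: basis_expansion flip: scalar_mult_eq_scaleR)
  then have Da: "chart_deriv A f p a = (\<Sum>i\<in>UNIV. a $ i * chart_deriv A f p (axis i 1))"
    by (simp add: linear_sum[OF lin] linear_cmul[OF lin])
  show ?thesis
  proof (rule that[of a])
    have "Z p = (\<Sum>i\<in>UNIV. a $ i *\<^sub>R partial ?y i ?u)"
      using tangent_coord_works[OF y c(1) u, of Z, OF Z(2)] by (simp add: a_def chart_inv_left[OF c])
    also have "\<dots> = jac ?y ?u *v a" by (simp add: mult_vec_eq_sum_partial)
    also have "\<dots> = chart_deriv A y p a"
      using jac_mult_vec[OF C1_map_differentiable[OF immersion_C1_map[OF y] c]] by (simp add: chart_deriv_def)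
    finally show "Z p = chart_deriv A y p a" .
    let ?g = "\<lambda>i j. matrix_inv (metric_matrix ?c y ?u) $ i $ j"
    have "tdivg y (\<lambda>q. exp (- f q) *\<^sub>R Z q) p = (\<Sum>i\<in>UNIV. \<Sum>j\<in>UNIV. ?g i j *
        (partial ?y j ?u \<bullet> (exp (- f p) *\<^sub>R (partial ?z i ?u - chart_deriv A f p (axis i 1) *\<^sub>R Z p))))"
      unfolding tdiv_eq_sum using pe by (simp add: comp_def)
    also have "\<dots> = exp (- f p) * ((\<Sum>i\<in>UNIV. \<Sum>j\<in>UNIV. ?g i j * (partial ?y j ?u \<bullet> partial ?z i ?u)) -
        (\<Sum>i\<in>UNIV. (\<Sum>j\<in>UNIV. ?g i j * (Z p \<bullet> partial ?y j ?u)) * chart_deriv A f p (axis i 1)))"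
      by (simp add: sum_distrib_left sum_distrib_right sum_subtractf[symmetric] inner_diff_right inner_commute
          algebra_simps)
    also have "\<dots> = exp (- f p) * (tdivg y Z p - chart_deriv A f p a)"
      unfolding tdiv_eq_sum Da by (simp add: a_def tangent_coord_def chart_inv_left[OF c])
    finally show "tdivg y (\<lambda>q. exp (- f q) *\<^sub>R Z q) p = exp (- f p) * (tdivg y Z p - chart_deriv A f p a)" .
  qed
qed

text \<open>Both weighted volumes have a potential of the shape \<open>\<bar>y\<bar>\<^sup>2 / 2 - k\<close>, where \<open>k\<close> is the function
  whose gradient enters the first variation.\<close>

lemma first_variation_integrand:
  fixes y \<xi> \<eta> :: "'a \<Rightarrow> real^'n" and k :: "'a \<Rightarrow> real"
  assumes y: "immersion A y" and \<eta>: "C1_map \<eta>" and k: "C1_map k"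
    and f: "\<And>q. f q = y q \<bullet> y q / 2 - k q"
  shows "exp (- f p) * (tdivg y \<eta> p - (y p - \<xi> p) \<bullet> \<eta> p) =
    tdivg y (\<lambda>q. exp (- f q) *\<^sub>R (\<eta> q - normal_part A y q (\<eta> q))) p
    - ((mean_curvature A y p + normal_part A y p (y p) - \<xi> p) + induced_gradient A y k p) \<bullet> \<eta> p * exp (- f p)"
proof -
  let ?T = "\<lambda>q. \<eta> q - normal_part A y q (\<eta> q)"
  let ?N = "\<lambda>q. normal_part A y q (\<eta> q)"
  note Y = immersion_C1_map[OF y]
  have fC: "C1_map f"
  proof -
    have "f = (\<lambda>q. y q \<bullet> y q * (1/2) - k q)" using f by (simp add: fun_eq_iff)
    then show ?thesis
      using C1_map_diff[OF C1_map_mult[OF C1_map_inner[OF Y Y] C1_map_const[of "1/2"]] k] by (simp only:)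
  qed
  have T: "C1_map ?T" "?T q \<in> tangent_space A y q" for q
    using C1_map_tangent_part[OF y \<eta>] tangent_part_in[OF y] by auto
  obtain a where a: "?T p = chart_deriv A y p a"
    "tdivg y (\<lambda>q. exp (- f q) *\<^sub>R ?T q) p = exp (- f p) * (tdivg y ?T p - chart_deriv A f p a)"
    using tdivg_scaled_tangent[OF y T fC, of p] by blast
  have "(f \<circ> chart_inv (chart_at A p) has_derivative (\<lambda>v. y p \<bullet> chart_deriv A y p v - chart_deriv A k p v))
      (at (snd (chart_at A p) p))"
  proof -
    let ?y = "y \<circ> chart_inv (chart_at A p)"
    let ?u = "snd (chart_at A p) p"
    have "f \<circ> chart_inv (chart_at A p) = (\<lambda>u. (1/2) *\<^sub>R (?y u \<bullet> ?y u) - (k \<circ> chart_inv (chart_at A p)) u)"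
      using f by (simp add: fun_eq_iff)
    moreover have "((\<lambda>u. (1/2) *\<^sub>R (?y u \<bullet> ?y u) - (k \<circ> chart_inv (chart_at A p)) u) has_derivative
        (\<lambda>v. (1/2) *\<^sub>R (?y ?u \<bullet> chart_deriv A y p v + chart_deriv A y p v \<bullet> ?y ?u) - chart_deriv A k p v)) (at ?u)"
      by (intro has_derivative_diff has_derivative_scaleR_right has_derivative_inner
          chart_deriv_eq[OF Y] chart_deriv_eq[OF k])
    moreover have "?y ?u = y p" by (simp add: chart_inv_left[OF chart_at_in])
    ultimately show ?thesis by (simp add: inner_commute)
  qed
  \<comment> \<open>The differential of the potential along the tangent part: |y|^2/2 contributes
    the position vector, and \<open>k\<close> contributes its gradient.\<close>
  then have Df: "chart_deriv A f p a = y p \<bullet> ?T p - induced_gradient A y k p \<bullet> ?T p"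
    using chart_deriv_eqI induced_gradient_works(2)[OF y k] a(1) by metis
  \<comment> \<open>The gradient is tangent, so it pairs with the full velocity exactly as with the
    tangent part.\<close>
  have "induced_gradient A y k p \<bullet> ?N p = 0"
    using normal_part_orthogonal[OF y induced_gradient_works(1)[OF y k]] by (simp add: inner_commute)
  then have gN: "induced_gradient A y k p \<bullet> ?T p = induced_gradient A y k p \<bullet> \<eta> p"
    by (simp add: inner_diff_right)
  \<comment> \<open>This identity trades the tangent part of the position vector for its normal part
    in the final integrand.\<close>
  have yT: "y p \<bullet> ?T p = y p \<bullet> \<eta> p - normal_part A y p (y p) \<bullet> \<eta> p"
    using normal_part_self_adjoint[OF y] by (simp add: inner_diff_right)
  have "tdivg y (\<lambda>q. ?T q + ?N q) p = tdivg y ?T p + tdivg y ?N p"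
    by (rule tdivg_add[OF T(1) C1_map_normal_part[OF y \<eta>]])
  then have td: "tdivg y \<eta> p = tdivg y ?T p - mean_curvature A y p \<bullet> \<eta> p"
    using tdivg_normal[OF y \<eta>] by simp
  show ?thesis
    unfolding a(2) Df gN yT td by (simp add: inner_add_left inner_diff_left algebra_simps)
qed

end

section \<open>Slices of maps of two variables\<close>

lemma has_derivative_slice_fst:
  assumes "G differentiable (at (u, t))"
  shows "((\<lambda>u. G (u, t)) has_derivative (\<lambda>v. frechet_derivative G (at (u, t)) (v, 0))) (at u)"
proof -
  have "((\<lambda>u. (u, t)) has_derivative (\<lambda>v. (v, 0))) (at u)"
    by (auto intro!: derivative_eq_intros)
  from has_derivative_compose[OF this, of G "frechet_derivative G (at (u, t))"] assms
  show ?thesis by (simp add: frechet_derivative_works)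
qed

lemma has_vector_derivative_slice_snd:
  fixes G :: "'b::real_normed_vector \<times> real \<Rightarrow> 'c::real_normed_vector"
  assumes "G differentiable (at (u, t))"
  shows "((\<lambda>s. G (u, s)) has_vector_derivative frechet_derivative G (at (u, t)) (0, 1)) (at t)"
proof -
  have "((\<lambda>s. (u, s)) has_derivative (\<lambda>r. (0, r))) (at t)"
    by (auto intro!: derivative_eq_intros)
  from has_derivative_compose[OF this, of G "frechet_derivative G (at (u, t))"] assms
  have deriv: "((\<lambda>s. G (u, s)) has_derivative (\<lambda>r. frechet_derivative G (at (u, t)) (0, r))) (at t)"
    by (simp add: frechet_derivative_works)
  have eq: "frechet_derivative G (at (u, t)) (0, r) = r *\<^sub>R frechet_derivative G (at (u, t)) (0, 1)" for r
    using linear_cmul[OF linear_frechet_derivative[OF assms], of r "(0, 1)"] by simp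
  show ?thesis unfolding has_vector_derivative_def eq[symmetric] by (rule deriv)
qed

lemma C1_on_slice_fst:
  fixes G :: "'b::euclidean_space \<times> real \<Rightarrow> 'c::real_normed_vector"
  assumes "C1_on (S \<times> T) G" "t \<in> T"
  shows "C1_on S (\<lambda>u. G (u, t))"
proof (rule C1_on_compose[OF _ assms(1)])
  show "C1_on S (\<lambda>u. (u, t))"
    by (rule C1_onI[where f' = "\<lambda>u v. (v, 0)"]) (auto intro!: derivative_eq_intros)
qed (use assms in auto)

lemma continuous_on_det:
  fixes G :: "'b::topological_space \<Rightarrow> real^'m^'m"
  assumes "\<And>i j. continuous_on S (\<lambda>u. G u $ i $ j)"
  shows "continuous_on S (\<lambda>u. det (G u))"
  unfolding det_def by (intro continuous_on_sum continuous_on_mult continuous_on_const continuous_on_prod assms)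

lemma continuous_on_matrix_inv:
  fixes G :: "'b::topological_space \<Rightarrow> real^'m^'m"
  assumes G: "\<And>i j. continuous_on S (\<lambda>u. G u $ i $ j)" and nz: "\<And>u. u \<in> S \<Longrightarrow> det (G u) \<noteq> 0"
  shows "continuous_on S (\<lambda>u. matrix_inv (G u) $ i $ j)"
proof (rule continuous_on_eq)
  have "continuous_on S (\<lambda>u. (\<chi> k l. if l = i then (if k = j then 1 else 0) else G u $ k $ l) $ a $ b)" for a b
    using G by (cases "b = i") (auto intro: continuous_on_const)
  then show "continuous_on S (\<lambda>u. det (\<chi> k l. if l = i then (if k = j then 1 else 0) else G u $ k $ l) / det (G u))"
    using nz G by (intro continuous_on_divide continuous_on_det) auto
qed (use nz in \<open>simp add: matrix_inv_component\<close>)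

context smooth_manifold
begin

text \<open>Joint continuity in point and time is required because the derivative of the weight must
  be bounded uniformly on a compact set times a compact time interval.\<close>

lemma continuous_on_times_by_charts:
  assumes "open I" and c: "\<And>c. c \<in> A \<Longrightarrow> continuous_on ((snd c ` fst c) \<times> I) (\<lambda>z. g (chart_inv c (fst z)) (snd z))"
  shows "continuous_on (UNIV \<times> I) (\<lambda>z. g (fst z) (snd z))"
proof -
  have "continuous_on (fst (chart_at A p) \<times> I) (\<lambda>z. g (fst z) (snd z))" for p
  proof -
    let ?c = "chart_at A p"
    note c' = chart_at_in[of p]
    have "continuous_on (fst ?c \<times> I) (\<lambda>z. (snd ?c (fst z), snd z))"
      by (intro continuous_on_Pair continuous_on_compose2[OF continuous_on_chart[OF c'(1)]] continuous_intros) auto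
    moreover have "(\<lambda>z. (snd ?c (fst z), snd z)) ` (fst ?c \<times> I) \<subseteq> (snd ?c ` fst ?c) \<times> I" by auto
    ultimately have "continuous_on (fst ?c \<times> I) (\<lambda>z. g (chart_inv ?c (snd ?c (fst z))) (snd z))"
      using continuous_on_compose2[OF c[OF c'(1)], of "fst ?c \<times> I" "\<lambda>z. (snd ?c (fst z), snd z)"] by simp
    then show ?thesis
      by (rule continuous_on_eq) (auto simp: chart_inv_left[OF c'(1)])
  qed
  then have "continuous_on (\<Union>p. fst (chart_at A p) \<times> I) (\<lambda>z. g (fst z) (snd z))"
    by (intro continuous_on_open_UN open_Times chart_open chart_at_in assms(1))
  moreover have "(\<Union>p. fst (chart_at A p) \<times> I) = UNIV \<times> I" using chart_at_in(2) by auto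
  ultimately show ?thesis by simp
qed

end

section \<open>Variations\<close>

locale smooth_variation = smooth_manifold A
  for A :: "('a::{t2_space, second_countable_topology}, 'm::finite) chart set" +
  fixes x :: "'a \<Rightarrow> real^'n" and \<epsilon> :: real and F :: "'a \<Rightarrow> real \<Rightarrow> real^'n"
  assumes var: "variation A x \<epsilon> F"
begin

abbreviation I :: "real set" where "I \<equiv> {-\<epsilon><..<\<epsilon>}"

text \<open>The variation in a chart as a function of one variable in the product space, so that
  symmetry of second derivatives covers mixed derivatives in space and time.\<close>

definition \<Phi> :: "('a, 'm) chart \<Rightarrow> (real^'m) \<times> real \<Rightarrow> real^'n" where
  "\<Phi> c z = F (chart_inv c (fst z)) (snd z)"

lemma immersion_slice: "t \<in> I \<Longrightarrow> immersion A (\<lambda>q. F q t)"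
  using var by (simp add: variation_def)

lemma Phi_smooth: "c \<in> A \<Longrightarrow> smooth_on ((snd c ` fst c) \<times> I) (\<Phi> c)"
  using var by (simp add: variation_def \<Phi>_def[abs_def] case_prod_unfold)

lemma C1_on_Phi: "c \<in> A \<Longrightarrow> C1_on ((snd c ` fst c) \<times> I) (\<Phi> c)"
  by (rule smooth_on_imp_C1_on[OF Phi_smooth])

lemma C1_on_deriv_Phi: "c \<in> A \<Longrightarrow> C1_on ((snd c ` fst c) \<times> I) (\<lambda>z. frechet_derivative (\<Phi> c) (at z) v)"
  by (rule smooth_on_imp_C1_on_deriv[OF Phi_smooth])

lemma has_vector_derivative_F_chart:
  assumes c: "c \<in> A" and u: "u \<in> snd c ` fst c" and t: "t \<in> I"
  shows "((\<lambda>s. F (chart_inv c u) s) has_vector_derivative frechet_derivative (\<Phi> c) (at (u, t)) (0, 1)) (at t)"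
  using has_vector_derivative_slice_snd[OF C1_on_differentiable[OF C1_on_Phi[OF c], of "(u, t)"]] u t
  by (simp add: \<Phi>_def)

lemma velocity_chart:
  assumes "c \<in> A" and "u \<in> snd c ` fst c" and "t \<in> I"
  shows "velocity F t (chart_inv c u) = frechet_derivative (\<Phi> c) (at (u, t)) (0, 1)"
  unfolding velocity_def by (rule vector_derivative_at[OF has_vector_derivative_F_chart[OF assms]])

lemma has_vector_derivative_F:
  assumes t: "t \<in> I"
  shows "(F p has_vector_derivative velocity F t p) (at t)"
proof -
  note c = chart_at_in[of p]
  have u: "snd (chart_at A p) p \<in> snd (chart_at A p) ` fst (chart_at A p)" using c by simp
  show ?thesis
    using has_vector_derivative_F_chart[OF c(1) u t] velocity_chart[OF c(1) u t]
    by (simp add: chart_inv_left[OF c])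
qed

lemma C1_map_velocity:
  assumes t: "t \<in> I"
  shows "C1_map (velocity F t)"
  unfolding C1_map_def
proof
  fix c assume c: "c \<in> A"
  show "C1_on (snd c ` fst c) (velocity F t \<circ> chart_inv c)"
    by (rule C1_on_cong[OF chart_open(2)[OF c] C1_on_slice_fst[OF C1_on_deriv_Phi[OF c] t]])
      (simp add: velocity_chart[OF c _ t])
qed

lemma partial_slice:
  assumes c: "c \<in> A" and u: "u \<in> snd c ` fst c" and t: "t \<in> I"
  shows "partial ((\<lambda>q. F q t) \<circ> chart_inv c) i u = frechet_derivative (\<Phi> c) (at (u, t)) (axis i 1, 0)"
  using partial_eqI[OF has_derivative_slice_fst[OF C1_on_differentiable[OF C1_on_Phi[OF c], of "(u, t)"]]] u t
  by (simp add: \<Phi>_def comp_def)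

lemma partial_velocity:
  assumes c: "c \<in> A" and u: "u \<in> snd c ` fst c" and t: "t \<in> I"
  shows "partial (velocity F t \<circ> chart_inv c) i u =
    frechet_derivative (\<lambda>z. frechet_derivative (\<Phi> c) (at z) (0, 1)) (at (u, t)) (axis i 1, 0)"
proof -
  have "partial (velocity F t \<circ> chart_inv c) i u = partial (\<lambda>u. frechet_derivative (\<Phi> c) (at (u, t)) (0, 1)) i u"
    using velocity_chart[OF c _ t]
    by (intro partial_cong_open[OF chart_open(2)[OF c] u] C1_on_differentiable[OF C1_map_D[OF C1_map_velocity[OF t] c] u])
      simp
  also have "\<dots> = frechet_derivative (\<lambda>z. frechet_derivative (\<Phi> c) (at z) (0, 1)) (at (u, t)) (axis i 1, 0)"
    using partial_eqI[OF has_derivative_slice_fst[OF C1_on_differentiable[OF C1_on_deriv_Phi[OF c], of "(u, t)"]]] u t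
    by simp
  finally show ?thesis .
qed

text \<open>Time and space derivatives of the variation commute; consequently the Jacobian of the
  slice has the Jacobian of the velocity as its time derivative.\<close>

lemma has_vector_derivative_partial_slice:
  assumes c: "c \<in> A" and u: "u \<in> snd c ` fst c" and t: "t \<in> I"
  shows "((\<lambda>s. partial ((\<lambda>q. F q s) \<circ> chart_inv c) i u) has_vector_derivative
    partial (velocity F t \<circ> chart_inv c) i u) (at t)"
proof -
  have ut: "(u, t) \<in> (snd c ` fst c) \<times> I" using u t by auto
  have op: "open ((snd c ` fst c) \<times> I)" by (intro open_Times chart_open c) auto
  have "((\<lambda>s. frechet_derivative (\<Phi> c) (at (u, s)) (axis i 1, 0)) has_vector_derivative
     frechet_derivative (\<lambda>z. frechet_derivative (\<Phi> c) (at z) (axis i 1, 0)) (at (u, t)) (0, 1)) (at t)"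
    by (rule has_vector_derivative_slice_snd[OF C1_on_differentiable[OF C1_on_deriv_Phi[OF c] ut]])
  also have "frechet_derivative (\<lambda>z. frechet_derivative (\<Phi> c) (at z) (axis i 1, 0)) (at (u, t)) (0, 1) =
     partial (velocity F t \<circ> chart_inv c) i u"
    unfolding partial_velocity[OF c u t]
    by (rule frechet_derivative_commute[OF op ut C1_on_Phi[OF c] C1_on_deriv_Phi[OF c]])
  finally show ?thesis
    by (rule has_vector_derivative_transform_within_open[of _ _ _ I])
      (use t partial_slice[OF c u] in auto)
qed

text \<open>Jacobi's formula in time: the relative rate of change of the volume element is the
  divergence of the velocity.\<close>

lemma has_real_derivative_volume_density:
  assumes c: "c \<in> A" and p: "p \<in> fst c" and t: "t \<in> I"
  shows "((\<lambda>s. volume_density c (\<lambda>q. F q s) (snd c p)) has_real_derivative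
    volume_density c (\<lambda>q. F q t) (snd c p) * tdiv c (\<lambda>q. F q t) (velocity F t) p) (at t)"
proof -
  have u: "snd c p \<in> snd c ` fst c" using p by simp
  have "((\<lambda>s. sqrt (det (transpose (jac ((\<lambda>q. F q s) \<circ> chart_inv c) (snd c p)) **
        jac ((\<lambda>q. F q s) \<circ> chart_inv c) (snd c p)))) has_real_derivative
     sqrt (det (transpose (jac ((\<lambda>q. F q t) \<circ> chart_inv c) (snd c p)) **
        jac ((\<lambda>q. F q t) \<circ> chart_inv c) (snd c p))) *
     tangential_trace (jac ((\<lambda>q. F q t) \<circ> chart_inv c) (snd c p))
       (jac (velocity F t \<circ> chart_inv c) (snd c p))) (at t)"
  proof (rule has_real_derivative_sqrt_det_gram)
    show "((\<lambda>s. column i (jac ((\<lambda>q. F q s) \<circ> chart_inv c) (snd c p))) has_vector_derivative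
       column i (jac (velocity F t \<circ> chart_inv c) (snd c p))) (at t)" for i
      unfolding column_jac by (rule has_vector_derivative_partial_slice[OF c u t])
    show "det (transpose (jac ((\<lambda>q. F q t) \<circ> chart_inv c) (snd c p)) **
        jac ((\<lambda>q. F q t) \<circ> chart_inv c) (snd c p)) > 0"
      using immersion_det_pos[OF immersion_slice[OF t] c u] by (simp add: metric_matrix_eq)
  qed
  then show ?thesis by (simp add: volume_density_def metric_matrix_eq tdiv_def)
qed

section \<open>Joint continuity in point and time\<close>

lemma continuous_on_metric_matrix_joint:
  assumes c: "c \<in> A"
  shows "continuous_on ((snd c ` fst c) \<times> I) (\<lambda>z. metric_matrix c (\<lambda>q. F q (snd z)) (fst z) $ i $ j)"
proof (rule continuous_on_eq)
  show "continuous_on ((snd c ` fst c) \<times> I) (\<lambda>z. frechet_derivative (\<Phi> c) (at z) (axis i 1, 0) \<bullet>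
      frechet_derivative (\<Phi> c) (at z) (axis j 1, 0))"
    by (intro continuous_on_inner C1_on_continuous_deriv C1_on_Phi c)
qed (auto simp: metric_matrix_def partial_slice[OF c])

lemma continuous_on_volume_density_joint:
  assumes c: "c \<in> A"
  shows "continuous_on ((snd c ` fst c) \<times> I) (\<lambda>z. volume_density c (\<lambda>q. F q (snd z)) (fst z))"
  unfolding volume_density_def
  by (intro continuous_on_real_sqrt continuous_on_det continuous_on_metric_matrix_joint c)

lemma continuous_on_tdiv_joint:
  assumes c: "c \<in> A"
  shows "continuous_on ((snd c ` fst c) \<times> I)
    (\<lambda>z. tdivg (\<lambda>q. F q (snd z)) (velocity F (snd z)) (chart_inv c (fst z)))"
proof (rule continuous_on_eq)
  let ?D = "\<lambda>z. frechet_derivative (\<Phi> c) (at z)"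
  show "continuous_on ((snd c ` fst c) \<times> I) (\<lambda>z. \<Sum>i\<in>UNIV. \<Sum>j\<in>UNIV.
      matrix_inv (metric_matrix c (\<lambda>q. F q (snd z)) (fst z)) $ i $ j *
      (?D z (axis j 1, 0) \<bullet> frechet_derivative (\<lambda>z. ?D z (0, 1)) (at z) (axis i 1, 0)))"
  proof (intro continuous_on_sum continuous_on_mult continuous_on_inner continuous_on_matrix_inv
      continuous_on_metric_matrix_joint c)
    show "det (metric_matrix c (\<lambda>q. F q (snd z)) (fst z)) \<noteq> 0" if "z \<in> (snd c ` fst c) \<times> I" for z
    proof -
      have "snd z \<in> I" "fst z \<in> snd c ` fst c" using that by auto
      from immersion_det_pos[OF immersion_slice[OF this(1)] c this(2)] show ?thesis by simp
    qed
    show "continuous_on ((snd c ` fst c) \<times> I) (\<lambda>z. ?D z (axis j 1, 0))" for j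
      by (rule C1_on_continuous_deriv[OF C1_on_Phi[OF c]])
    show "continuous_on ((snd c ` fst c) \<times> I) (\<lambda>z. frechet_derivative (\<lambda>z. ?D z (0, 1)) (at z) (axis i 1, 0))" for i
      by (rule C1_on_continuous_deriv[OF C1_on_deriv_Phi[OF c]])
  qed
  fix z assume "z \<in> (snd c ` fst c) \<times> I"
  then have z: "fst z \<in> snd c ` fst c" "snd z \<in> I" by auto
  have "tdivg (\<lambda>q. F q (snd z)) (velocity F (snd z)) (chart_inv c (fst z)) =
      tdiv c (\<lambda>q. F q (snd z)) (velocity F (snd z)) (chart_inv c (fst z))"
    by (rule tdivg_chart[OF immersion_slice[OF z(2)] c chart_inv_in[OF c z(1)] C1_map_velocity[OF z(2)]])
  then show "(\<Sum>i\<in>UNIV. \<Sum>j\<in>UNIV. matrix_inv (metric_matrix c (\<lambda>q. F q (snd z)) (fst z)) $ i $ j *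
      (?D z (axis j 1, 0) \<bullet> frechet_derivative (\<lambda>z. ?D z (0, 1)) (at z) (axis i 1, 0))) =
    tdivg (\<lambda>q. F q (snd z)) (velocity F (snd z)) (chart_inv c (fst z))"
    by (simp only: tdiv_eq_sum chart_inv_right[OF c z(1)] partial_slice[OF c z] partial_velocity[OF c z] prod.collapse)
qed

lemma continuous_on_F_joint: "continuous_on (UNIV \<times> I) (\<lambda>z. F (fst z) (snd z))"
  by (rule continuous_on_times_by_charts)
    (use C1_on_imp_continuous_on[OF C1_on_Phi] in \<open>auto simp: \<Phi>_def[abs_def]\<close>)

lemma continuous_on_velocity_joint: "continuous_on (UNIV \<times> I) (\<lambda>z. velocity F (snd z) (fst z))"
proof (rule continuous_on_times_by_charts[where g = "\<lambda>p s. velocity F s p"])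
  fix c assume c: "c \<in> A"
  show "continuous_on ((snd c ` fst c) \<times> I) (\<lambda>z. velocity F (snd z) (chart_inv c (fst z)))"
    by (rule continuous_on_eq[OF C1_on_continuous_deriv[OF C1_on_Phi[OF c], of "(0, 1)"]])
      (auto simp: velocity_chart[OF c])
qed simp

lemma continuous_on_tdivg_joint:
  "continuous_on (UNIV \<times> I) (\<lambda>z. tdivg (\<lambda>q. F q (snd z)) (velocity F (snd z)) (fst z))"
  by (rule continuous_on_times_by_charts[where g = "\<lambda>p s. tdivg (\<lambda>q. F q s) (velocity F s) p"])
    (auto intro: continuous_on_tdiv_joint)

lemma continuous_on_density_ratio_joint:
  assumes t: "t \<in> I"
  shows "continuous_on (UNIV \<times> I) (\<lambda>z. density_ratio (\<lambda>q. F q t) (\<lambda>q. F q (snd z)) (fst z))"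
proof (rule continuous_on_times_by_charts[where g = "\<lambda>p s. density_ratio (\<lambda>q. F q t) (\<lambda>q. F q s) p"])
  fix c assume c: "c \<in> A"
  have "continuous_on ((snd c ` fst c) \<times> I) (\<lambda>z. volume_density c (\<lambda>q. F q t) (fst z))"
    by (intro continuous_on_compose2[OF C1_on_imp_continuous_on[OF C1_on_volume_density[OF immersion_slice[OF t] c]]]
        continuous_intros) auto
  then have "continuous_on ((snd c ` fst c) \<times> I)
      (\<lambda>z. volume_density c (\<lambda>q. F q (snd z)) (fst z) / volume_density c (\<lambda>q. F q t) (fst z))"
  proof (intro continuous_on_divide continuous_on_volume_density_joint c ballI)
    fix z assume "z \<in> (snd c ` fst c) \<times> I"
    then show "volume_density c (\<lambda>q. F q t) (fst z) \<noteq> 0"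
      using volume_density_pos[OF immersion_slice[OF t] c, of "fst z"] by auto
  qed
  then show "continuous_on ((snd c ` fst c) \<times> I)
      (\<lambda>z. density_ratio (\<lambda>q. F q t) (\<lambda>q. F q (snd z)) (chart_inv c (fst z)))"
  proof (rule continuous_on_eq)
    fix z assume "z \<in> (snd c ` fst c) \<times> I"
    then have z: "fst z \<in> snd c ` fst c" "snd z \<in> I" by auto
    show "volume_density c (\<lambda>q. F q (snd z)) (fst z) / volume_density c (\<lambda>q. F q t) (fst z) =
        density_ratio (\<lambda>q. F q t) (\<lambda>q. F q (snd z)) (chart_inv c (fst z))"
      using density_ratio_chart[OF immersion_slice[OF t] immersion_slice[OF z(2)] c chart_inv_in[OF c z(1)]]
      by (simp add: chart_inv_right[OF c z(1)])
  qed
qed simp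

end

section \<open>The first variation of the weighted volume\<close>

text \<open>Expands |y - \<xi>|^2/2 and groups all terms other than |y|^2/2 into the function whose
  gradient appears in the result. The parameter \<open>w\<close> is |\<xi>|^2/2 for the first volume
  and 0 for the barred one, so one argument treats both.\<close>

definition quadratic_potential :: "('a \<Rightarrow> real^'n) \<Rightarrow> ('a \<Rightarrow> real) \<Rightarrow> ('a \<Rightarrow> real^'n) \<Rightarrow> 'a \<Rightarrow> real" where
  "quadratic_potential \<xi> w y p = y p \<bullet> y p / 2 - (y p \<bullet> \<xi> p - w p)"

lemma potential_eq_quadratic: "potential \<xi> = quadratic_potential \<xi> (\<lambda>p. (norm (\<xi> p))\<^sup>2 / 2)"
  by (simp add: fun_eq_iff potential_def quadratic_potential_def power2_norm_eq_inner inner_diff_left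
      inner_diff_right inner_commute field_simps)

lemma potential_bar_eq_quadratic: "potential_bar \<xi> = quadratic_potential \<xi> (\<lambda>p. 0)"
  by (simp add: fun_eq_iff potential_bar_def potential_eq_quadratic quadratic_potential_def)

text \<open>\<open>K\<close> is one compact set serving all times; this uniformity in time is what
  provides a dominating function independent of the parameter.\<close>

locale weighted_variation = smooth_variation A x \<epsilon> F
  for A :: "('a::{t2_space, second_countable_topology}, 'm::finite) chart set"
    and x :: "'a \<Rightarrow> real^'n" and \<epsilon> F +
  fixes \<xi> :: "'a \<Rightarrow> real^'n" and w :: "'a \<Rightarrow> real" and K :: "'a set"
  assumes C1_xi: "C1_map \<xi>" and C1_w: "C1_map w" and K: "compact K"
    and velocity_off: "\<And>t p. t \<in> {-\<epsilon><..<\<epsilon>} \<Longrightarrow> p \<notin> K \<Longrightarrow> velocity F t p = 0"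
begin

text \<open>The density of exp(-f_s) dV_s with respect to the fixed measure dV_t.\<close>

definition weight :: "real \<Rightarrow> real \<Rightarrow> 'a \<Rightarrow> real" where
  "weight t s p = exp (- quadratic_potential \<xi> w (\<lambda>q. F q s) p) * density_ratio (\<lambda>q. F q t) (\<lambda>q. F q s) p"

text \<open>The factor in parentheses is the logarithmic derivative of the weight: the volume ratio
  contributes the divergence and the exponential contributes the inner product.\<close>

definition weight_deriv :: "real \<Rightarrow> real \<Rightarrow> 'a \<Rightarrow> real" where
  "weight_deriv t s p = weight t s p *
     (tdivg (\<lambda>q. F q s) (velocity F s) p - (F p s - \<xi> p) \<bullet> velocity F s p)"

lemma has_real_derivative_weight:
  assumes t: "t \<in> I" and s: "s \<in> I"
  shows "((\<lambda>s. weight t s p) has_real_derivative weight_deriv t s p) (at s)"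
proof -
  let ?\<eta> = "velocity F s p"
  note FV = has_vector_derivative_F[OF s, of p]
  have "((\<lambda>s. F p s \<bullet> F p s) has_vector_derivative F p s \<bullet> ?\<eta> + ?\<eta> \<bullet> F p s) (at s)"
    by (rule bounded_bilinear.has_vector_derivative[OF bounded_bilinear_inner FV FV])
  then have FF: "((\<lambda>s. F p s \<bullet> F p s) has_real_derivative 2 * (F p s \<bullet> ?\<eta>)) (at s)"
    by (simp add: has_real_derivative_iff_has_vector_derivative inner_commute)
  have "((\<lambda>s. F p s \<bullet> \<xi> p) has_vector_derivative F p s \<bullet> 0 + ?\<eta> \<bullet> \<xi> p) (at s)"
    by (rule bounded_bilinear.has_vector_derivative[OF bounded_bilinear_inner FV has_vector_derivative_const])
  then have Fx: "((\<lambda>s. F p s \<bullet> \<xi> p) has_real_derivative ?\<eta> \<bullet> \<xi> p) (at s)"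
    by (simp add: has_real_derivative_iff_has_vector_derivative)
  have "((\<lambda>s. - quadratic_potential \<xi> w (\<lambda>q. F q s) p) has_real_derivative
      - ((2 * (F p s \<bullet> ?\<eta>)) / 2 - (?\<eta> \<bullet> \<xi> p - 0))) (at s)"
    unfolding quadratic_potential_def
    by (intro DERIV_minus DERIV_diff DERIV_cdivide FF Fx DERIV_const)
  then have e: "((\<lambda>s. exp (- quadratic_potential \<xi> w (\<lambda>q. F q s) p)) has_real_derivative
      exp (- quadratic_potential \<xi> w (\<lambda>q. F q s) p) * - ((F p s - \<xi> p) \<bullet> ?\<eta>)) (at s)"
    by (rule DERIV_chain2[OF DERIV_exp, THEN DERIV_cong])
      (simp add: inner_diff_left inner_diff_right inner_commute)
  have r: "((\<lambda>s. density_ratio (\<lambda>q. F q t) (\<lambda>q. F q s) p) has_real_derivative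
      density_ratio (\<lambda>q. F q t) (\<lambda>q. F q s) p * tdivg (\<lambda>q. F q s) (velocity F s) p) (at s)"
    unfolding density_ratio_def
    by (rule DERIV_cdivide[OF has_real_derivative_volume_density[OF chart_at_in s], THEN DERIV_cong]) simp
  show ?thesis
    unfolding weight_def
    by (rule DERIV_mult[OF e r, THEN DERIV_cong]) (simp add: weight_deriv_def weight_def algebra_simps)
qed

lemma weight_deriv_off:
  assumes s: "s \<in> I" and p: "p \<notin> K"
  shows "weight_deriv t s p = 0"
  using tdivg_zero_off_support[OF compact_imp_closed[OF K] velocity_off[OF s] p] velocity_off[OF s p]
  by (simp add: weight_deriv_def)

lemma continuous_on_weight_joint:
  assumes t: "t \<in> I"
  shows "continuous_on (UNIV \<times> I) (\<lambda>z. weight t (snd z) (fst z))"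
proof -
  have fst: "continuous_on (UNIV \<times> I) (\<lambda>z. h (fst z))" if "continuous_on UNIV h" for h :: "'a \<Rightarrow> 'z::topological_space"
    by (rule continuous_on_compose2[OF that continuous_on_fst[OF continuous_on_id]]) auto
  show ?thesis
    unfolding weight_def quadratic_potential_def
    by (intro continuous_on_mult continuous_on_exp continuous_on_minus continuous_on_diff continuous_on_divide
        continuous_on_inner continuous_on_const continuous_on_F_joint continuous_on_density_ratio_joint[OF t]
        fst C1_map_imp_continuous_on[OF C1_xi] C1_map_imp_continuous_on[OF C1_w]) simp
qed

lemma continuous_on_weight_deriv_joint:
  assumes t: "t \<in> I"
  shows "continuous_on (UNIV \<times> I) (\<lambda>z. weight_deriv t (snd z) (fst z))"
proof -
  have "continuous_on (UNIV \<times> I) (\<lambda>z. \<xi> (fst z))"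
    by (rule continuous_on_compose2[OF C1_map_imp_continuous_on[OF C1_xi] continuous_on_fst[OF continuous_on_id]]) auto
  then show ?thesis
    unfolding weight_deriv_def
    by (intro continuous_on_mult continuous_on_diff continuous_on_inner continuous_on_weight_joint[OF t]
        continuous_on_tdivg_joint continuous_on_F_joint continuous_on_velocity_joint)
qed

lemma continuous_on_slice:
  assumes "s \<in> I" "continuous_on (UNIV \<times> I) (\<lambda>z. h (snd z) (fst z))"
  shows "continuous_on UNIV (h s)"
proof -
  have "continuous_on UNIV (\<lambda>p. (p, s))" by (intro continuous_intros)
  moreover have "range (\<lambda>p. (p, s)) \<subseteq> UNIV \<times> I" using assms(1) by auto
  ultimately show ?thesis
    using continuous_on_compose2[OF assms(2), of UNIV "\<lambda>p. (p, s)"] by simp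
qed

lemma weight_measurable: "t \<in> I \<Longrightarrow> s \<in> I \<Longrightarrow> weight t s \<in> borel_measurable borel"
  by (intro borel_measurable_continuous_onI continuous_on_slice continuous_on_weight_joint)

lemma weight_deriv_measurable: "t \<in> I \<Longrightarrow> s \<in> I \<Longrightarrow> weight_deriv t s \<in> borel_measurable borel"
  by (intro borel_measurable_continuous_onI continuous_on_slice continuous_on_weight_deriv_joint)

text \<open>A jointly continuous function is bounded on the compact product of \<open>K\<close> with
  a closed time interval inside \<open>I\<close>, and the derivative is zero off
  \<open>K\<close>.\<close>

lemma weight_deriv_bound:
  assumes t: "t \<in> I"
  shows "\<exists>\<delta> B. \<delta> > 0 \<and> (\<forall>s. \<bar>s - t\<bar> < \<delta> \<longrightarrow> s \<in> I) \<and>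
    (\<forall>s p. \<bar>s - t\<bar> < \<delta> \<longrightarrow> \<bar>weight_deriv t s p\<bar> \<le> B * indicator K p)"
proof -
  obtain \<delta> where \<delta>: "\<delta> > 0" "cball t \<delta> \<subseteq> I"
    using open_contains_cball[THEN iffD1, OF open_greaterThanLessThan, rule_format, OF t] by auto
  have "compact ((\<lambda>z. weight_deriv t (snd z) (fst z)) ` (K \<times> cball t \<delta>))"
    using \<delta>(2) by (intro compact_continuous_image continuous_on_subset[OF continuous_on_weight_deriv_joint[OF t]]
        compact_Times K compact_cball) auto
  from compact_imp_bounded[OF this]
  obtain B where B: "\<forall>b\<in>(\<lambda>z. weight_deriv t (snd z) (fst z)) ` (K \<times> cball t \<delta>). norm b \<le> B"
    unfolding bounded_iff by (elim exE)
  show ?thesis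
  proof (rule exI[of _ \<delta>], rule exI[of _ B], intro conjI allI impI)
    show I: "s \<in> I" if "\<bar>s - t\<bar> < \<delta>" for s
      using that \<delta>(2) by (intro subsetD[OF \<delta>(2)]) (simp add: dist_real_def)
    fix s p assume s: "\<bar>s - t\<bar> < \<delta>"
    show "\<bar>weight_deriv t s p\<bar> \<le> B * indicator K p"
    proof (cases "p \<in> K")
      case True
      then have "weight_deriv t s p \<in> (\<lambda>z. weight_deriv t (snd z) (fst z)) ` (K \<times> cball t \<delta>)"
        using s by (intro image_eqI[of _ _ "(p, s)"]) (auto simp: dist_real_def)
      with B True show ?thesis by auto
    qed (simp add: weight_deriv_off[OF I[OF s]])
  qed (rule \<delta>(1))
qed

lemma integrable_indicator_K:
  assumes y: "immersion A y"
  shows "integrable (volume_measure A y) (\<lambda>p. B * indicator K p :: real)"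
  using emeasure_volume_measure_compact[OF y K] compact_imp_closed[OF K]
  by (intro integrable_mult_right integrable_real_indicator) (auto simp: volume_measure_works(1)[OF y])

lemma integrable_weight_deriv:
  assumes t: "t \<in> I"
  shows "integrable (volume_measure A (\<lambda>q. F q t)) (weight_deriv t t)"
proof -
  note y = immersion_slice[OF t]
  from weight_deriv_bound[OF t] obtain \<delta> B where B0: "\<delta> > 0" "\<forall>s. \<bar>s - t\<bar> < \<delta> \<longrightarrow> s \<in> I"
    "\<forall>s p. \<bar>s - t\<bar> < \<delta> \<longrightarrow> \<bar>weight_deriv t s p\<bar> \<le> B * indicator K p"
    by (elim exE conjE)
  note B = B0(1) B0(2)[rule_format] B0(3)[rule_format]
  show ?thesis
  proof (rule Bochner_Integration.integrable_bound[OF integrable_indicator_K[OF y, of B]])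
    show "weight_deriv t t \<in> borel_measurable (volume_measure A (\<lambda>q. F q t))"
      using weight_deriv_measurable[OF t t] by (simp add: measurable_volume_measure[OF y])
    show "AE p in volume_measure A (\<lambda>q. F q t). norm (weight_deriv t t p) \<le> norm (B * indicator K p)"
      using B(1) by (intro AE_I2) (simp add: order_trans[OF B(3)])
  qed
qed

lemma weight_self:
  assumes t: "t \<in> I"
  shows "weight t t p = exp (- quadratic_potential \<xi> w (\<lambda>q. F q t) p)"
  using volume_density_pos[OF immersion_slice[OF t] chart_at_in(1)[of p] imageI[OF chart_at_in(2)]]
  by (simp add: weight_def density_ratio_def)

text \<open>The integrand of the theorem without its minus sign, for both potentials at
  once.\<close>

definition first_variation :: "real \<Rightarrow> 'a \<Rightarrow> real" where
  "first_variation t p = (let y = (\<lambda>q. F q t) in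
     ((mean_curvature A y p + normal_part A y p (y p) - \<xi> p)
       + induced_gradient A y (\<lambda>q. y q \<bullet> \<xi> q - w q) p) \<bullet> velocity F t p * exp (- quadratic_potential \<xi> w y p))"

lemma has_bochner_integral_weight_deriv:
  assumes t: "t \<in> I"
  shows "has_bochner_integral (volume_measure A (\<lambda>q. F q t)) (weight_deriv t t)
    (- (LINT p|volume_measure A (\<lambda>q. F q t). first_variation t p))"
proof -
  let ?y = "\<lambda>q. F q t"
  let ?f = "quadratic_potential \<xi> w ?y"
  let ?\<eta> = "velocity F t"
  let ?Z = "\<lambda>q. exp (- ?f q) *\<^sub>R (?\<eta> q - normal_part A ?y q (?\<eta> q))"
  note y = immersion_slice[OF t]
  note Y = immersion_C1_map[OF y]
  have k: "C1_map (\<lambda>q. ?y q \<bullet> \<xi> q - w q)"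
    by (intro C1_map_diff C1_map_inner Y C1_xi C1_w)
  have f: "C1_map ?f"
    using C1_map_diff[OF C1_map_mult[OF C1_map_inner[OF Y Y] C1_map_const[of "1/2"]] k]
    by (simp add: quadratic_potential_def[abs_def])
  have id: "weight_deriv t t p = tdivg ?y ?Z p - first_variation t p" for p
    using first_variation_integrand[OF y C1_map_velocity[OF t] k, of ?f p \<xi>]
    by (simp add: quadratic_potential_def weight_deriv_def weight_self[OF t] first_variation_def Let_def)
  have "has_bochner_integral (volume_measure A ?y) (tdivg ?y ?Z) 0"
  proof (rule divergence_theorem[OF y K])
    show "C1_map ?Z"
      by (intro C1_map_scaleR C1_map_exp C1_map_minus f C1_map_tangent_part y C1_map_velocity t)
    show "?Z p \<in> tangent_space A ?y p" for p
      by (rule tangent_space_scaleR[OF y tangent_part_in[OF y]])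
    show "?Z p = 0" if "p \<notin> K" for p
      using velocity_off[OF t that] normal_part_chart[OF y chart_at_in, of p 0] by simp
  qed
  then have Z: "integrable (volume_measure A ?y) (tdivg ?y ?Z)" "(LINT p|volume_measure A ?y. tdivg ?y ?Z p) = 0"
    by (simp_all add: has_bochner_integral_iff)
  \<comment> \<open>The integrand containing the mean curvature is handled as a difference of two
    functions known to be integrable, so its measurability needs no separate argument.\<close>
  have "(LINT p|volume_measure A ?y. first_variation t p) =
      (LINT p|volume_measure A ?y. tdivg ?y ?Z p - weight_deriv t t p)"
    by (simp add: id)
  also have "\<dots> = - (LINT p|volume_measure A ?y. weight_deriv t t p)"
    using Z integrable_weight_deriv[OF t] by simp
  finally show ?thesis using integrable_weight_deriv[OF t] by (simp add: has_bochner_integral_iff)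
qed

text \<open>Moves the time dependence from the measure into the integrand, as differentiation under
  the integral sign demands.\<close>

lemma weighted_volume_eq:
  assumes t: "t \<in> I" and s: "s \<in> I"
  shows "weighted_volume A (quadratic_potential \<xi> w) (\<lambda>p. F p s) =
    (\<integral>\<^sup>+p. ennreal (weight t s p) \<partial>volume_measure A (\<lambda>q. F q t))"
proof -
  let ?r = "density_ratio (\<lambda>q. F q t) (\<lambda>q. F q s)"
  note y = immersion_slice[OF t] and z = immersion_slice[OF s]
  have r: "?r \<in> borel_measurable borel"
    by (intro borel_measurable_continuous_onI continuous_on_density_ratio y z)
  \<comment> \<open>Measurability of the exponential is recovered by dividing the weight by the
    positive volume ratio.\<close>
  have "(\<lambda>p. weight t s p / ?r p) \<in> borel_measurable borel"
    using r weight_measurable[OF t s] by simp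
  then have e: "(\<lambda>p. exp (- quadratic_potential \<xi> w (\<lambda>p. F p s) p)) \<in> borel_measurable borel"
    using density_ratio_pos[OF y z] by (simp add: weight_def less_imp_neq[THEN not_sym])
  have "weighted_volume A (quadratic_potential \<xi> w) (\<lambda>p. F p s) =
    (\<integral>\<^sup>+p. ennreal (?r p) * ennreal (exp (- quadratic_potential \<xi> w (\<lambda>p. F p s) p)) \<partial>volume_measure A (\<lambda>q. F q t))"
    unfolding weighted_volume_def volume_measure_eq_density[OF y z]
    using r e by (intro nn_integral_density) (simp_all add: measurable_volume_measure[OF y])
  also have "\<dots> = (\<integral>\<^sup>+p. ennreal (weight t s p) \<partial>volume_measure A (\<lambda>q. F q t))"
    using density_ratio_pos[OF y z]
    by (intro nn_integral_cong) (simp add: weight_def ennreal_mult'[symmetric] mult.commute less_imp_le)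
  finally show ?thesis .
qed

lemma weight_nonneg: "t \<in> I \<Longrightarrow> s \<in> I \<Longrightarrow> weight t s p \<ge> 0"
  using density_ratio_pos[OF immersion_slice immersion_slice, of t s p] by (simp add: weight_def)

text \<open>In both cases the derivative is the integral of \<open>weight_deriv t t\<close>. For
  finite volume this is differentiation under the integral sign; for infinite volume it is the
  convention itself, and the integral exists by compact support.\<close>

theorem has_weighted_volume_deriv_first_variation:
  assumes t: "t \<in> I"
  shows "has_weighted_volume_deriv A (quadratic_potential \<xi> w) F t
    (- (LINT p|volume_measure A (\<lambda>q. F q t). first_variation t p))"
proof -
  let ?V = "volume_measure A (\<lambda>q. F q t)"
  let ?D = "- (LINT p|?V. first_variation t p)"
  note y = immersion_slice[OF t]
  note hb = has_bochner_integral_weight_deriv[OF t]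
  have D: "?D = (LINT p|?V. weight_deriv t t p)"
    using hb by (simp add: has_bochner_integral_iff)
  show ?thesis
  proof (cases "weighted_volume A (quadratic_potential \<xi> w) (\<lambda>p. F p t) < \<infinity>")
    case True
    from weight_deriv_bound[OF t] obtain \<delta> B where B0: "\<delta> > 0" "\<forall>s. \<bar>s - t\<bar> < \<delta> \<longrightarrow> s \<in> I"
      "\<forall>s p. \<bar>s - t\<bar> < \<delta> \<longrightarrow> \<bar>weight_deriv t s p\<bar> \<le> B * indicator K p"
      by (elim exE conjE)
    note B = B0(1) B0(2)[rule_format] B0(3)[rule_format]
    have m: "weight t s \<in> borel_measurable ?V" if "\<bar>s - t\<bar> < \<delta>" for s
      using weight_measurable[OF t B(2)[OF that]] by (simp add: measurable_volume_measure[OF y])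
    have "(\<integral>\<^sup>+p. ennreal (norm (weight t t p)) \<partial>?V) < \<infinity>"
      using True weight_nonneg[OF t t] by (simp add: weighted_volume_eq[OF t t])
    then have int_t: "integrable ?V (weight t t)"
      using m[of t] B(1) by (simp add: integrable_iff_bounded)
    \<comment> \<open>Finiteness is given at time \<open>t\<close> only; the derivative bound
      carries it to nearby times, so that \<open>enn2real\<close> does not collapse an infinite
      volume to 0 there.\<close>
    have int: "integrable ?V (weight t s)" if s: "\<bar>s - t\<bar> < \<delta>" for s
      by (rule integrable_of_deriv_bound[where f = "\<lambda>p s. weight t s p", OF has_real_derivative_weight[OF t B(2)] B(3)
          integrable_indicator_K[OF y] int_t m[OF s] s])
    have "((\<lambda>s. LINT p|?V. weight t s p) has_real_derivative (LINT p|?V. weight_deriv t t p)) (at t)"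
    proof (rule has_real_derivative_integral[where f = "\<lambda>p s. weight t s p", OF B(1) _ B(3) integrable_indicator_K[OF y] int])
      show "((\<lambda>s. weight t s p) has_real_derivative weight_deriv t s p) (at s)" if "\<bar>s - t\<bar> < \<delta>" for s p
        by (rule has_real_derivative_weight[OF t B(2)[OF that]])
      show "weight_deriv t t \<in> borel_measurable ?V"
        using weight_deriv_measurable[OF t t] by (simp add: measurable_volume_measure[OF y])
    qed
    then have "((\<lambda>s. enn2real (weighted_volume A (quadratic_potential \<xi> w) (\<lambda>p. F p s))) has_real_derivative
        (LINT p|?V. weight_deriv t t p)) (at t)"
    proof (rule has_field_derivative_transform_within_open[of _ _ _ "ball t \<delta>"])
      fix s assume "s \<in> ball t \<delta>"
      then have s: "\<bar>s - t\<bar> < \<delta>" by (simp add: dist_real_def abs_minus_commute)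
      have "weighted_volume A (quadratic_potential \<xi> w) (\<lambda>p. F p s) = ennreal (LINT p|?V. weight t s p)"
        unfolding weighted_volume_eq[OF t B(2)[OF s]]
        by (intro nn_integral_eq_integral int s AE_I2 weight_nonneg t B(2))
      then show "(LINT p|?V. weight t s p) = enn2real (weighted_volume A (quadratic_potential \<xi> w) (\<lambda>p. F p s))"
        by (simp add: integral_nonneg_AE weight_nonneg[OF t B(2)[OF s]])
    qed (use B(1) in auto)
    then show ?thesis using True D by (simp add: has_weighted_volume_deriv_def)
  next
    case False
    \<comment> \<open>The function differentiated in the definition is literally
      \<open>weight t\<close>, whose derivative has already been computed.\<close>
    have "weighted_volume_element_deriv A (quadratic_potential \<xi> w) F t p = weight_deriv t t p" for p
      using DERIV_imp_deriv[OF has_real_derivative_weight[OF t t, of p]]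
      by (simp add: weighted_volume_element_deriv_def Let_def weight_def density_ratio_def)
    then have "weighted_volume_element_deriv A (quadratic_potential \<xi> w) F t = weight_deriv t t" by (rule ext)
    then show ?thesis using False hb by (simp add: has_weighted_volume_deriv_def)
  qed
qed

text \<open>The gradient term is tangent and therefore invisible to a normal velocity.\<close>

lemma first_variation_normal:
  assumes t: "t \<in> I" and n: "normal_field A (\<lambda>q. F q t) (velocity F t)"
  shows "first_variation t p = (mean_curvature A (\<lambda>q. F q t) p + normal_part A (\<lambda>q. F q t) p (F p t) - \<xi> p)
    \<bullet> velocity F t p * exp (- quadratic_potential \<xi> w (\<lambda>q. F q t) p)"
proof -
  let ?y = "\<lambda>q. F q t"
  have k: "C1_map (\<lambda>q. ?y q \<bullet> \<xi> q - w q)"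
    by (intro C1_map_diff C1_map_inner immersion_C1_map immersion_slice t C1_xi C1_w)
  have "velocity F t p \<bullet> induced_gradient A ?y (\<lambda>q. ?y q \<bullet> \<xi> q - w q) p = 0"
    using n induced_gradient_works(1)[OF immersion_slice[OF t] k, of p]
    unfolding normal_field_def orthogonal_def by blast
  then have "induced_gradient A ?y (\<lambda>q. ?y q \<bullet> \<xi> q - w q) p \<bullet> velocity F t p = 0"
    by (simp only: inner_commute)
  then show ?thesis by (simp add: first_variation_def Let_def inner_add_left)
qed

end

theorem theorem4p1:
  fixes A :: "('a::{t2_space, second_countable_topology}, 'm::finite) chart set"
    and \<xi> x :: "'a \<Rightarrow> real^'n"
    and F :: "'a \<Rightarrow> real \<Rightarrow> real^'n"
    and \<epsilon> :: real and p :: nat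
  assumes dim: "CARD('n) = CARD('m) + p"
    and atlas: "smooth_atlas A"
    and xi: "smooth_map A \<xi>"
    and x: "immersion A x"
    and eps: "\<epsilon> > 0"
    and F: "compact_variation A x \<epsilon> F"
  shows "(\<forall>t\<in>{-\<epsilon><..<\<epsilon>}. let y = (\<lambda>q. F q t) in
      has_weighted_volume_deriv A (potential \<xi>) F t
        (- (LINT q|volume_measure A y.
              ((mean_curvature A y q + normal_part A y q (y q) - \<xi> q)
                + induced_gradient A y (\<lambda>r. y r \<bullet> \<xi> r - (norm (\<xi> r))\<^sup>2 / 2) q)
              \<bullet> velocity F t q * exp (- potential \<xi> y q)))
      \<and> has_weighted_volume_deriv A (potential_bar \<xi>) F t
        (- (LINT q|volume_measure A y.
              ((mean_curvature A y q + normal_part A y q (y q) - \<xi> q)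
                + induced_gradient A y (\<lambda>r. y r \<bullet> \<xi> r) q)
              \<bullet> velocity F t q * exp (- potential_bar \<xi> y q))))
    \<and> (let \<eta> = velocity F 0 in normal_field A x \<eta> \<longrightarrow>
      has_weighted_volume_deriv A (potential \<xi>) F 0
        (- (LINT q|volume_measure A x.
              (mean_curvature A x q + normal_part A x q (x q) - \<xi> q) \<bullet> \<eta> q
              * exp (- potential \<xi> x q)))
      \<and> has_weighted_volume_deriv A (potential_bar \<xi>) F 0
        (- (LINT q|volume_measure A x.
              (mean_curvature A x q + normal_part A x q (x q) - \<xi> q) \<bullet> \<eta> q
              * exp (- potential_bar \<xi> x q))))"
proof -
  interpret M: smooth_manifold A by (standard) (rule atlas)
  have var: "variation A x \<epsilon> F" using F by (simp add: compact_variation_def)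
  obtain B where B: "compact (closure B)"
    "\<And>t. t \<in> {-\<epsilon><..<\<epsilon>} \<Longrightarrow> closure {p. velocity F t p \<noteq> 0} \<subseteq> B"
    using F by (auto simp: compact_variation_def)
  \<comment> \<open>The relatively compact open set \<open>B\<close> is replaced by its compact
    closure, which serves as the common support set.\<close>
  have off: "velocity F t p = 0" if "t \<in> {-\<epsilon><..<\<epsilon>}" "p \<notin> closure B" for t p
  proof (rule ccontr)
    assume "velocity F t p \<noteq> 0"
    then have "p \<in> closure {p. velocity F t p \<noteq> 0}" by (intro subsetD[OF closure_subset]) simp
    with B(2)[OF that(1)] that(2) closure_subset[of B] show False by blast
  qed
  have xiC: "M.C1_map \<xi>" by (rule M.smooth_map_imp_C1_map[OF xi])
  have "M.C1_map (\<lambda>p. (norm (\<xi> p))\<^sup>2 / 2)"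
    using M.C1_map_mult[OF M.C1_map_inner[OF xiC xiC] M.C1_map_const[of "1/2"]]
    by (simp add: power2_norm_eq_inner)
  \<comment> \<open>\<open>P\<close> treats the potential and \<open>Q\<close> the barred one; they
    differ only in the correction |\<xi>|^2/2, respectively 0.\<close>
  then interpret P: weighted_variation A x \<epsilon> F \<xi> "\<lambda>p. (norm (\<xi> p))\<^sup>2 / 2" "closure B"
    using var xiC B(1) off by unfold_locales
  interpret Q: weighted_variation A x \<epsilon> F \<xi> "\<lambda>p. 0" "closure B"
    using var xiC B(1) off M.C1_map_const by unfold_locales
  have x0: "(\<lambda>q. F q 0) = x" "\<And>q. F q 0 = x q"
    using var by (auto simp: variation_def)
  have 0: "0 \<in> {-\<epsilon><..<\<epsilon>}" using eps by simp
  note dP = P.has_weighted_volume_deriv_first_variation[folded potential_eq_quadratic]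
  note dQ = Q.has_weighted_volume_deriv_first_variation[folded potential_bar_eq_quadratic]
  have "has_weighted_volume_deriv A (potential \<xi>) F 0
        (- (LINT q|volume_measure A x.
              (mean_curvature A x q + normal_part A x q (x q) - \<xi> q) \<bullet> velocity F 0 q
              * exp (- potential \<xi> x q)))"
    "has_weighted_volume_deriv A (potential_bar \<xi>) F 0
        (- (LINT q|volume_measure A x.
              (mean_curvature A x q + normal_part A x q (x q) - \<xi> q) \<bullet> velocity F 0 q
              * exp (- potential_bar \<xi> x q)))"
    if "normal_field A x (velocity F 0)"
    using dP[OF 0] dQ[OF 0] P.first_variation_normal[OF 0] Q.first_variation_normal[OF 0] that
    by (simp_all add: x0 potential_eq_quadratic potential_bar_eq_quadratic)
  then show ?thesis
    using dP dQ
    by (simp add: Let_def P.first_variation_def Q.first_variation_def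
        potential_eq_quadratic[symmetric] potential_bar_eq_quadratic[symmetric])
qed

end
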